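(* Let $\{G_t,t\ge0\}$ be a one-dimensional centered Gaussian process with covariance $R(s,t)=\mathbb{E}(G_sG_t)$, let $\mu\in\mathbb{R}$ and $\sigma>0$ be parameters, and let $X_t=\mu t+\sigma G_t$, $t\ge0$. Let $0<t_1<t_2<\cdots$ be observation times, and for each $n$ let $\mathbf t=(t_1,\dots,t_n)'$, $\mathbf X=(X_{t_1},\dots,X_{t_n})'$, $\mathbf V=(R(t_i,t_j))_{i,j=1}^n$, and $$\hat\mu_n=\frac{\mathbf t'\mathbf V^{-1}\mathbf X}{\mathbf t'\mathbf V^{-1}\mathbf t},\qquad \hat\sigma_n^2=\frac1n\,\frac{(\mathbf X'\mathbf V^{-1}\mathbf X)(\mathbf t'\mathbf V^{-1}\mathbf t)-(\mathbf t'\mathbf V^{-1}\mathbf X)^2}{\mathbf t'\mathbf V^{-1}\mathbf t}.$$ Consider the hypotheses: (H1) there exist constants $c>0$ and $\beta<2$ such that $\mathbb{E}(G_t^2)\le c\,t^\beta$ for all $t\ge0$; (H2) for every $n$, the matrix $\mathbf V=(R(t_i,t_j))_{i,j=1}^n$ is strictly positive definite. Then: \begin{enumerate} \item If (H1) and (H2) hold and there are constants $\alpha>0$, $c_1,c_2>0$ with $c_1n^\alpha\le t_n\le c_2 n^\alpha$ for all $n$, then $\hat\mu_n\to\mu$ almost surely and $\hat\sigma_n^2\to\sigma^2$ almost surely as $n\to\infty$. \item If (H2) holds, then with $Y_n=\frac1\sigma\sqrt{\mathbf t'\mathbf V^{-1}\mathbf t}\,(\hat\mu_n-\mu)$ and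 $Q_n=\frac{1}{\sigma^2}\sqrt{\frac n2}\,(\hat\sigma_n^2-\sigma^2)$, the random vector $(Y_n,Q_n)'$ converges in law to the bivariate standard normal distribution $N_2(\mathbf 0,\mathbf I)$ as $n\to\infty$, where $\mathbf I$ is the $2\times2$ identity matrix. \item If (H2) holds, then with $\bar Q_n=Q_n-\mathbb{E}(Q_n)$ and $\Phi(z)=\int_{-\infty}^z\frac{1}{\sqrt{2\pi}}e^{-x^2/2}\,dx$: (a) $\sup_{z\in\mathbb{R}}|P(\bar Q_n\le z)-\Phi(z)|\le \frac{\sqrt{2n-1}}{n}$ for every $n$; (b) for every $z\in\mathbb{R}$, $\frac{n}{\sqrt{2n-1}}\left(P(\bar Q_n\le z)-\Phi(z)\right)\to -\frac{\Phi^{(3)}(z)}{3}$ as $n\to\infty$, where $\Phi^{(3)}(z)=(z^2-1)\frac{1}{\sqrt{2\pi}}e^{-z^2/2}$ is the third derivative of $\Phi$; (c) there exist a constant $C\in(0,1)$ and an integer $n_0\ge1$ such that for every $n\ge n_0$, $$C<\frac{n}{\sqrt{2n-1}}\sup_{z\in\mathbb{R}}|P(\bar Q_n\le z)-\Phi(z)|\le 1.$$ \end{enumerate}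
   Context: $X_t$ is the solution of $dX_t=\mu\,dt+\sigma\,dG_t$, $X_0=0$; $\hat\mu_n,\hat\sigma_n^2$ are the maximum likelihood estimators of $\mu,\sigma^2$ based on $\mathbf X$. A symmetric matrix is strictly positive definite if its quadratic form is positive on nonzero vectors. *)

theory Defs
  imports "HOL-Probability.Probability"
begin

text \<open>Finite matrices/vectors of size n are represented as functions on nat,
  only entries with indices < n being relevant (index i corresponds to t_(i+1)).\<close>

definition centered_gaussian_process :: "'a measure \<Rightarrow> (real \<Rightarrow> 'a \<Rightarrow> real) \<Rightarrow> bool" where
  "centered_gaussian_process M G \<longleftrightarrow>
     (\<forall>t\<ge>0. G t \<in> borel_measurable M) \<and>
     (\<forall>(n::nat) (s::nat \<Rightarrow> real) (a::nat \<Rightarrow> real). (\<forall>i<n. s i \<ge> 0) \<longrightarrow>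
        (let Z = (\<lambda>\<omega>. \<Sum>i<n. a i * G (s i) \<omega>) in
          (AE \<omega> in M. Z \<omega> = 0) \<or>
          (\<exists>v>0. distributed M lborel Z (normal_density 0 v))))"

definition Rcov :: "'a measure \<Rightarrow> (real \<Rightarrow> 'a \<Rightarrow> real) \<Rightarrow> real \<Rightarrow> real \<Rightarrow> real" where
  "Rcov M G s t = (\<integral>\<omega>. G s \<omega> * G t \<omega> \<partial>M)"

definition Vmat :: "'a measure \<Rightarrow> (real \<Rightarrow> 'a \<Rightarrow> real) \<Rightarrow> (nat \<Rightarrow> real) \<Rightarrow> nat \<Rightarrow> nat \<Rightarrow> real" where
  "Vmat M G ts i j = Rcov M G (ts (Suc i)) (ts (Suc j))"

definition is_inverse_mat :: "nat \<Rightarrow> (nat \<Rightarrow> nat \<Rightarrow> real) \<Rightarrow> (nat \<Rightarrow> nat \<Rightarrow> real) \<Rightarrow> bool" where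
  "is_inverse_mat n A B \<longleftrightarrow>
     (\<forall>i<n. \<forall>j<n. (\<Sum>k<n. A i k * B k j) = (if i = j then 1 else 0)) \<and>
     (\<forall>i<n. \<forall>j<n. (\<Sum>k<n. B i k * A k j) = (if i = j then 1 else 0))"

definition inv_mat :: "nat \<Rightarrow> (nat \<Rightarrow> nat \<Rightarrow> real) \<Rightarrow> (nat \<Rightarrow> nat \<Rightarrow> real)" where
  "inv_mat n A = (SOME B. is_inverse_mat n A B)"

definition bilin :: "nat \<Rightarrow> (nat \<Rightarrow> real) \<Rightarrow> (nat \<Rightarrow> nat \<Rightarrow> real) \<Rightarrow> (nat \<Rightarrow> real) \<Rightarrow> real" where
  "bilin n u B v = (\<Sum>i<n. \<Sum>j<n. u i * B i j * v j)"

definition strictly_pos_def :: "nat \<Rightarrow> (nat \<Rightarrow> nat \<Rightarrow> real) \<Rightarrow> bool" where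
  "strictly_pos_def n A \<longleftrightarrow> (\<forall>i<n. \<forall>j<n. A i j = A j i) \<and>
     (\<forall>x. (\<exists>i<n. x i \<noteq> 0) \<longrightarrow> bilin n x A x > 0)"

definition tvec :: "(nat \<Rightarrow> real) \<Rightarrow> nat \<Rightarrow> real" where
  "tvec ts i = ts (Suc i)"

definition Xvec :: "(real \<Rightarrow> 'a \<Rightarrow> real) \<Rightarrow> real \<Rightarrow> real \<Rightarrow> (nat \<Rightarrow> real) \<Rightarrow> 'a \<Rightarrow> nat \<Rightarrow> real" where
  "Xvec G mu sg ts \<omega> i = mu * ts (Suc i) + sg * G (ts (Suc i)) \<omega>"

definition mu_hat :: "'a measure \<Rightarrow> (real \<Rightarrow> 'a \<Rightarrow> real) \<Rightarrow> real \<Rightarrow> real \<Rightarrow> (nat \<Rightarrow> real) \<Rightarrow> nat \<Rightarrow> 'a \<Rightarrow> real" where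
  "mu_hat M G mu sg ts n \<omega> =
     (let W = inv_mat n (Vmat M G ts); t = tvec ts; X = Xvec G mu sg ts \<omega> in
       bilin n t W X / bilin n t W t)"

definition sigma2_hat :: "'a measure \<Rightarrow> (real \<Rightarrow> 'a \<Rightarrow> real) \<Rightarrow> real \<Rightarrow> real \<Rightarrow> (nat \<Rightarrow> real) \<Rightarrow> nat \<Rightarrow> 'a \<Rightarrow> real" where
  "sigma2_hat M G mu sg ts n \<omega> =
     (let W = inv_mat n (Vmat M G ts); t = tvec ts; X = Xvec G mu sg ts \<omega> in
       (1 / real n) * ((bilin n X W X * bilin n t W t - (bilin n t W X)\<^sup>2) / bilin n t W t))"

definition Yn :: "'a measure \<Rightarrow> (real \<Rightarrow> 'a \<Rightarrow> real) \<Rightarrow> real \<Rightarrow> real \<Rightarrow> (nat \<Rightarrow> real) \<Rightarrow> nat \<Rightarrow> 'a \<Rightarrow> real" where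
  "Yn M G mu sg ts n \<omega> =
     (1 / sg) * sqrt (bilin n (tvec ts) (inv_mat n (Vmat M G ts)) (tvec ts))
       * (mu_hat M G mu sg ts n \<omega> - mu)"

definition Qn :: "'a measure \<Rightarrow> (real \<Rightarrow> 'a \<Rightarrow> real) \<Rightarrow> real \<Rightarrow> real \<Rightarrow> (nat \<Rightarrow> real) \<Rightarrow> nat \<Rightarrow> 'a \<Rightarrow> real" where
  "Qn M G mu sg ts n \<omega> =
     (1 / sg\<^sup>2) * sqrt (real n / 2) * (sigma2_hat M G mu sg ts n \<omega> - sg\<^sup>2)"

definition Qbar :: "'a measure \<Rightarrow> (real \<Rightarrow> 'a \<Rightarrow> real) \<Rightarrow> real \<Rightarrow> real \<Rightarrow> (nat \<Rightarrow> real) \<Rightarrow> nat \<Rightarrow> 'a \<Rightarrow> real" where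
  "Qbar M G mu sg ts n \<omega> =
     Qn M G mu sg ts n \<omega> - (\<integral>\<omega>'. Qn M G mu sg ts n \<omega>' \<partial>M)"

definition Phi :: "real \<Rightarrow> real" where
  "Phi z = (LBINT x:{..z}. std_normal_density x)"

definition conv_law_std_normal2 :: "'a measure \<Rightarrow> (nat \<Rightarrow> 'a \<Rightarrow> real) \<Rightarrow> (nat \<Rightarrow> 'a \<Rightarrow> real) \<Rightarrow> bool" where
  "conv_law_std_normal2 M Y Q \<longleftrightarrow>
     (\<forall>f :: real \<times> real \<Rightarrow> real. continuous_on UNIV f \<and> bounded (range f) \<longrightarrow>
        (\<lambda>n. \<integral>\<omega>. f (Y n \<omega>, Q n \<omega>) \<partial>M) \<longlonglongrightarrow>
        (\<integral>p. f p * (std_normal_density (fst p) * std_normal_density (snd p)) \<partial>(lborel :: (real \<times> real) measure)))"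

end

theory Submission
  imports Defs "HOL-Real_Asymp.Real_Asymp"
begin

text \<open>For fixed $n$, choose a basis of $\mathbb{R}^n$ that is orthonormal for the quadratic form of the
  covariance matrix and all of whose members except the first are orthogonal to the vector of observation
  times. The coordinates $Z_0, \ldots, Z_{n-1}$ of the Gaussian vector in this basis are independent standard
  normal, and the estimators become $\hat\mu_n - \mu = \sigma Z_0 / \sqrt{T_n}$ with $T_n$ the Fisher
  information, and $n \hat\sigma_n^2 / \sigma^2 = \chi^2 := Z_1^2 + \ldots + Z_{n-1}^2$. Hence
  $Y_n = Z_0$ exactly, it is independent of $Q_n$, and the centred $Q_n$ is
  $F = (\chi^2 - (n - 1)) / \sqrt{2n}$.

  Integration by parts in each coordinate gives $E[F f(F)] = E[(\chi^2/n) f'(F)]$. Taking for $f$ the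
  solution $f_z$ of Stein's equation yields
  $P(F \le z) - \Phi(z) = E[f_z'(F)(1 - \chi^2/n)]$. The bound $|f_z'| \le 1$ and the Cauchy--Schwarz
  inequality give the Berry--Esseen bound, hence the central limit theorem. Since
  $1 - \chi^2/n = 1/n - \sqrt{2/n} F$, the rescaled difference converges to $- E[N f_z'(N)]$ for a
  standard normal $N$, which is computed explicitly.

  Consistency follows from summability of high moments; for $\hat\mu_n$ it uses the Cauchy--Schwarz
  bound $T_n \ge t_n^2 / E[G_{t_n}^2]$.\<close>

section \<open>Orthonormal families for a positive definite form\<close>

text \<open>\<open>centered_gaussian_process\<close> speaks only of single linear combinations, so
  independence of the coordinates has to be read off from the laws of their combinations.
  Orthonormality is what makes the variance of a combination the sum of its squared coefficients.
  The basis depends on n, and no relation between the coordinates for different n is established.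
  They form a triangular array, so almost sure convergence rests on moment bounds row by row and not
  on the law of large numbers for one i.i.d. sequence. The derivative of f_z jumps at z. This is why
  the calculus lemmas tolerate a finite exceptional set, and why the limit of E[F f_z'(F)] needs a
  form of weak convergence for integrands that are unbounded and discontinuous at one point. The
  factor sqrt(2n) does not give F variance one, because the sum of squares has n - 1 degrees of
  freedom. The mismatch leaves the deterministic term 1/n in 1 - chi^2/n, and it is visible in the
  numerator 2n - 1 of the bound.\<close>

text \<open>The only dimension count of the development: it yields both a further vector orthogonal
  to given ones and the linear dependence of n + 1 vectors in dimension n.\<close>

lemma homogeneous_system_nontrivial:
  fixes L :: "nat \<Rightarrow> 'i \<Rightarrow> real"
  assumes "finite I" "k < card I"
  shows "\<exists>x. (\<exists>i\<in>I. x i \<noteq> 0) \<and> (\<forall>j<k. (\<Sum>i\<in>I. L j i * x i) = 0)"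
  using assms
proof (induction k arbitrary: I L)
  case 0
  then have "I \<noteq> {}" by auto
  then show ?case by (intro exI[of _ "\<lambda>_. 1"]) auto
next
  case (Suc k)
  show ?case
  proof (cases "\<forall>i\<in>I. L k i = 0")
    case True
    have "k < card I" using Suc.prems by simp
    from Suc.IH[OF Suc.prems(1) this, of L] obtain x where
      x: "\<exists>i\<in>I. x i \<noteq> 0" "\<forall>j<k. (\<Sum>i\<in>I. L j i * x i) = 0" by blast
    moreover have "(\<Sum>i\<in>I. L k i * x i) = 0" using True by simp
    ultimately show ?thesis by (metis less_Suc_eq)
  next
    case False
    then obtain p where p: "p \<in> I" "L k p \<noteq> 0" by blast
    define I' where "I' = I - {p}"
    have I': "finite I'" "k < card I'" "p \<notin> I'" "I = insert p I'"
      using Suc.prems p by (auto simp: I'_def)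
    \<comment> \<open>Equation k is solved for the pivot unknown p and substituted into the other
      equations; the induction then runs on one unknown and one equation fewer.\<close>
    from Suc.IH[OF I'(1,2), of "\<lambda>j i. L j i - L j p * L k i / L k p"] obtain x where
      x: "\<exists>i\<in>I'. x i \<noteq> 0"
         "\<And>j. j < k \<Longrightarrow> (\<Sum>i\<in>I'. (L j i - L j p * L k i / L k p) * x i) = 0" by blast
    define s where "s = (\<Sum>i\<in>I'. L k i * x i)"
    define y where "y = x(p := - s / L k p)"
    have y: "(\<Sum>i\<in>I. L j i * y i) = L j p * (- s / L k p) + (\<Sum>i\<in>I'. L j i * x i)" for j
      using I' by (auto simp: y_def intro!: sum.cong)
    have "(\<Sum>i\<in>I. L j i * y i) = 0" if "j < Suc k" for j
    proof (cases "j = k")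
      case True
      then show ?thesis using p by (simp add: y s_def)
    next
      case False
      then have "j < k" using that by simp
      from x(2)[OF this] have "(\<Sum>i\<in>I'. L j i * x i) = L j p / L k p * s"
        by (simp add: algebra_simps sum_subtractf sum_distrib_left s_def)
      then show ?thesis by (simp add: y)
    qed
    moreover have "\<exists>i\<in>I. y i \<noteq> 0" using x(1) I' by (auto simp: y_def)
    ultimately show ?thesis by blast
  qed
qed

definition dotn :: "nat \<Rightarrow> (nat \<Rightarrow> real) \<Rightarrow> (nat \<Rightarrow> real) \<Rightarrow> real" where
  "dotn n u v = (\<Sum>i<n. u i * v i)"

definition orthonormal_family :: "nat \<Rightarrow> (nat \<Rightarrow> nat \<Rightarrow> real) \<Rightarrow> (nat \<Rightarrow> nat \<Rightarrow> real) \<Rightarrow> bool" where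
  "orthonormal_family n V a \<longleftrightarrow> (\<forall>i<n. \<forall>j<n. bilin n (a i) V (a j) = (if i = j then 1 else 0))"

lemma bilin_as_dotn_right: "bilin n u V v = dotn n (\<lambda>j. \<Sum>i<n. u i * V i j) v"
  unfolding bilin_def dotn_def by (subst sum.swap) (simp add: sum_distrib_right)

lemma bilin_as_dotn_left: "bilin n u V v = dotn n u (\<lambda>i. dotn n (V i) v)"
  unfolding bilin_def dotn_def by (simp add: sum_distrib_left mult.assoc)

lemma bilin_scale: "bilin n (\<lambda>i. c * u i) V (\<lambda>i. d * v i) = c * d * bilin n u V v"
  unfolding bilin_def by (simp add: sum_distrib_left mult_ac)

lemma bilin_commute:
  assumes "strictly_pos_def n V"
  shows "bilin n u V v = bilin n v V u"
  using assms unfolding bilin_def strictly_pos_def_def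
  by (subst sum.swap) (auto intro!: sum.cong)

text \<open>A Gram-Schmidt step without projections: fewer conditions than dimensions leave a
  nonzero solution, and definiteness allows it to be normalised.\<close>

lemma unit_vector_in_kernel:
  assumes V: "strictly_pos_def n V" and k: "k < n"
  shows "\<exists>x. bilin n x V x = 1 \<and> (\<forall>j<k. dotn n (L j) x = 0)"
proof -
  obtain x where x: "\<exists>i\<in>{..<n}. x i \<noteq> 0" "\<forall>j<k. dotn n (L j) x = 0"
    using homogeneous_system_nontrivial[of "{..<n}" k L] k unfolding dotn_def by auto
  then have pos: "bilin n x V x > 0" using V unfolding strictly_pos_def_def by auto
  define c where "c = 1 / sqrt (bilin n x V x)"
  have "bilin n (\<lambda>i. c * x i) V (\<lambda>i. c * x i) = 1"
    unfolding bilin_scale c_def using pos by (simp add: field_simps)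
  moreover have "dotn n (L j) (\<lambda>i. c * x i) = c * dotn n (L j) x" for j
    unfolding dotn_def by (simp add: sum_distrib_left mult_ac)
  ultimately show ?thesis using x(2) by (intro exI[of _ "\<lambda>i. c * x i"]) simp
qed

text \<open>The vector with index 0 is constructed last. The others carry the extra condition of
  annihilating t, so only n - 1 of them can be demanded; one direction V-orthogonal to all of them
  remains. Its sign is chosen so that \<open>dotn n (a 0) t\<close> will be the square root of the
  information and not its negative.\<close>

lemma orthonormal_family_adapted:
  assumes V: "strictly_pos_def n V" and n: "1 \<le> n"
  shows "\<exists>a. orthonormal_family n V a \<and> (\<forall>i. 0 < i \<and> i < n \<longrightarrow> dotn n (a i) t = 0) \<and> 0 \<le> dotn n (a 0) t"
proof -
  have "\<exists>a. (\<forall>i\<in>{1..k}. \<forall>j\<in>{1..k}. bilin n (a i) V (a j) = (if i = j then 1 else 0)) \<and>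
            (\<forall>i\<in>{1..k}. dotn n (a i) t = 0)" if "k < n" for k
    using that
  proof (induction k)
    case 0
    then show ?case by simp
  next
    case (Suc k)
    then obtain a where a: "\<forall>i\<in>{1..k}. \<forall>j\<in>{1..k}. bilin n (a i) V (a j) = (if i = j then 1 else 0)"
      "\<forall>i\<in>{1..k}. dotn n (a i) t = 0" by auto
    \<comment> \<open>Row 0 encodes the ordinary dot product with t, and row j encodes
      V-orthogonality to \<open>a j\<close>. Index 0 is taken by t, which is why the family built
      here starts at 1.\<close>
    define L where "L = (\<lambda>j. if j = 0 then t else (\<lambda>l. \<Sum>i<n. a j i * V i l))"
    obtain x where x: "bilin n x V x = 1" "\<And>j. j < Suc k \<Longrightarrow> dotn n (L j) x = 0"
      using unit_vector_in_kernel[OF V Suc.prems, of L] by auto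
    have x0: "dotn n x t = 0" using x(2)[of 0] unfolding L_def dotn_def by (simp add: mult.commute)
    have xa: "bilin n (a j) V x = 0" if "j \<in> {1..k}" for j
      using x(2)[of j] that unfolding L_def bilin_as_dotn_right by auto
    then have ax: "bilin n x V (a j) = 0" if "j \<in> {1..k}" for j
      using that bilin_commute[OF V] by metis
    have "\<forall>i\<in>{1..Suc k}. \<forall>j\<in>{1..Suc k}. bilin n ((a(Suc k := x)) i) V ((a(Suc k := x)) j) = (if i = j then 1 else 0)"
      using a(1) x(1) xa ax by (auto simp: atLeastAtMostSuc_conv)
    moreover have "\<forall>i\<in>{1..Suc k}. dotn n ((a(Suc k := x)) i) t = 0"
      using a(2) x0 by (auto simp: atLeastAtMostSuc_conv)
    ultimately show ?case by blast
  qed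
  from this[of "n - 1"] n obtain a where
    a: "\<forall>i\<in>{1..n-1}. \<forall>j\<in>{1..n-1}. bilin n (a i) V (a j) = (if i = j then 1 else 0)"
       "\<forall>i\<in>{1..n-1}. dotn n (a i) t = 0" by auto
  define L where "L = (\<lambda>j l. \<Sum>i<n. a (Suc j) i * V i l)"
  obtain x where x: "bilin n x V x = 1" "\<And>j. j < n - 1 \<Longrightarrow> dotn n (L j) x = 0"
    using unit_vector_in_kernel[OF V, of "n - 1" L] n by auto
  have xa: "bilin n (a j) V x = 0" if "0 < j" "j < n" for j
    using x(2)[of "j - 1"] that unfolding L_def bilin_as_dotn_right by auto
  define c :: real where "c = (if 0 \<le> dotn n x t then 1 else -1)"
  define y where "y = (\<lambda>i. c * x i)"
  have cc: "c * c = 1" by (simp add: c_def)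
  have yy: "bilin n y V y = 1" unfolding y_def bilin_scale cc using x by simp
  have ya: "bilin n (a j) V y = 0" if "0 < j" "j < n" for j
    using xa[OF that] bilin_scale[of n 1 "a j" V c x] unfolding y_def by simp
  then have ay: "bilin n y V (a j) = 0" if "0 < j" "j < n" for j
    using that bilin_commute[OF V] by metis
  have "dotn n y t = c * dotn n x t" unfolding dotn_def y_def by (simp add: sum_distrib_left mult_ac)
  then have yt: "0 \<le> dotn n y t" by (auto simp: c_def)
  have "orthonormal_family n V (a(0 := y))"
    unfolding orthonormal_family_def using a(1) yy ya ay by (auto simp: Ball_def)
  then show ?thesis using a(2) yt by (intro exI[of _ "a(0 := y)"]) (auto simp: Ball_def)
qed

text \<open>Since $n + 1$ vectors in dimension $n$ are dependent, the $i$-th unit vector is the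
  combination of the $a_k$ with coefficients $(V a_k)_i$.\<close>
lemma orthonormal_family_complete:
  assumes V: "strictly_pos_def n V" and a: "orthonormal_family n V a" and i: "i < n" and l: "l < n"
  shows "(\<Sum>k<n. dotn n (V i) (a k) * a k l) = (if l = i then 1 else 0)"
proof -
  define e where "e = (\<lambda>l. if l = i then 1 else (0::real))"
  define L where "L = (\<lambda>l k. if k = n then e l else a k l)"
  obtain x where x: "\<exists>k\<in>{..n}. x k \<noteq> 0" "\<And>l. l < n \<Longrightarrow> (\<Sum>k\<in>{..n}. L l k * x k) = 0"
    using homogeneous_system_nontrivial[of "{..n}" n L] by auto
  have dep: "e l * x n + (\<Sum>k<n. a k l * x k) = 0" if "l < n" for l
    using x(2)[OF that] unfolding L_def by (simp add: lessThan_Suc_atMost[symmetric])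
  \<comment> \<open>Pairing the relation with V a_j removes every member of the family but the j-th.
    Hence \<open>x n = 0\<close> would make all coefficients vanish, and otherwise the relation can
    be solved for e.\<close>
  have inner: "bilin n e V (a j) * x n + x j = 0" if j: "j < n" for j
  proof -
    have "0 = (\<Sum>l<n. (e l * x n + (\<Sum>k<n. a k l * x k)) * dotn n (V l) (a j))"
      using dep by simp
    also have "\<dots> = bilin n e V (a j) * x n + (\<Sum>l<n. \<Sum>k<n. x k * (a k l * dotn n (V l) (a j)))"
      unfolding bilin_as_dotn_left unfolding dotn_def[of n e]
      by (simp add: algebra_simps sum.distrib sum_distrib_right sum_distrib_left)
    also have "(\<Sum>l<n. \<Sum>k<n. x k * (a k l * dotn n (V l) (a j))) = (\<Sum>k<n. x k * bilin n (a k) V (a j))"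
      unfolding bilin_as_dotn_left unfolding dotn_def[of n "a _"]
      by (subst sum.swap) (simp add: sum_distrib_left)
    also have "\<dots> = (\<Sum>k<n. if k = j then x k else 0)"
      using a j unfolding orthonormal_family_def by (intro sum.cong) auto
    also have "\<dots> = x j" using j by simp
    finally show ?thesis by simp
  qed
  have xn: "x n \<noteq> 0"
  proof
    assume "x n = 0"
    then have "\<forall>k\<le>n. x k = 0" using inner by (metis add_cancel_right_left le_neq_implies_less mult_zero_right)
    then show False using x(1) by auto
  qed
  have ei: "bilin n e V (a j) = dotn n (V i) (a j)" for j
  proof -
    have "bilin n e V (a j) = (\<Sum>l<n. if l = i then dotn n (V l) (a j) else 0)"
      unfolding bilin_as_dotn_left unfolding dotn_def[of n e] by (intro sum.cong) (auto simp: e_def)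
    then show ?thesis using i by simp
  qed
  have xk: "x k = - (dotn n (V i) (a k) * x n)" if "k < n" for k
    using inner[OF that] unfolding ei by simp
  have "e l * x n + (\<Sum>k<n. a k l * - (dotn n (V i) (a k) * x n)) = 0"
    using dep[OF l] xk by (simp cong: sum.cong_simp)
  then have "(e l - (\<Sum>k<n. dotn n (V i) (a k) * a k l)) * x n = 0"
    by (simp add: algebra_simps sum_distrib_left sum_negf)
  then show ?thesis using xn unfolding e_def by simp
qed

text \<open>If A has the rows a_k, completeness says that V times A'A is the identity. The product
  in the other order follows by transposition, since both factors are symmetric.\<close>

lemma is_inverse_mat_orthonormal:
  assumes V: "strictly_pos_def n V" and a: "orthonormal_family n V a"
  shows "is_inverse_mat n V (\<lambda>i j. \<Sum>k<n. a k i * a k j)"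
proof -
  have sym: "V i j = V j i" if "i < n" "j < n" for i j
    using V that unfolding strictly_pos_def_def by blast
  have 1: "(\<Sum>l<n. V i l * (\<Sum>k<n. a k l * a k j)) = (if i = j then 1 else 0)" if "i < n" "j < n" for i j
  proof -
    have "(\<Sum>l<n. V i l * (\<Sum>k<n. a k l * a k j)) = (\<Sum>k<n. dotn n (V i) (a k) * a k j)"
      unfolding dotn_def by (simp add: sum_distrib_left sum_distrib_right mult.assoc) (rule sum.swap)
    then show ?thesis using orthonormal_family_complete[OF V a that] by auto
  qed
  have 2: "(\<Sum>l<n. (\<Sum>k<n. a k i * a k l) * V l j) = (if i = j then 1 else 0)" if "i < n" "j < n" for i j
  proof -
    have "(\<Sum>l<n. (\<Sum>k<n. a k i * a k l) * V l j) = (\<Sum>l<n. V j l * (\<Sum>k<n. a k l * a k i))"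
      using that by (intro sum.cong) (auto simp: sym mult_ac)
    then show ?thesis using 1[OF that(2,1)] by auto
  qed
  show ?thesis unfolding is_inverse_mat_def using 1 2 by blast
qed

text \<open>\<open>inv_mat\<close> is picked by \<open>SOME\<close>, and
  \<open>is_inverse_mat\<close> constrains only entries below n. Uniqueness in that range makes the
  chosen inverse computable.\<close>

lemma is_inverse_mat_unique:
  assumes B: "is_inverse_mat n V B" and C: "is_inverse_mat n V C" and i: "i < n" and j: "j < n"
  shows "B i j = C i j"
proof -
  have "B i j = (\<Sum>k<n. B i k * (\<Sum>l<n. V k l * C l j))"
  proof -
    have "(\<Sum>k<n. B i k * (\<Sum>l<n. V k l * C l j)) = (\<Sum>k<n. if k = j then B i k else 0)"
      using C j unfolding is_inverse_mat_def by (intro sum.cong) auto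
    then show ?thesis using j by simp
  qed
  also have "\<dots> = (\<Sum>l<n. (\<Sum>k<n. B i k * V k l) * C l j)"
    by (simp add: sum_distrib_left sum_distrib_right mult.assoc) (rule sum.swap)
  also have "\<dots> = (\<Sum>l<n. if l = i then C l j else 0)"
    using B i unfolding is_inverse_mat_def by (intro sum.cong) auto
  also have "\<dots> = C i j" using i by simp
  finally show ?thesis .
qed

text \<open>In the coordinates \<open>dotn n (a k)\<close> the inverse matrix acts as the identity,
  so every quadratic expression in the estimators becomes a sum over coordinates.\<close>

lemma bilin_inv_mat_orthonormal:
  assumes V: "strictly_pos_def n V" and a: "orthonormal_family n V a"
  shows "bilin n u (inv_mat n V) v = (\<Sum>k<n. dotn n (a k) u * dotn n (a k) v)"
proof -
  note inv = is_inverse_mat_orthonormal[OF V a]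
  have "is_inverse_mat n V (inv_mat n V)" unfolding inv_mat_def by (rule someI[of "is_inverse_mat n V"]) (rule inv)
  then have eq: "inv_mat n V i j = (\<Sum>k<n. a k i * a k j)" if "i < n" "j < n" for i j
    using is_inverse_mat_unique[OF _ inv that] by blast
  have "bilin n u (inv_mat n V) v = (\<Sum>i<n. \<Sum>j<n. u i * (\<Sum>k<n. a k i * a k j) * v j)"
    unfolding bilin_def by (intro sum.cong) (auto simp: eq)
  also have "\<dots> = (\<Sum>i<n. \<Sum>j<n. \<Sum>k<n. (a k i * u i) * (a k j * v j))"
    by (simp add: sum_distrib_left sum_distrib_right mult_ac)
  also have "\<dots> = (\<Sum>i<n. \<Sum>k<n. \<Sum>j<n. (a k i * u i) * (a k j * v j))"
    by (intro sum.cong refl sum.swap)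
  also have "\<dots> = (\<Sum>k<n. \<Sum>i<n. \<Sum>j<n. (a k i * u i) * (a k j * v j))" by (rule sum.swap)
  also have "\<dots> = (\<Sum>k<n. dotn n (a k) u * dotn n (a k) v)"
    unfolding dotn_def by (simp add: sum_product)
  finally show ?thesis .
qed

text \<open>\<open>t i\<close> is the pairing of row i of V with t in the form of the inverse
  matrix, and that row has squared length \<open>V i i\<close> there. In statistical terms, n
  observations carry at least the information of any single one. The bound serves both the
  positivity of the information and its growth.\<close>

lemma inv_mat_Cauchy_Schwarz:
  assumes V: "strictly_pos_def n V" and i: "i < n"
  shows "(t i)\<^sup>2 \<le> V i i * bilin n t (inv_mat n V) t"
proof -
  obtain a where a: "orthonormal_family n V a"
    using orthonormal_family_adapted[OF V] i by fastforce
  note complete = orthonormal_family_complete[OF V a i]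
  have expand: "(\<Sum>k<n. dotn n (V i) (a k) * dotn n (a k) y) = y i" for y
  proof -
    have "(\<Sum>k<n. dotn n (V i) (a k) * dotn n (a k) y) = (\<Sum>l<n. (\<Sum>k<n. dotn n (V i) (a k) * a k l) * y l)"
      unfolding dotn_def[of n "a _"] by (simp add: sum_distrib_left sum_distrib_right mult.assoc) (rule sum.swap)
    also have "\<dots> = (\<Sum>l<n. if l = i then y l else 0)" using complete by (intro sum.cong) auto
    finally show ?thesis using i by simp
  qed
  have "V i i = (\<Sum>k<n. (dotn n (V i) (a k))\<^sup>2)"
    using expand[of "V i"] by (simp add: power2_eq_square dotn_def mult.commute)
  moreover have "bilin n t (inv_mat n V) t = (\<Sum>k<n. (dotn n (a k) t)\<^sup>2)"
    unfolding bilin_inv_mat_orthonormal[OF V a] by (simp add: power2_eq_square)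
  ultimately show ?thesis
    using Cauchy_Schwarz_ineq_sum[of "\<lambda>k. dotn n (V i) (a k)" "\<lambda>k. dotn n (a k) t" "{..<n}"]
    by (simp add: expand)
qed

section \<open>Independence of jointly Gaussian coordinates\<close>

text \<open>A real form of the characteristic function: the phases 0 and -pi/2 recover its real and
  imaginary parts.\<close>

lemma std_normal_integral_cos:
  "(\<integral>x. cos (\<psi> + s * x) \<partial>std_normal_distribution) = cos \<psi> * exp (- s\<^sup>2 / 2)"
proof -
  interpret N: real_distribution std_normal_distribution by (rule real_dist_normal_dist)
  have int: "integrable std_normal_distribution (\<lambda>x. iexp (s * x))"
    by (rule N.integrable_iexp) auto
  have "(CLINT x|std_normal_distribution. iexp (s * x)) = complex_of_real (exp (- s\<^sup>2 / 2))"
    using char_std_normal_distribution unfolding char_def by (metis (no_types))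
  then have "(\<integral>x. Re (iexp (s * x)) \<partial>std_normal_distribution) = exp (- s\<^sup>2 / 2)"
            "(\<integral>x. Im (iexp (s * x)) \<partial>std_normal_distribution) = 0"
    using int by (simp_all del: Re_exp Im_exp)
  then have c: "(\<integral>x. cos (s * x) \<partial>std_normal_distribution) = exp (- s\<^sup>2 / 2)"
    and s: "(\<integral>x. sin (s * x) \<partial>std_normal_distribution) = 0"
    by (simp_all add: Re_exp Im_exp)
  have ic: "integrable std_normal_distribution (\<lambda>x. cos (s * x))"
    and si: "integrable std_normal_distribution (\<lambda>x. sin (s * x))"
    by (auto intro!: N.integrable_const_bound[where B=1])
  have "(\<integral>x. cos (\<psi> + s * x) \<partial>std_normal_distribution) =
        (\<integral>x. cos \<psi> * cos (s * x) - sin \<psi> * sin (s * x) \<partial>std_normal_distribution)"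
    by (simp add: cos_add)
  then show ?thesis using ic si by (simp add: c s)
qed

text \<open>Levy's uniqueness theorem applied to the law of $Z$ under the measure with density $w$.\<close>
lemma (in prob_space) weighted_std_normal_law:
  assumes Z[measurable]: "random_variable borel Z" and w[measurable]: "random_variable borel w"
    and w0: "\<And>\<omega>. 0 \<le> w \<omega>" and wB: "\<And>\<omega>. w \<omega> \<le> B"
    and cs: "\<And>\<psi> s. expectation (\<lambda>\<omega>. w \<omega> * cos (\<psi> + s * Z \<omega>)) = cos \<psi> * exp (- s\<^sup>2 / 2) * expectation w"
    and A[measurable]: "A \<in> sets borel"
  shows "expectation (\<lambda>\<omega>. w \<omega> * indicator A (Z \<omega>)) = expectation w * measure std_normal_distribution A"
proof -
  define c where "c = expectation w"
  have wint: "integrable M w" by (rule integrable_const_bound[where B=B]) (use w0 wB in auto)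
  have c0: "0 \<le> c" unfolding c_def using w0 by simp
  show ?thesis
  proof (cases "c = 0")
    case True
    then have "AE \<omega> in M. w \<omega> = 0"
      using integral_nonneg_eq_0_iff_AE[OF wint] w0 unfolding c_def by simp
    then have "expectation (\<lambda>\<omega>. w \<omega> * indicator A (Z \<omega>)) = expectation (\<lambda>_. 0)"
      by (intro integral_cong_AE) auto
    then show ?thesis using True unfolding c_def by simp
  next
    case False
    with c0 have c: "0 < c" by simp
    define D where "D = density M (\<lambda>\<omega>. ennreal (w \<omega> / c))"
    have wc: "0 \<le> w \<omega> / c" for \<omega> using w0 c by simp
    have D: "prob_space D"
    proof
      have "emeasure D (space D) = (\<integral>\<^sup>+\<omega>. ennreal (w \<omega> / c) \<partial>M)"
        unfolding D_def by (subst emeasure_density) (auto intro!: nn_integral_cong)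
      also have "\<dots> = ennreal (expectation (\<lambda>\<omega>. w \<omega> / c))"
        by (intro nn_integral_eq_integral) (use wint wc in auto)
      also have "\<dots> = 1" using c by (simp add: c_def[symmetric])
      finally show "emeasure D (space D) = 1" .
    qed
    interpret D: prob_space D by fact
    have Zm: "Z \<in> borel_measurable D" unfolding D_def by simp
    define N where "N = distr D borel Z"
    interpret N: real_distribution N unfolding N_def using Zm by (rule D.real_distribution_distr)
    have "char N s = char std_normal_distribution s" for s
    proof -
      have iw: "integrable M (\<lambda>\<omega>. (w \<omega> / c) *\<^sub>R iexp (s * Z \<omega>))"
        by (rule integrable_const_bound[where B="B / c"]) (use wc wB c in \<open>auto simp: divide_right_mono w0\<close>)
      have "char N s = (CLINT \<omega>|D. iexp (s * Z \<omega>))"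
        unfolding char_def N_def using Zm by (simp add: integral_distr)
      also have "\<dots> = (CLINT \<omega>|M. (w \<omega> / c) *\<^sub>R iexp (s * Z \<omega>))"
        unfolding D_def by (rule integral_density) (use wc in auto)
      also have "\<dots> = complex_of_real (exp (- s\<^sup>2 / 2))"
      proof (rule complex_eqI)
        have "Re (CLINT \<omega>|M. (w \<omega> / c) *\<^sub>R iexp (s * Z \<omega>)) = expectation (\<lambda>\<omega>. Re ((w \<omega> / c) *\<^sub>R iexp (s * Z \<omega>)))"
          using integral_Re[OF iw] by simp
        also have "\<dots> = expectation (\<lambda>\<omega>. w \<omega> * cos (0 + s * Z \<omega>) / c)" by (simp add: Re_exp)
        also have "\<dots> = exp (- s\<^sup>2 / 2)" using cs[of 0 s] c by (simp add: c_def[symmetric])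
        finally show "Re (CLINT \<omega>|M. (w \<omega> / c) *\<^sub>R iexp (s * Z \<omega>)) = Re (complex_of_real (exp (- s\<^sup>2 / 2)))"
          by simp
        have "Im (CLINT \<omega>|M. (w \<omega> / c) *\<^sub>R iexp (s * Z \<omega>)) = expectation (\<lambda>\<omega>. Im ((w \<omega> / c) *\<^sub>R iexp (s * Z \<omega>)))"
          using integral_Im[OF iw] by simp
        also have "\<dots> = expectation (\<lambda>\<omega>. w \<omega> * cos (- (pi/2) + s * Z \<omega>) / c)"
          by (simp add: Im_exp cos_diff)
        also have "\<dots> = 0" using cs[of "-(pi/2)" s] by simp
        finally show "Im (CLINT \<omega>|M. (w \<omega> / c) *\<^sub>R iexp (s * Z \<omega>)) = Im (complex_of_real (exp (- s\<^sup>2 / 2)))"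
          by simp
      qed
      finally show ?thesis by (simp add: char_std_normal_distribution)
    qed
    then have "N = std_normal_distribution"
      by (intro Levy_uniqueness) (auto simp: N.real_distribution_axioms real_dist_normal_dist)
    then have "measure std_normal_distribution A = (\<integral>x. indicator A x \<partial>N)" by simp
    also have "\<dots> = (\<integral>\<omega>. indicator A (Z \<omega>) \<partial>D)"
      unfolding N_def by (rule integral_distr) (use Zm in auto)
    also have "\<dots> = expectation (\<lambda>\<omega>. (w \<omega> / c) *\<^sub>R indicator A (Z \<omega>))"
      unfolding D_def by (rule integral_density) (use wc in auto)
    also have "\<dots> = expectation (\<lambda>\<omega>. w \<omega> * indicator A (Z \<omega>)) / c"
      by simp
    finally show ?thesis using c by (simp add: field_simps c_def)
  qed
qed

text \<open>The coordinates are handled one at a time: the indicators of the coordinates already treated,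
  multiplied by $1 + \cos(\varphi + \ldots)$, form a nonnegative weight for the next one. The free phase
  $\varphi$ covers sine and cosine simultaneously.\<close>
lemma (in prob_space) std_normal_product_formula:
  fixes Z :: "nat \<Rightarrow> 'a \<Rightarrow> real"
  assumes Z[measurable]: "\<And>i. random_variable borel (Z i)"
    and cs: "\<And>\<phi> c. expectation (\<lambda>\<omega>. cos (\<phi> + (\<Sum>i<n. c i * Z i \<omega>))) = cos \<phi> * exp (- (\<Sum>i<n. (c i)\<^sup>2) / 2)"
    and A[measurable]: "\<And>i. A i \<in> sets borel"
    and k: "k \<le> n"
  shows "expectation (\<lambda>\<omega>. (\<Prod>i<k. indicator (A i) (Z i \<omega>)) * cos (\<phi> + (\<Sum>i\<in>{k..<n}. c i * Z i \<omega>))) =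
    (\<Prod>i<k. measure std_normal_distribution (A i)) * (cos \<phi> * exp (- (\<Sum>i\<in>{k..<n}. (c i)\<^sup>2) / 2))"
  using k
proof (induction k arbitrary: \<phi> c)
  case 0
  then show ?case using cs by (simp add: atLeast0LessThan)
next
  case (Suc k)
  define I where "I \<omega> = (\<Prod>i<k. indicator (A i) (Z i \<omega>) :: real)" for \<omega>
  define m where "m = (\<Prod>i<k. measure std_normal_distribution (A i))"
  define \<theta> where "\<theta> \<omega> = (\<Sum>i\<in>{Suc k..<n}. c i * Z i \<omega>)" for \<omega>
  define q where "q = (\<Sum>i\<in>{Suc k..<n}. (c i)\<^sup>2)"
  have [measurable]: "I \<in> borel_measurable M" "\<theta> \<in> borel_measurable M"
    unfolding I_def \<theta>_def by measurable
  have I01: "0 \<le> I \<omega>" "I \<omega> \<le> 1" for \<omega>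
    unfolding I_def by (auto intro!: prod_nonneg prod_le_1 simp: indicator_def)
  have split: "{k..<n} = insert k {Suc k..<n}" using Suc.prems by auto
  \<comment> \<open>The factor d scales the part of the phase that belongs to the later coordinates:
    d = 0 drops it, and d = 1 and d = -1 give the two terms of the product-to-sum formula for
    cosines.\<close>
  have IH: "expectation (\<lambda>\<omega>. I \<omega> * cos (\<psi> + s * Z k \<omega> + d * \<theta> \<omega>)) = m * (cos \<psi> * exp (- s\<^sup>2 / 2 - d\<^sup>2 * q / 2))" for \<psi> s d
  proof -
    have *: "(\<Sum>i\<in>{k..<n}. (if i = k then s else d * c i) * Z i \<omega>) = s * Z k \<omega> + d * \<theta> \<omega>" for \<omega>
      unfolding split \<theta>_def sum_distrib_left by (simp add: mult.assoc)
    have **: "(\<Sum>i\<in>{k..<n}. (if i = k then s else d * c i)\<^sup>2) = s\<^sup>2 + d\<^sup>2 * q"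
      unfolding split q_def sum_distrib_left by (simp add: power_mult_distrib)
    show ?thesis
      using Suc.IH[of \<psi> "\<lambda>i. if i = k then s else d * c i"] Suc.prems
      unfolding * ** I_def[symmetric] m_def[symmetric] by (simp add: add.assoc diff_divide_distrib)
  qed
  have bnd: "integrable M (\<lambda>\<omega>. I \<omega> * cos (f \<omega>))" if [measurable]: "f \<in> borel_measurable M" for f
    by (rule integrable_const_bound[where B=1]) (use I01 in \<open>auto simp: abs_mult intro!: mult_le_one\<close>)
  have int: "integrable M I" by (rule integrable_const_bound[where B=1]) (use I01 in auto)
  have EI: "expectation I = m" using IH[of 0 0 0] by simp
  define w where "w \<omega> = I \<omega> * (1 + cos (\<phi> + \<theta> \<omega>))" for \<omega>
  have [measurable]: "w \<in> borel_measurable M" unfolding w_def by measurable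
  have c1: "0 \<le> 1 + cos x" "1 + cos x \<le> 2" for x :: real
    using cos_ge_minus_one[of x] cos_le_one[of x] by linarith+
  have w0: "0 \<le> w \<omega>" "w \<omega> \<le> 2" for \<omega>
  proof -
    show "0 \<le> w \<omega>" unfolding w_def using I01 c1 by simp
    have "w \<omega> \<le> 1 * 2" unfolding w_def using I01 c1 by (intro mult_mono) auto
    then show "w \<omega> \<le> 2" by simp
  qed
  have Ew: "expectation w = m * (1 + cos \<phi> * exp (- q / 2))"
    using IH[of \<phi> 0 1] int bnd[of "\<lambda>\<omega>. \<phi> + \<theta> \<omega>"] EI unfolding w_def[abs_def] by (simp add: distrib_left)
  have wcs: "expectation (\<lambda>\<omega>. w \<omega> * cos (\<psi> + s * Z k \<omega>)) = cos \<psi> * exp (- s\<^sup>2 / 2) * expectation w" for \<psi> s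
  proof -
    have "w \<omega> * cos (\<psi> + s * Z k \<omega>) = I \<omega> * cos (\<psi> + s * Z k \<omega> + 0 * \<theta> \<omega>)
        + (I \<omega> * cos ((\<psi> + \<phi>) + s * Z k \<omega> + 1 * \<theta> \<omega>) + I \<omega> * cos ((\<psi> - \<phi>) + s * Z k \<omega> + (-1) * \<theta> \<omega>)) / 2" for \<omega>
    proof -
      have "cos (a + b) + cos (a - b) = 2 * cos a * cos b" for a b :: real
        by (simp add: cos_add cos_diff)
      from this[of "\<psi> + s * Z k \<omega>" "\<phi> + \<theta> \<omega>"]
      have e: "cos ((\<psi> + \<phi>) + s * Z k \<omega> + 1 * \<theta> \<omega>) + cos ((\<psi> - \<phi>) + s * Z k \<omega> + (-1) * \<theta> \<omega>)
        = 2 * cos (\<psi> + s * Z k \<omega>) * cos (\<phi> + \<theta> \<omega>)"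
        by (simp add: algebra_simps)
      show ?thesis unfolding w_def distrib_left[symmetric] e by (simp add: algebra_simps)
    qed
    moreover have i1: "integrable M (\<lambda>\<omega>. I \<omega> * cos (\<psi> + s * Z k \<omega> + 0 * \<theta> \<omega>))"
      and i2: "integrable M (\<lambda>\<omega>. I \<omega> * cos ((\<psi> + \<phi>) + s * Z k \<omega> + 1 * \<theta> \<omega>))"
      and i3: "integrable M (\<lambda>\<omega>. I \<omega> * cos ((\<psi> - \<phi>) + s * Z k \<omega> + (-1) * \<theta> \<omega>))"
      by (rule bnd, measurable)+
    ultimately have "expectation (\<lambda>\<omega>. w \<omega> * cos (\<psi> + s * Z k \<omega>)) =
      expectation (\<lambda>\<omega>. I \<omega> * cos (\<psi> + s * Z k \<omega> + 0 * \<theta> \<omega>)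
        + (I \<omega> * cos ((\<psi> + \<phi>) + s * Z k \<omega> + 1 * \<theta> \<omega>) + I \<omega> * cos ((\<psi> - \<phi>) + s * Z k \<omega> + (-1) * \<theta> \<omega>)) / 2)"
      by (simp only:)
    also have "\<dots> = expectation (\<lambda>\<omega>. I \<omega> * cos (\<psi> + s * Z k \<omega> + 0 * \<theta> \<omega>))
        + (expectation (\<lambda>\<omega>. I \<omega> * cos ((\<psi> + \<phi>) + s * Z k \<omega> + 1 * \<theta> \<omega>))
         + expectation (\<lambda>\<omega>. I \<omega> * cos ((\<psi> - \<phi>) + s * Z k \<omega> + (-1) * \<theta> \<omega>))) / 2"
      using i1 i2 i3 by (simp only: Bochner_Integration.integral_add Bochner_Integration.integral_divide_zero
          Bochner_Integration.integrable_add integrable_divide)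
    also have "\<dots> = m * (cos \<psi> * exp (- s\<^sup>2 / 2)) + (m * (cos (\<psi> + \<phi>) * exp (- s\<^sup>2 / 2 - q / 2))
         + m * (cos (\<psi> - \<phi>) * exp (- s\<^sup>2 / 2 - q / 2))) / 2"
      unfolding IH by simp
    also have "\<dots> = m * (cos \<psi> * exp (- s\<^sup>2 / 2)) + m * (cos \<psi> * cos \<phi> * (exp (- s\<^sup>2 / 2) * exp (- q / 2)))"
      by (simp add: cos_add cos_diff algebra_simps exp_add[symmetric])
    also have "\<dots> = cos \<psi> * exp (- s\<^sup>2 / 2) * expectation w" unfolding Ew by (simp add: algebra_simps)
    finally show ?thesis .
  qed
  have Ics: "expectation (\<lambda>\<omega>. I \<omega> * cos (\<psi> + s * Z k \<omega>)) = cos \<psi> * exp (- s\<^sup>2 / 2) * expectation I" for \<psi> s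
    using IH[of \<psi> s 0] EI by simp
  have 1: "expectation (\<lambda>\<omega>. w \<omega> * indicator (A k) (Z k \<omega>)) = expectation w * measure std_normal_distribution (A k)"
    using weighted_std_normal_law[OF _ _ w0 wcs] by simp
  have 2: "expectation (\<lambda>\<omega>. I \<omega> * indicator (A k) (Z k \<omega>)) = expectation I * measure std_normal_distribution (A k)"
    using weighted_std_normal_law[OF _ _ I01 Ics] by simp
  \<comment> \<open>The summand 1 served only to make the weight nonnegative; subtracting the
    identity for the weight I alone takes it out again.\<close>
  have "expectation (\<lambda>\<omega>. (\<Prod>i<Suc k. indicator (A i) (Z i \<omega>)) * cos (\<phi> + (\<Sum>i\<in>{Suc k..<n}. c i * Z i \<omega>))) =
    expectation (\<lambda>\<omega>. w \<omega> * indicator (A k) (Z k \<omega>) - I \<omega> * indicator (A k) (Z k \<omega>))"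
    by (rule arg_cong[where f=expectation]) (auto simp: w_def I_def \<theta>_def algebra_simps fun_eq_iff)
  also have "\<dots> = expectation (\<lambda>\<omega>. w \<omega> * indicator (A k) (Z k \<omega>)) - expectation (\<lambda>\<omega>. I \<omega> * indicator (A k) (Z k \<omega>))"
  proof (rule Bochner_Integration.integral_diff)
    show "integrable M (\<lambda>\<omega>. w \<omega> * indicator (A k) (Z k \<omega>))"
      by (rule integrable_const_bound[where B=2]) (use w0 in \<open>auto simp: indicator_def\<close>)
    show "integrable M (\<lambda>\<omega>. I \<omega> * indicator (A k) (Z k \<omega>))"
      by (rule integrable_const_bound[where B=1]) (use I01 in \<open>auto simp: indicator_def\<close>)
  qed
  also have "\<dots> = (\<Prod>i<Suc k. measure std_normal_distribution (A i)) * (cos \<phi> * exp (- q / 2))"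
    unfolding 1 2 Ew EI by (simp add: m_def algebra_simps)
  finally show ?case unfolding q_def by simp
qed

text \<open>With all n coordinates treated, the product formula has an empty phase and becomes
  multiplicativity of the joint law on rectangles. Rectangles with a single restricted side give the
  marginal laws.\<close>

lemma (in prob_space) indep_std_normal_of_char:
  fixes Z :: "nat \<Rightarrow> 'a \<Rightarrow> real"
  assumes Z[measurable]: "\<And>i. random_variable borel (Z i)"
    and cs: "\<And>\<phi> c. expectation (\<lambda>\<omega>. cos (\<phi> + (\<Sum>i<n. c i * Z i \<omega>))) = cos \<phi> * exp (- (\<Sum>i<n. (c i)\<^sup>2) / 2)"
    and n: "1 \<le> n"
  shows "indep_vars (\<lambda>_. borel) Z {..<n}"
    and "\<And>i. i < n \<Longrightarrow> distr M borel (Z i) = std_normal_distribution"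
proof -
  interpret N: real_distribution std_normal_distribution by (rule real_dist_normal_dist)
  have prod: "prob (\<Inter>j\<in>{..<n}. Z j -` A j \<inter> space M) = (\<Prod>j<n. measure std_normal_distribution (A j))"
    if [measurable]: "\<And>i. A i \<in> sets borel" for A
  proof -
    have [measurable]: "(\<Inter>j\<in>{..<n}. Z j -` A j \<inter> space M) \<in> sets M" using n by (intro sets.finite_INT) (auto simp: lessThan_empty_iff)
    have "prob (\<Inter>j\<in>{..<n}. Z j -` A j \<inter> space M) = expectation (indicator (\<Inter>j\<in>{..<n}. Z j -` A j \<inter> space M))"
      using n by (auto simp: lessThan_empty_iff)
    also have "\<dots> = expectation (\<lambda>\<omega>. (\<Prod>i<n. indicator (A i) (Z i \<omega>)) * cos (0 + (\<Sum>i\<in>{n..<n}. 0 * Z i \<omega>)))"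
    proof (rule Bochner_Integration.integral_cong)
      fix \<omega> assume \<omega>: "\<omega> \<in> space M"
      show "indicator (\<Inter>j\<in>{..<n}. Z j -` A j \<inter> space M) \<omega> = (\<Prod>i<n. indicator (A i) (Z i \<omega>)) * cos (0 + (\<Sum>i\<in>{n..<n}. 0 * Z i \<omega>))"
      proof (cases "\<forall>j<n. Z j \<omega> \<in> A j")
        case True then show ?thesis using \<omega> by (simp add: indicator_def)
      next
        case False
        then obtain j where "j < n" "Z j \<omega> \<notin> A j" by blast
        then have "(\<Prod>i<n. indicator (A i) (Z i \<omega>) :: real) = 0"
          by (intro prod_zero) (auto intro!: bexI[of _ j])
        then show ?thesis using False by (auto simp: indicator_def)
      qed
    qed simp
    also have "\<dots> = (\<Prod>j<n. measure std_normal_distribution (A j))"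
      using std_normal_product_formula[OF Z cs that order_refl, where \<phi>=0 and c="\<lambda>_. 0"] by simp
    finally show ?thesis .
  qed
  have marg: "prob (Z i -` B \<inter> space M) = measure std_normal_distribution B"
    if i: "i < n" and B[measurable]: "B \<in> sets borel" for i B
  proof -
    define A where "A j = (if j = i then B else UNIV)" for j :: nat
    have "(\<Inter>j\<in>{..<n}. Z j -` A j \<inter> space M) = Z i -` B \<inter> space M"
      using i by (auto simp: A_def split: if_splits)
    moreover have "(\<Prod>j<n. measure std_normal_distribution (A j)) = (\<Prod>j<n. if j = i then measure std_normal_distribution B else 1)"
      using N.prob_space by (intro prod.cong) (auto simp: A_def)
    ultimately show ?thesis using prod[of A] i by (simp add: A_def)
  qed
  show "distr M borel (Z i) = std_normal_distribution" if "i < n" for i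
  proof (rule measure_eqI)
    fix B assume "B \<in> sets (distr M borel (Z i))"
    then have B: "B \<in> sets borel" by simp
    then show "emeasure (distr M borel (Z i)) B = emeasure std_normal_distribution B"
      using marg[OF that B] by (simp add: emeasure_distr emeasure_eq_measure N.emeasure_eq_measure)
  qed simp
  show "indep_vars (\<lambda>_. borel) Z {..<n}"
  proof (subst indep_vars_finite[where E="\<lambda>_. sets borel"])
    show "\<forall>A\<in>{..<n} \<rightarrow> sets borel. prob (\<Inter>j\<in>{..<n}. Z j -` A j \<inter> space M) = (\<Prod>j<n. prob (Z j -` A j \<inter> space M))"
    proof
      fix A :: "nat \<Rightarrow> real set" assume A: "A \<in> {..<n} \<rightarrow> sets borel"
      \<comment> \<open>The sets are given only for indices below n, whereas \<open>prod\<close>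
        wants a measurable set for every index.\<close>
      define A' where "A' j = (if j < n then A j else {})" for j
      have "prob (\<Inter>j\<in>{..<n}. Z j -` A' j \<inter> space M) = (\<Prod>j<n. measure std_normal_distribution (A' j))"
        by (rule prod) (use A in \<open>auto simp: A'_def\<close>)
      also have "\<dots> = (\<Prod>j<n. prob (Z j -` A j \<inter> space M))"
        using A by (intro prod.cong) (auto simp: A'_def marg Pi_iff)
      finally show "prob (\<Inter>j\<in>{..<n}. Z j -` A j \<inter> space M) = (\<Prod>j<n. prob (Z j -` A j \<inter> space M))"
        by (simp add: A'_def cong: INF_cong_simp)
    qed
  qed (use n in \<open>auto simp: lessThan_empty_iff intro: sets.Int_stable simp: sets.sigma_sets_eq[of borel, simplified]\<close>)
qed

section \<open>Stein's equation for the normal distribution\<close>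

text \<open>The finite exceptional set admits functions with kinks, such as cut-offs by
  \<open>min\<close> and the Stein solution; continuity of H excludes jumps there. Symmetric
  intervals suffice for the limit because h is integrable.\<close>

lemma integral_deriv_real_line:
  fixes H h :: "real \<Rightarrow> real"
  assumes S: "finite S" and cont: "continuous_on UNIV H"
    and deriv: "\<And>x. x \<notin> S \<Longrightarrow> (H has_real_derivative h x) (at x)"
    and int: "integrable lborel h"
    and bot: "(H \<longlongrightarrow> A) at_bot" and top: "(H \<longlongrightarrow> B) at_top"
  shows "(\<integral>x. h x \<partial>lborel) = B - A"
proof -
  have [measurable]: "h \<in> borel_measurable borel" using borel_measurable_integrable[OF int] by simp
  define N where "N = (\<lambda>n::nat. {- real n..real n})"
  have "(LBINT x:N n. h x) = H (real n) - H (- real n)" for n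
  proof -
    have "(h has_integral (H (real n) - H (- real n))) (N n)"
      unfolding N_def using S
      by (rule fundamental_theorem_of_calculus_interior_strong)
        (auto intro: deriv continuous_on_subset[OF cont] simp: has_real_derivative_iff_has_vector_derivative[symmetric])
    moreover have "set_integrable lborel (N n) h"
      unfolding set_integrable_def N_def by (rule integrable_mult_indicator[OF _ int]) simp
    ultimately show ?thesis
      using set_borel_integral_eq_integral(2) integral_unique by metis
  qed
  moreover have "(\<lambda>n. (LBINT x:N n. h x)) \<longlonglongrightarrow> (\<integral>x. h x \<partial>lborel)"
    unfolding set_lebesgue_integral_def
  proof (rule integral_dominated_convergence[where w="\<lambda>x. norm (h x)"])
    show "AE x in lborel. (\<lambda>n. indicator (N n) x *\<^sub>R h x) \<longlonglongrightarrow> h x"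
    proof (rule AE_I2, rule tendsto_eventually)
      fix x :: real
      obtain n0 where "\<bar>x\<bar> \<le> real n0" using real_arch_simple by blast
      then show "\<forall>\<^sub>F n in sequentially. indicator (N n) x *\<^sub>R h x = h x"
        by (intro eventually_sequentiallyI[of n0]) (auto simp: N_def indicator_def)
    qed
  qed (use int in \<open>auto simp: N_def indicator_def\<close>)
  moreover have "(\<lambda>n. H (real n) - H (- real n)) \<longlonglongrightarrow> B - A"
    by (intro tendsto_diff filterlim_compose[OF top] filterlim_compose[OF bot] filterlim_real_sequentially
        filterlim_compose[OF filterlim_uminus_at_bot_at_top filterlim_real_sequentially])
  ultimately show ?thesis using LIMSEQ_unique by (metis (no_types, lifting) ext)
qed

abbreviation (input) "\<phi> \<equiv> std_normal_density"

section \<open>The normal density and its distribution function\<close>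

lemma std_normal_density_deriv:
  "(\<phi> has_real_derivative - x * \<phi> x) (at x)"
proof -
  have eq: "\<phi> = (\<lambda>x. (1 / sqrt (2 * pi)) * exp (- x\<^sup>2 / 2))"
    by (intro ext) (rule std_normal_density_def)
  show ?thesis unfolding eq by (rule derivative_eq_intros refl | simp)+
qed

lemma std_normal_density_continuous: "continuous_on S \<phi>"
  by (rule DERIV_continuous_on[OF has_field_derivative_at_within[OF std_normal_density_deriv]])

lemma std_normal_density_positive: "0 < \<phi> x"
  by (simp add: normal_density_pos)

lemma tendsto_power_std_normal_density:
  "((\<lambda>x. x ^ k * \<phi> x) \<longlongrightarrow> 0) at_top" "((\<lambda>x. x ^ k * \<phi> x) \<longlongrightarrow> 0) at_bot"
proof -
  \<comment> \<open>From 2 on, x^2/2 exceeds \<bar>x\<bar>, so the Gaussian tail is compared with an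
    exponential one.\<close>
  have le: "\<bar>x ^ k * \<phi> x\<bar> \<le> \<bar>x\<bar> ^ k / exp \<bar>x\<bar>" if "2 \<le> \<bar>x\<bar>" for x :: real
  proof -
    have "2 * \<bar>x\<bar> \<le> \<bar>x\<bar> * \<bar>x\<bar>" using that by (intro mult_right_mono) auto
    then have "exp (- (x\<^sup>2) / 2) \<le> exp (- \<bar>x\<bar>)" by (simp add: power2_eq_square)
    moreover have "1 \<le> sqrt (2 * pi)" using pi_gt3 by simp
    then have "1 / sqrt (2 * pi) \<le> 1" by simp
    ultimately have "\<phi> x \<le> 1 * exp (- \<bar>x\<bar>)"
      unfolding std_normal_density_def by (intro mult_mono) auto
    then have "\<bar>x\<bar> ^ k * \<phi> x \<le> \<bar>x\<bar> ^ k * exp (- \<bar>x\<bar>)" by (intro mult_left_mono) auto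
    then show ?thesis by (simp add: abs_mult power_abs exp_minus field_simps)
  qed
  have L: "((\<lambda>x::real. \<bar>x\<bar> ^ k / exp \<bar>x\<bar>) \<longlongrightarrow> 0) at_top"
    by (rule Lim_transform_eventually[OF tendsto_power_div_exp_0[of k]])
       (auto simp: eventually_at_top_linorder intro!: exI[of _ 0])
  show "((\<lambda>x. x ^ k * \<phi> x) \<longlongrightarrow> 0) at_top"
    by (rule Lim_null_comparison[OF _ L], rule eventually_at_top_linorderI[of 2])
       (simp only: real_norm_def, rule le, simp)
  have "norm ((- x) ^ k * \<phi> (- x)) \<le> \<bar>x\<bar> ^ k / exp \<bar>x\<bar>" if "2 \<le> x" for x :: real
    using le[of "- x"] that by simp
  then show "((\<lambda>x. x ^ k * \<phi> x) \<longlongrightarrow> 0) at_bot"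
    unfolding filterlim_at_bot_mirror
    by (intro Lim_null_comparison[OF _ L] eventually_at_top_linorderI[of 2])
qed

lemma tendsto_std_normal_density: "(\<phi> \<longlongrightarrow> 0) at_top" "(\<phi> \<longlongrightarrow> 0) at_bot"
  using tendsto_power_std_normal_density[of 0] by simp_all

lemma set_integrable_std_normal_density: "S \<in> sets borel \<Longrightarrow> set_integrable lborel S \<phi>"
  unfolding set_integrable_def by (rule integrable_mult_indicator) auto

lemma Phi_eq_measure: "Phi z = measure std_normal_distribution {..z}"
proof -
  have "measure std_normal_distribution {..z} = (\<integral>x. indicator {..z} x \<partial>std_normal_distribution)"
    by simp
  also have "\<dots> = (\<integral>x. \<phi> x *\<^sub>R indicator {..z} x \<partial>lborel)"
    by (rule integral_density) auto
  finally show ?thesis unfolding Phi_def set_lebesgue_integral_def by (simp add: mult.commute)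
qed

lemma one_minus_Phi: "1 - Phi z = (LBINT x:{z<..}. \<phi> x)"
proof -
  have "(UNIV :: real set) = {..z} \<union> {z<..}" by auto
  then have "(LBINT x:UNIV. \<phi> x) = (LBINT x:{..z}. \<phi> x) + (LBINT x:{z<..}. \<phi> x)"
    by (subst set_integral_Un[symmetric])
       (auto simp: set_integrable_std_normal_density ivl_disj_un ivl_disj_int)
  then show ?thesis unfolding Phi_def by (simp add: set_lebesgue_integral_def)
qed

lemma Phi_nonneg: "0 \<le> Phi z" and Phi_le_one: "Phi z \<le> 1"
proof -
  show "0 \<le> Phi z" unfolding Phi_def set_lebesgue_integral_def by (auto intro!: integral_nonneg_AE)
  have "0 \<le> 1 - Phi z" unfolding one_minus_Phi set_lebesgue_integral_def by (auto intro!: integral_nonneg_AE)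
  then show "Phi z \<le> 1" by simp
qed

lemma Phi_diff:
  assumes "a \<le> b"
  shows "Phi b = Phi a + integral {a..b} \<phi>"
proof -
  have "Phi b = Phi a + (LBINT x:{a<..b}. \<phi> x)"
    unfolding Phi_def using assms
    by (subst set_integral_Un[symmetric])
       (auto simp: set_integrable_std_normal_density ivl_disj_un ivl_disj_int)
  also have "(LBINT x:{a<..b}. \<phi> x) = (LBINT x:{a..b}. \<phi> x)"
    unfolding set_lebesgue_integral_def
    by (rule integral_cong_AE) (auto intro!: AE_I[of _ _ "{a}"] simp: indicator_def)
  also have "\<dots> = integral {a..b} \<phi>"
    by (rule set_borel_integral_eq_integral) (simp add: set_integrable_std_normal_density)
  finally show ?thesis .
qed

lemma Phi_mono: "a \<le> b \<Longrightarrow> Phi a \<le> Phi b"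
  using Phi_diff[of a b] by (simp add: Henstock_Kurzweil_Integration.integral_nonneg
      integrable_continuous_real std_normal_density_continuous)

lemma Phi_deriv: "(Phi has_real_derivative \<phi> x) (at x)"
proof -
  define a b where "a = x - 1" and "b = x + 1"
  have "((\<lambda>u. integral {a..u} \<phi>) has_real_derivative \<phi> x) (at x within {a..b})"
    by (rule integral_has_real_derivative) (auto simp: std_normal_density_continuous a_def b_def)
  then have "((\<lambda>u. Phi a + integral {a..u} \<phi>) has_real_derivative \<phi> x) (at x within {a..b})"
    by (auto intro!: derivative_eq_intros)
  then have "(Phi has_real_derivative \<phi> x) (at x within {a..b})"
    by (rule has_field_derivative_transform_within[where d=1]) (auto simp: Phi_diff[symmetric] a_def b_def)
  then show ?thesis by (simp add: at_within_Icc_at a_def b_def)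
qed

lemma isCont_Phi: "isCont Phi x"
  using Phi_deriv DERIV_isCont by blast

text \<open>On t \<le> x one has -x \<le> -t, and -t times the density is the derivative of the
  density; integrating the comparison over \<open>{..x}\<close> gives the bound.\<close>

lemma mills_ratio_lower: "- x * Phi x \<le> \<phi> x"
proof -
  define h where "h t = indicator {..x} t * (- t * \<phi> t)" for t
  have hint: "integrable lborel h"
    unfolding h_def using integrable_mult_indicator[OF _ integrable_minus[OF integrable_std_normal_moment[of 1]], of "{..x}"]
    by (simp add: mult_ac)
  \<comment> \<open>Freezing the density beyond x gives an antiderivative of the truncated integrand
    on the whole line, with its only kink at x.\<close>
  have "(\<integral>t. h t \<partial>lborel) = \<phi> x - 0"
  proof (rule integral_deriv_real_line[of "{x}" "\<lambda>t. \<phi> (min t x)"])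
    show "continuous_on UNIV (\<lambda>t. \<phi> (min t x))"
      by (rule continuous_on_compose2[OF std_normal_density_continuous[of UNIV]]) (auto intro!: continuous_intros)
    show "((\<lambda>t. \<phi> (min t x)) has_real_derivative h t) (at t)" if "t \<notin> {x}" for t
    proof (cases "t < x")
      case True
      have "((\<lambda>t. \<phi> (min t x)) has_real_derivative - t * \<phi> t) (at t) = (\<phi> has_real_derivative - t * \<phi> t) (at t)"
        by (rule DERIV_cong_ev) (use True in \<open>auto intro!: eventually_mono[OF eventually_nhds_in_open[of "{..<x}"]]\<close>)
      then show ?thesis using std_normal_density_deriv True by (simp add: h_def)
    next
      case False
      then have t: "x < t" using that by simp
      have "((\<lambda>t. \<phi> (min t x)) has_real_derivative 0) (at t) = ((\<lambda>_. \<phi> x) has_real_derivative 0) (at t)"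
        by (rule DERIV_cong_ev) (use t in \<open>auto intro!: eventually_mono[OF eventually_nhds_in_open[of "{x<..}"]]\<close>)
      then show ?thesis using t by (simp add: h_def)
    qed
    show "((\<lambda>t. \<phi> (min t x)) \<longlongrightarrow> 0) at_bot"
      by (rule Lim_transform_eventually[OF tendsto_std_normal_density(2)])
         (auto simp: eventually_at_bot_linorder min_def intro!: exI[of _ "x"])
    show "((\<lambda>t. \<phi> (min t x)) \<longlongrightarrow> \<phi> x) at_top"
      by (rule tendsto_eventually) (auto simp: eventually_at_top_linorder min_def intro!: exI[of _ "x"])
  qed (use hint in auto)
  moreover have "- x * Phi x \<le> (\<integral>t. h t \<partial>lborel)"
  proof -
    have "- x * Phi x = (\<integral>t. - x * (indicator {..x} t * \<phi> t) \<partial>lborel)"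
      unfolding Phi_def set_lebesgue_integral_def by simp
    also have "\<dots> \<le> (\<integral>t. h t \<partial>lborel)"
    proof (rule integral_mono[OF _ hint])
      show "integrable lborel (\<lambda>t. - x * (indicator {..x} t * \<phi> t))"
        using set_integrable_std_normal_density[of "{..x}"] unfolding set_integrable_def by (intro integrable_mult_right) simp
    qed (auto simp: h_def indicator_def intro!: mult_right_mono)
    finally show ?thesis .
  qed
  ultimately show ?thesis by simp
qed

lemma Phi_minus: "Phi (- x) = 1 - Phi x"
proof -
  have "Phi (- x) = (\<integral>t. indicator {..- x} t * \<phi> t \<partial>lborel)"
    unfolding Phi_def set_lebesgue_integral_def by simp
  also have "\<dots> = (\<integral>t. indicator {..- x} (- t) * \<phi> (- t) \<partial>lborel)"
    using lborel_integral_real_affine[of "-1" "\<lambda>t. indicator {..- x} t * \<phi> t" 0] by simp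
  also have "\<dots> = (\<integral>t. indicator {x<..} t * \<phi> t \<partial>lborel)"
    by (rule integral_cong_AE) (auto intro!: AE_I[of _ _ "{x}"] simp: indicator_def std_normal_density_def)
  finally show ?thesis unfolding one_minus_Phi set_lebesgue_integral_def by simp
qed

lemma mills_ratio_upper: "x * (1 - Phi x) \<le> \<phi> x"
  using mills_ratio_lower[of "- x"] unfolding Phi_minus by (simp add: std_normal_density_def)

section \<open>The bounded solution of Stein's equation\<close>

text \<open>The bounded solution of f'(x) - x f(x) = 1 - Phi(z) for x \<le> z and = -Phi(z) for x >
  z. The functions \<open>min\<close> and \<open>max\<close> merge its two branches into one
  formula.\<close>

definition stein :: "real \<Rightarrow> real \<Rightarrow> real" where
  "stein z x = Phi (min x z) * (1 - Phi (max x z)) / \<phi> x"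

text \<open>Stein's equation holds by definition, also at x = z, where \<open>stein z\<close> has no
  derivative and the value is the left derivative. The equation can then be evaluated at a random
  point without excluding z.\<close>

definition stein_deriv :: "real \<Rightarrow> real \<Rightarrow> real" where
  "stein_deriv z x = x * stein z x + indicator {..z} x - Phi z"

lemma continuous_on_stein: "continuous_on S (stein z)"
proof -
  have Phi: "continuous_on UNIV Phi" using isCont_Phi by (simp add: continuous_on_eq_continuous_at)
  have "continuous_on S (\<lambda>x. Phi (min x z))" "continuous_on S (\<lambda>x. Phi (max x z))"
    by (rule continuous_on_compose2[OF Phi]; auto intro!: continuous_intros)+
  then show ?thesis unfolding stein_def[abs_def]
    by (intro continuous_intros std_normal_density_continuous) (use std_normal_density_positive in \<open>auto simp: less_imp_neq[symmetric]\<close>)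
qed

lemma stein_has_deriv:
  assumes "x \<noteq> z"
  shows "(stein z has_real_derivative stein_deriv z x) (at x)"
proof -
  note nz = std_normal_density_positive[of x, THEN less_imp_neq, symmetric]
  show ?thesis
  proof (cases "x < z")
    case True
    have "((\<lambda>x. Phi x * (1 - Phi z) / \<phi> x) has_real_derivative stein_deriv z x) (at x)"
      unfolding stein_deriv_def stein_def using True nz
      by (auto intro!: derivative_eq_intros Phi_deriv std_normal_density_deriv simp: field_simps min_def max_def)
    moreover have "(stein z has_real_derivative stein_deriv z x) (at x) =
      ((\<lambda>x. Phi x * (1 - Phi z) / \<phi> x) has_real_derivative stein_deriv z x) (at x)"
      by (rule DERIV_cong_ev) (use True in \<open>auto simp: stein_def intro!: eventually_mono[OF eventually_nhds_in_open[of "{..<z}"]]\<close>)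
    ultimately show ?thesis by simp
  next
    case False
    then have zx: "z < x" using assms by simp
    have "((\<lambda>x. Phi z * (1 - Phi x) / \<phi> x) has_real_derivative stein_deriv z x) (at x)"
      unfolding stein_deriv_def stein_def using zx nz
      by (auto intro!: derivative_eq_intros Phi_deriv std_normal_density_deriv simp: field_simps min_def max_def)
    moreover have "(stein z has_real_derivative stein_deriv z x) (at x) =
      ((\<lambda>x. Phi z * (1 - Phi x) / \<phi> x) has_real_derivative stein_deriv z x) (at x)"
      by (rule DERIV_cong_ev) (use zx in \<open>auto simp: stein_def intro!: eventually_mono[OF eventually_nhds_in_open[of "{z<..}"]]\<close>)
    ultimately show ?thesis by simp
  qed
qed

text \<open>For x \<le> z the derivative is (1 - Phi z)(1 + l), nonnegative by one Mills bound. The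
  quantity l has no upper bound, so monotonicity of Phi first replaces z by x, and the identity
  \<open>lu\<close> then trades l for u, which the other Mills bound controls. The case z < x is the
  mirror image.\<close>

lemma stein_deriv_bound: "\<bar>stein_deriv z x\<bar> \<le> 1"
proof -
  have p: "0 < \<phi> x" by (rule std_normal_density_positive)
  define l u where "l = x * Phi x / \<phi> x" and "u = x * (1 - Phi x) / \<phi> x"
  have l: "- 1 \<le> l" using mills_ratio_lower[of x] p by (simp add: l_def field_simps)
  have u: "u \<le> 1" using mills_ratio_upper[of x] p by (simp add: u_def field_simps)
  have P: "0 \<le> Phi x" "Phi x \<le> 1" "0 \<le> Phi z" "Phi z \<le> 1" by (auto simp: Phi_nonneg Phi_le_one)
  have lu: "l * (1 - Phi x) = Phi x * u" by (simp add: l_def u_def)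
  show ?thesis
  proof (cases "x \<le> z")
    case True
    have e: "stein_deriv z x = (1 - Phi z) * (1 + l)"
      unfolding stein_deriv_def stein_def l_def using True by (simp add: algebra_simps)
    have "0 \<le> stein_deriv z x" unfolding e using P l by simp
    moreover have "stein_deriv z x \<le> 1"
    proof -
      have "(1 - Phi z) * (1 + l) \<le> (1 - Phi x) * (1 + l)"
        using Phi_mono[OF True] l by (intro mult_right_mono) auto
      also have "\<dots> = (1 - Phi x) + Phi x * u" using lu by (simp add: algebra_simps)
      also have "\<dots> \<le> (1 - Phi x) + Phi x * 1" using P u by (intro add_left_mono mult_left_mono) auto
      finally show ?thesis unfolding e by simp
    qed
    ultimately show ?thesis by simp
  next
    case False
    have e: "stein_deriv z x = - (Phi z * (1 - u))"
      unfolding stein_deriv_def stein_def u_def using False by (simp add: algebra_simps)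
    have "0 \<le> Phi z * (1 - u)" using P u by simp
    moreover have "Phi z * (1 - u) \<le> 1"
    proof -
      have "Phi z * (1 - u) \<le> Phi x * (1 - u)"
        using Phi_mono[of z x] False u by (intro mult_right_mono) auto
      also have "\<dots> = Phi x + (1 - Phi x) * (- l)" using lu by (simp add: algebra_simps)
      also have "\<dots> \<le> Phi x + (1 - Phi x) * 1" using P l by (intro add_left_mono mult_left_mono) auto
      finally show ?thesis by simp
    qed
    ultimately show ?thesis unfolding e by simp
  qed
qed

lemma mult_stein_bound: "\<bar>x * stein z x\<bar> \<le> 2"
proof -
  have "x * stein z x = stein_deriv z x - (indicator {..z} x - Phi z)" by (simp add: stein_deriv_def)
  moreover have "\<bar>indicator {..z} x - Phi z\<bar> \<le> 1"
    using Phi_nonneg[of z] Phi_le_one[of z] by (auto simp: indicator_def)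
  ultimately show ?thesis using stein_deriv_bound[of z x] by linarith
qed

text \<open>Compactness on [-1, 1], and the bound on \<open>x * stein z x\<close> outside, since the
  latter says nothing near 0.\<close>

lemma stein_bounded: "\<exists>B. \<forall>x. \<bar>stein z x\<bar> \<le> B"
proof -
  have "bounded (stein z ` {-1..1})"
    by (rule compact_imp_bounded[OF compact_continuous_image[OF continuous_on_stein]]) simp
  then obtain B where B: "\<And>x. x \<in> {-1..1} \<Longrightarrow> \<bar>stein z x\<bar> \<le> B"
    unfolding bounded_iff by (metis imageI real_norm_def)
  have "\<bar>stein z x\<bar> \<le> max B 2" for x
  proof (cases "x \<in> {-1..1}")
    case True then show ?thesis using B[OF True] by simp
  next
    case False
    then have "1 * \<bar>stein z x\<bar> \<le> \<bar>x\<bar> * \<bar>stein z x\<bar>" by (intro mult_right_mono) auto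
    then show ?thesis using mult_stein_bound[of x z] by (simp add: abs_mult)
  qed
  then show ?thesis by blast
qed

lemma borel_measurable_stein [measurable]: "stein z \<in> borel_measurable borel"
  by (rule borel_measurable_continuous_onI[OF continuous_on_stein])

lemma borel_measurable_stein_deriv [measurable]: "stein_deriv z \<in> borel_measurable borel"
  unfolding stein_deriv_def[abs_def] by measurable

section \<open>Limits in law and almost sure limits\<close>

lemma weak_conv_linear_growth:
  fixes \<mu> :: "nat \<Rightarrow> real measure" and h :: "real \<Rightarrow> real"
  assumes \<mu>: "\<And>n. real_distribution (\<mu> n)" and N: "real_distribution N" and conv: "weak_conv_m \<mu> N"
    and h[measurable]: "h \<in> borel_measurable borel" and growth: "\<And>x. \<bar>h x\<bar> \<le> \<bar>x\<bar>"
    and cont: "\<And>x. x \<noteq> z \<Longrightarrow> isCont h x" and null: "emeasure N {z} = 0"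
    and \<mu>2: "\<And>n. integrable (\<mu> n) (\<lambda>x. x\<^sup>2)" "\<And>n. (\<integral>x. x\<^sup>2 \<partial>\<mu> n) \<le> 1"
    and N2: "integrable N (\<lambda>x. x\<^sup>2)" "(\<integral>x. x\<^sup>2 \<partial>N) \<le> 1"
  shows "(\<lambda>n. \<integral>x. h x \<partial>\<mu> n) \<longlonglongrightarrow> (\<integral>x. h x \<partial>N)"
proof (rule LIMSEQ_I)
  fix r :: real assume r: "0 < r"
  \<comment> \<open>Three errors are added: damping before the limit, damping in the limit, and weak
    convergence of the damped integrals.\<close>
  define e where "e = r / 3"
  have e: "0 < e" using r by (simp add: e_def)
  define hd where "hd x = h x / (1 + e\<^sup>2 * x\<^sup>2)" for x
  have den: "0 < 1 + e\<^sup>2 * x\<^sup>2" for x by (rule add_pos_nonneg) auto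
  have ex: "e * \<bar>x\<bar> \<le> 1 + e\<^sup>2 * x\<^sup>2" for x
  proof -
    have "0 \<le> (e * \<bar>x\<bar> - 1)\<^sup>2" by simp
    then have "2 * (e * \<bar>x\<bar>) \<le> 1 + e\<^sup>2 * x\<^sup>2" by (simp add: power2_diff power_mult_distrib)
    moreover have "0 \<le> e * \<bar>x\<bar>" using e by simp
    ultimately show ?thesis by linarith
  qed
  have bd: "norm (hd x) \<le> 1 / e" for x
  proof -
    have "norm (hd x) \<le> \<bar>x\<bar> / (1 + e\<^sup>2 * x\<^sup>2)"
      using growth[of x] den[of x] by (simp add: hd_def divide_right_mono)
    also have "\<dots> \<le> 1 / e" using ex[of x] den[of x] e by (simp add: field_simps)
    finally show ?thesis .
  qed
  have diff: "\<bar>h x - hd x\<bar> \<le> e * x\<^sup>2" for x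
  proof -
    have "h x - hd x = h x * (e\<^sup>2 * x\<^sup>2 / (1 + e\<^sup>2 * x\<^sup>2))"
      using den[of x] by (simp add: hd_def field_simps)
    then have "\<bar>h x - hd x\<bar> = \<bar>h x\<bar> * (e\<^sup>2 * x\<^sup>2 / (1 + e\<^sup>2 * x\<^sup>2))"
      using den[of x] by (simp add: abs_mult)
    also have "\<dots> \<le> \<bar>x\<bar> * (e\<^sup>2 * x\<^sup>2 / (1 + e\<^sup>2 * x\<^sup>2))"
      using growth[of x] den[of x] by (intro mult_right_mono) (auto intro!: divide_nonneg_pos)
    also have "\<dots> = (e * x\<^sup>2) * (e * \<bar>x\<bar> / (1 + e\<^sup>2 * x\<^sup>2))" by (simp add: power2_eq_square)
    also have "\<dots> \<le> (e * x\<^sup>2) * 1"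
      using ex[of x] den[of x] e by (intro mult_left_mono) (auto simp: field_simps)
    finally show ?thesis by simp
  qed
  have [measurable]: "hd \<in> borel_measurable borel" unfolding hd_def[abs_def] by measurable
  have close: "\<bar>(\<integral>x. h x \<partial>\<nu>) - (\<integral>x. hd x \<partial>\<nu>)\<bar> \<le> e"
    if "real_distribution \<nu>" "integrable \<nu> (\<lambda>x. x\<^sup>2)" "(\<integral>x. x\<^sup>2 \<partial>\<nu>) \<le> 1" for \<nu>
  proof -
    interpret \<nu>: real_distribution \<nu> by fact
    have id: "integrable \<nu> hd" by (rule \<nu>.integrable_const_bound[where B="1/e"]) (use bd in auto)
    have ihd: "integrable \<nu> (\<lambda>x. h x - hd x)"
      by (rule Bochner_Integration.integrable_bound[OF integrable_mult_right[OF that(2), of e]])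
         (use diff e in auto)
    from Bochner_Integration.integrable_add[OF ihd id] have ih: "integrable \<nu> h" by simp
    have "\<bar>(\<integral>x. h x \<partial>\<nu>) - (\<integral>x. hd x \<partial>\<nu>)\<bar> = \<bar>\<integral>x. h x - hd x \<partial>\<nu>\<bar>" using ih id by simp
    also have "\<dots> \<le> (\<integral>x. \<bar>h x - hd x\<bar> \<partial>\<nu>)" by (rule integral_abs_bound)
    also have "\<dots> \<le> (\<integral>x. e * x\<^sup>2 \<partial>\<nu>)"
      by (rule integral_mono) (use ihd that(2) diff in auto)
    also have "\<dots> \<le> e" using that(3) e by simp
    finally show ?thesis .
  qed
  have "(\<lambda>n. \<integral>x. hd x \<partial>\<mu> n) \<longlonglongrightarrow> (\<integral>x. hd x \<partial>N)"
  proof (rule weak_conv_imp_bdd_ae_continuous_conv[OF \<mu> N conv _ bd])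
    have "isCont hd x" if "x \<noteq> z" for x
      unfolding hd_def[abs_def] using cont[OF that] den[of x] by (intro continuous_intros) auto
    then have "{x. \<not> isCont hd x} \<subseteq> {z}" by auto
    then have "{x. \<not> isCont hd x} = {} \<or> {x. \<not> isCont hd x} = {z}" by (metis subset_singletonD)
    then show "emeasure N {x. \<not> isCont hd x} = 0" using null by auto
  qed simp
  from LIMSEQ_D[OF this e] obtain n0 where
    n0: "\<And>n. n \<ge> n0 \<Longrightarrow> norm ((\<integral>x. hd x \<partial>\<mu> n) - (\<integral>x. hd x \<partial>N)) < e" by blast
  show "\<exists>n0. \<forall>n\<ge>n0. norm ((\<integral>x. h x \<partial>\<mu> n) - (\<integral>x. h x \<partial>N)) < r"
  proof (intro exI[of _ n0] allI impI)
    fix n assume "n0 \<le> n"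
    from n0[OF this] close[OF \<mu> \<mu>2, of n] close[OF N N2]
    show "norm ((\<integral>x. h x \<partial>\<mu> n) - (\<integral>x. h x \<partial>N)) < r" unfolding e_def real_norm_def by linarith
  qed
qed

text \<open>With $P = (x^2 - 1)\varphi/3$, so that $P' = (x - x^3/3)\varphi$, and $f$ the Stein solution, the
  integrand $x f' \varphi$ has the antiderivative $x^3 f \varphi/3 + P(\min(x, z)) - \Phi(z) P$.\<close>
lemma stein_limit_constant:
  "(\<integral>x. x * stein_deriv z x \<partial>std_normal_distribution) = (z\<^sup>2 - 1) * \<phi> z / 3"
proof -
  \<comment> \<open>The factor \<open>x ^ 0\<close> gives both terms the shape required by
    \<open>tendsto_power_std_normal_density\<close>.\<close>
  define P where "P x = (x ^ 2 * \<phi> x - x ^ 0 * \<phi> x) / 3" for x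
  have Pd: "(P has_real_derivative (x - x ^ 3 / 3) * \<phi> x) (at x)" for x
    unfolding P_def[abs_def]
    by (rule derivative_eq_intros std_normal_density_deriv refl | simp)+
       (simp add: algebra_simps eval_nat_numeral)
  have Pc: "continuous_on UNIV P" unfolding P_def[abs_def] by (intro continuous_intros std_normal_density_continuous) simp
  have P0: "(P \<longlongrightarrow> 0) at_top" "(P \<longlongrightarrow> 0) at_bot"
  proof -
    have "((\<lambda>x. (x ^ 2 * \<phi> x - x ^ 0 * \<phi> x) / 3) \<longlongrightarrow> (0 - 0) / 3) at_top"
      "((\<lambda>x. (x ^ 2 * \<phi> x - x ^ 0 * \<phi> x) / 3) \<longlongrightarrow> (0 - 0) / 3) at_bot"
      by (intro tendsto_intros tendsto_power_std_normal_density; simp)+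
    then show "(P \<longlongrightarrow> 0) at_top" "(P \<longlongrightarrow> 0) at_bot" unfolding P_def[abs_def] by simp_all
  qed
  \<comment> \<open>By Stein's equation x f' is x^2 f plus x times the centred indicator. The
    derivative of x^3 f \<phi>/3 has the same term x^2 f \<phi>, but x^3/3 in place of x before the
    indicator; P supplies the difference x - x^3/3.\<close>
  define H where "H x = x ^ 3 / 3 * (stein z x * \<phi> x) + P (min x z) - Phi z * P x" for x
  have "(\<integral>x. \<phi> x * (x * stein_deriv z x) \<partial>lborel) = P z - 0"
  proof (rule integral_deriv_real_line[of "{z}" H])
    have "continuous_on UNIV (\<lambda>x. P (min x z))"
      by (rule continuous_on_compose2[OF Pc]) (auto intro!: continuous_intros)
    then show "continuous_on UNIV H"
      unfolding H_def[abs_def] by (intro continuous_intros continuous_on_stein std_normal_density_continuous Pc) auto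
    show "(H has_real_derivative \<phi> x * (x * stein_deriv z x)) (at x)" if "x \<notin> {z}" for x
    proof -
      have xz: "x \<noteq> z" using that by simp
      have "((\<lambda>x. P (min x z)) has_real_derivative indicator {..z} x * ((x - x ^ 3 / 3) * \<phi> x)) (at x)"
      proof (cases "x < z")
        case True
        have "((\<lambda>x. P (min x z)) has_real_derivative ((x - x ^ 3 / 3) * \<phi> x)) (at x) \<longleftrightarrow>
          (P has_real_derivative ((x - x ^ 3 / 3) * \<phi> x)) (at x)"
          by (rule DERIV_cong_ev) (use True in \<open>auto intro!: eventually_mono[OF eventually_nhds_in_open[of "{..<z}"]]\<close>)
        then show ?thesis using Pd True by simp
      next
        case False
        then have zx: "z < x" using xz by simp
        have "((\<lambda>x. P (min x z)) has_real_derivative 0) (at x) \<longleftrightarrow> ((\<lambda>x. P z) has_real_derivative 0) (at x)"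
          by (rule DERIV_cong_ev) (use zx in \<open>auto intro!: eventually_mono[OF eventually_nhds_in_open[of "{z<..}"]]\<close>)
        then show ?thesis using zx by simp
      qed
      note mn = this
      have cube: "((\<lambda>x. x ^ 3 / 3) has_real_derivative x ^ 2) (at x)"
        by (auto intro!: derivative_eq_intros)
      note D = DERIV_diff[OF DERIV_add[OF DERIV_mult[OF cube DERIV_mult[OF stein_has_deriv[OF xz] std_normal_density_deriv]] mn]
          DERIV_cmult[OF Pd, of "Phi z"]]
      show ?thesis
        unfolding H_def[abs_def]
        by (rule DERIV_cong[OF D]) (simp add: stein_deriv_def algebra_simps eval_nat_numeral)
    qed
    show "integrable lborel (\<lambda>x. \<phi> x * (x * stein_deriv z x))"
    proof (rule Bochner_Integration.integrable_bound[OF integrable_std_normal_moment_abs[of 1]])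
      show "AE x in lborel. norm (\<phi> x * (x * stein_deriv z x)) \<le> norm (\<phi> x * \<bar>x\<bar> ^ 1)"
        using mult_left_mono[OF stein_deriv_bound] by (intro AE_I2) (simp add: abs_mult mult_left_mono mult_left_le)
    qed simp
    have le: "\<And>x. norm (x ^ 3 / 3 * (stein z x * \<phi> x)) \<le> norm (x ^ 2 * \<phi> x)"
    proof -
      fix x
      have "norm (x ^ 3 / 3 * (stein z x * \<phi> x)) = \<bar>x * stein z x\<bar> * (x ^ 2 * \<phi> x) / 3"
        by (simp add: abs_mult eval_nat_numeral)
      also have "\<dots> \<le> 2 * (x ^ 2 * \<phi> x) / 3"
        using mult_stein_bound[of x z] by (intro divide_right_mono mult_right_mono) auto
      also have "\<dots> \<le> norm (x ^ 2 * \<phi> x)" by (simp add: abs_mult)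
      finally show "norm (x ^ 3 / 3 * (stein z x * \<phi> x)) \<le> norm (x ^ 2 * \<phi> x)" .
    qed
    have s0: "((\<lambda>x. x ^ 3 / 3 * (stein z x * \<phi> x)) \<longlongrightarrow> 0) at_top" "((\<lambda>x. x ^ 3 / 3 * (stein z x * \<phi> x)) \<longlongrightarrow> 0) at_bot"
      by (rule Lim_null_comparison[OF always_eventually tendsto_norm_zero[OF tendsto_power_std_normal_density(1)[of 2]]], rule allI, rule le)
         (rule Lim_null_comparison[OF always_eventually tendsto_norm_zero[OF tendsto_power_std_normal_density(2)[of 2]]], rule allI, rule le)
    have "((\<lambda>x. P (min x z)) \<longlongrightarrow> 0) at_bot"
      by (rule Lim_transform_eventually[OF P0(2)])
         (auto simp: eventually_at_bot_linorder min_def intro!: exI[of _ "z"])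
    from tendsto_diff[OF tendsto_add[OF s0(2) this] tendsto_mult_right_zero[OF P0(2), of "Phi z"]]
    show "(H \<longlongrightarrow> 0) at_bot" unfolding H_def[abs_def] by simp
    have "((\<lambda>x. P (min x z)) \<longlongrightarrow> P z) at_top"
      by (rule tendsto_eventually) (auto simp: eventually_at_top_linorder min_def intro!: exI[of _ "z"])
    from tendsto_diff[OF tendsto_add[OF s0(1) this] tendsto_mult_right_zero[OF P0(1), of "Phi z"]]
    show "(H \<longlongrightarrow> P z) at_top" unfolding H_def[abs_def] by simp
  qed simp
  moreover have "(\<integral>x. x * stein_deriv z x \<partial>std_normal_distribution) = (\<integral>x. \<phi> x * (x * stein_deriv z x) \<partial>lborel)"
    by (subst integral_density) auto
  ultimately show ?thesis by (simp add: P_def algebra_simps)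
qed

text \<open>A series of nonnegative terms with summable expectations is almost surely finite, so its
  terms vanish in the limit. The joint law of the \<open>U n\<close> does not enter, which suits
  coordinates that change with n.\<close>

lemma AE_tendsto_zero_of_summable_moments:
  fixes U :: "nat \<Rightarrow> 'a \<Rightarrow> real"
  assumes [measurable]: "\<And>n. U n \<in> borel_measurable M"
    and k: "0 < k" and int: "\<And>n. integrable M (\<lambda>\<omega>. U n \<omega> ^ (2 * k))"
    and le: "\<And>n. (\<integral>\<omega>. U n \<omega> ^ (2 * k) \<partial>M) \<le> a n" and a: "summable a"
  shows "AE \<omega> in M. (\<lambda>n. U n \<omega>) \<longlonglongrightarrow> 0"
proof -
  have pos: "0 \<le> U n \<omega> ^ (2 * k)" for n \<omega> by (simp add: power_mult)
  have a0: "0 \<le> a n" for n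
    by (rule order_trans[OF _ le]) (simp add: pos)
  have "(\<integral>\<^sup>+\<omega>. (\<Sum>n. ennreal (U n \<omega> ^ (2 * k))) \<partial>M) = (\<Sum>n. \<integral>\<^sup>+\<omega>. ennreal (U n \<omega> ^ (2 * k)) \<partial>M)"
    by (rule nn_integral_suminf) measurable
  also have "\<dots> = (\<Sum>n. ennreal (\<integral>\<omega>. U n \<omega> ^ (2 * k) \<partial>M))"
    by (intro suminf_cong nn_integral_eq_integral int AE_I2 pos)
  also have "\<dots> \<le> (\<Sum>n. ennreal (a n))"
    by (rule suminf_le) (auto intro: ennreal_leI le)
  also have "\<dots> = ennreal (\<Sum>n. a n)" by (rule suminf_ennreal2[OF a0 a])
  also have "\<dots> < \<infinity>" by simp
  finally have "AE \<omega> in M. (\<Sum>n. ennreal (U n \<omega> ^ (2 * k))) \<noteq> \<infinity>"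
    by (intro nn_integral_noteq_infinite) auto
  then show ?thesis
  proof eventually_elim
    case (elim \<omega>)
    have "summable (\<lambda>n. U n \<omega> ^ (2 * k))"
    proof (rule summable_suminf_not_top)
      show "(\<Sum>n. ennreal (U n \<omega> ^ (2 * k))) \<noteq> top" using elim unfolding infinity_ennreal_def .
    qed (rule pos)
    then have "(\<lambda>n. U n \<omega> ^ (2 * k)) \<longlonglongrightarrow> 0" by (rule summable_LIMSEQ_zero)
    then show ?case using k by (subst (asm) power_tendsto_0_iff) auto
  qed
qed

section \<open>Sums of squares of independent standard normals\<close>

lemma integrable_mult_bounded:
  fixes u v :: "'a \<Rightarrow> real"
  assumes u: "integrable M u" and v: "\<And>\<omega>. \<bar>v \<omega>\<bar> \<le> C" and [measurable]: "v \<in> borel_measurable M"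
  shows "integrable M (\<lambda>\<omega>. u \<omega> * v \<omega>)"
proof (rule Bochner_Integration.integrable_bound)
  have [measurable]: "u \<in> borel_measurable M" using u by simp
  show "integrable M (\<lambda>\<omega>. C * u \<omega>)" using u by simp
  show "AE \<omega> in M. norm (u \<omega> * v \<omega>) \<le> norm (C * u \<omega>)"
  proof (rule AE_I2)
    fix \<omega>
    have "\<bar>u \<omega>\<bar> * \<bar>v \<omega>\<bar> \<le> \<bar>u \<omega>\<bar> * \<bar>C\<bar>"
      using v[of \<omega>] by (intro mult_left_mono) auto
    then show "norm (u \<omega> * v \<omega>) \<le> norm (C * u \<omega>)" by (simp add: abs_mult mult.commute)
  qed
  show "(\<lambda>\<omega>. u \<omega> * v \<omega>) \<in> borel_measurable M" by measurable
qed

text \<open>Allows an identity for the law of X to be applied with the value of Y frozen: for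
  integration by parts in one coordinate, and for integrating out Y_n in the bivariate
  limit.\<close>

lemma (in prob_space) expectation_indep_Fubini:
  fixes F :: "real \<times> real \<Rightarrow> real"
  assumes ind: "indep_var borel X borel Y" and law: "distr M borel X = \<mu>"
    and F[measurable]: "F \<in> borel_measurable (borel \<Otimes>\<^sub>M borel)"
    and int: "integrable M (\<lambda>\<omega>. F (X \<omega>, Y \<omega>))"
  shows "expectation (\<lambda>\<omega>. F (X \<omega>, Y \<omega>)) = expectation (\<lambda>\<omega>. \<integral>x. F (x, Y \<omega>) \<partial>\<mu>)"
proof -
  have [measurable]: "random_variable borel X" "random_variable borel Y"
    using ind by (auto dest: indep_var_rv1 indep_var_rv2)
  interpret X: prob_space \<mu> unfolding law[symmetric] by (rule prob_space_distr) simp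
  interpret Y: prob_space "distr M borel Y" by (rule prob_space_distr) simp
  interpret P: pair_sigma_finite \<mu> "distr M borel Y" ..
  have sets[simp, measurable_cong]: "sets \<mu> = sets borel" unfolding law[symmetric] by simp
  have joint: "\<mu> \<Otimes>\<^sub>M distr M borel Y = distr M (borel \<Otimes>\<^sub>M borel) (\<lambda>\<omega>. (X \<omega>, Y \<omega>))"
    using ind unfolding indep_var_distribution_eq law by blast
  have "integrable (\<mu> \<Otimes>\<^sub>M distr M borel Y) F"
    unfolding joint using int by (subst integrable_distr_eq) auto
  then have "integrable (\<mu> \<Otimes>\<^sub>M distr M borel Y) (case_prod (\<lambda>x y. F (x, y)))" by simp
  from P.integral_snd[OF this]
  have "(\<integral>y. (\<integral>x. F (x, y) \<partial>\<mu>) \<partial>distr M borel Y) = integral\<^sup>L (\<mu> \<Otimes>\<^sub>M distr M borel Y) F" by simp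
  also have "\<dots> = expectation (\<lambda>\<omega>. F (X \<omega>, Y \<omega>))"
    unfolding joint by (subst integral_distr) auto
  finally show ?thesis
    by (subst (asm) integral_distr) (auto intro!: X.borel_measurable_lebesgue_integral)
qed

lemma std_normal_integral_eq:
  fixes f :: "real \<Rightarrow> real"
  assumes "f \<in> borel_measurable borel"
  shows "(\<integral>x. f x \<partial>std_normal_distribution) = (\<integral>x. \<phi> x * f x \<partial>lborel)"
    and "integrable std_normal_distribution f \<longleftrightarrow> integrable lborel (\<lambda>x. \<phi> x * f x)"
  using assms by (simp_all add: integral_density integrable_density)

text \<open>Integration by parts applied to the function $x g(x^2 + r)$.\<close>
lemma std_normal_square_by_parts:
  fixes g g' :: "real \<Rightarrow> real"
  assumes cont: "continuous_on UNIV g"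
    and deriv: "\<And>y. y \<noteq> c \<Longrightarrow> (g has_real_derivative g' y) (at y)"
    and [measurable]: "g' \<in> borel_measurable borel"
    and B: "\<And>y. \<bar>g y\<bar> \<le> B" and B': "\<And>y. \<bar>g' y\<bar> \<le> B'"
  shows "(\<integral>x. (x\<^sup>2 - 1) * g (x\<^sup>2 + r) - 2 * x\<^sup>2 * g' (x\<^sup>2 + r) \<partial>std_normal_distribution) = 0"
proof -
  have [measurable]: "g \<in> borel_measurable borel" using cont by (rule borel_measurable_continuous_onI)
  define h where "h x = \<phi> x * ((x\<^sup>2 - 1) * g (x\<^sup>2 + r) - 2 * x\<^sup>2 * g' (x\<^sup>2 + r))" for x
  \<comment> \<open>The function g may have a kink at c, and x^2 + r meets c in at most two
    points.\<close>
  have "(\<integral>x. h x \<partial>lborel) = 0 - 0"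
  proof (rule integral_deriv_real_line[of "{x. x\<^sup>2 + r = c}" "\<lambda>x. - (x * \<phi> x) * g (x\<^sup>2 + r)"])
    have "{x. x\<^sup>2 + r = c} \<subseteq> {sqrt (c - r), - sqrt (c - r)}"
    proof
      fix x assume "x \<in> {x. x\<^sup>2 + r = c}"
      then have "c - r = x\<^sup>2" by auto
      then show "x \<in> {sqrt (c - r), - sqrt (c - r)}" by (simp add: abs_if)
    qed
    then show "finite {x. x\<^sup>2 + r = c}" by (rule finite_subset) simp
    have "continuous_on UNIV (\<lambda>x. g (x\<^sup>2 + r))"
      by (rule continuous_on_compose2[OF cont]) (auto intro!: continuous_intros)
    then show "continuous_on UNIV (\<lambda>x. - (x * \<phi> x) * g (x\<^sup>2 + r))"
      by (intro continuous_intros std_normal_density_continuous)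
    show "((\<lambda>x. - (x * \<phi> x) * g (x\<^sup>2 + r)) has_real_derivative h x) (at x)" if "x \<notin> {x. x\<^sup>2 + r = c}" for x
    proof -
      have "((\<lambda>x. g (x\<^sup>2 + r)) has_real_derivative g' (x\<^sup>2 + r) * (2 * x)) (at x)"
        using that by (intro DERIV_chain2[where f=g] deriv) (auto intro!: derivative_eq_intros)
      from DERIV_mult[OF DERIV_minus[OF DERIV_mult[OF DERIV_ident std_normal_density_deriv]] this]
      show ?thesis by (rule DERIV_cong) (simp add: h_def algebra_simps power2_eq_square)
    qed
    have "integrable lborel (\<lambda>x. B * (\<phi> x * x ^ 2) + B * \<phi> x + 2 * B' * (\<phi> x * x ^ 2))"
      by (intro Bochner_Integration.integrable_add integrable_mult_right integrable_std_normal_moment) auto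
    then show "integrable lborel h"
    proof (rule Bochner_Integration.integrable_bound)
      show "AE x in lborel. norm (h x) \<le> norm (B * (\<phi> x * x ^ 2) + B * \<phi> x + 2 * B' * (\<phi> x * x ^ 2))"
      proof (rule AE_I2)
        fix x
        have B0: "0 \<le> B" "0 \<le> B'" using B[of 0] B'[of 0] by linarith+
        have "\<bar>(x\<^sup>2 - 1) * g (x\<^sup>2 + r)\<bar> \<le> (x\<^sup>2 + 1) * B"
          unfolding abs_mult using B by (intro mult_mono) (auto simp: abs_le_iff intro: order_trans[of _ "0::real"])
        moreover have "\<bar>2 * x\<^sup>2 * g' (x\<^sup>2 + r)\<bar> \<le> (2 * x\<^sup>2) * B'"
          unfolding abs_mult using B' by (intro mult_mono) auto
        ultimately have "\<bar>(x\<^sup>2 - 1) * g (x\<^sup>2 + r) - 2 * x\<^sup>2 * g' (x\<^sup>2 + r)\<bar> \<le> (x\<^sup>2 + 1) * B + (2 * x\<^sup>2) * B'"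
          by linarith
        then have "norm (h x) \<le> \<phi> x * ((x\<^sup>2 + 1) * B + (2 * x\<^sup>2) * B')"
          unfolding h_def by (simp add: abs_mult mult_left_mono)
        also have "\<dots> = B * (\<phi> x * x ^ 2) + B * \<phi> x + 2 * B' * (\<phi> x * x ^ 2)" by (simp add: algebra_simps)
        finally show "norm (h x) \<le> norm (B * (\<phi> x * x ^ 2) + B * \<phi> x + 2 * B' * (\<phi> x * x ^ 2))" by simp
      qed
    qed (simp add: h_def[abs_def])
    have "\<forall>x. norm (- (x * \<phi> x) * g (x\<^sup>2 + r)) \<le> norm (x ^ 1 * \<phi> x) * B"
      unfolding norm_mult using B by (auto intro!: mult_mono simp: abs_mult)
    note le = this[rule_format]
    have *: "((\<lambda>x. norm (x ^ 1 * \<phi> x) * B) \<longlongrightarrow> 0) at_top" "((\<lambda>x. norm (x ^ 1 * \<phi> x) * B) \<longlongrightarrow> 0) at_bot"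
      by (intro tendsto_mult_left_zero tendsto_norm_zero tendsto_power_std_normal_density)+
    show "((\<lambda>x. - (x * \<phi> x) * g (x\<^sup>2 + r)) \<longlongrightarrow> 0) at_bot"
      by (rule Lim_null_comparison[OF always_eventually *(2)]) (rule allI, rule le)
    show "((\<lambda>x. - (x * \<phi> x) * g (x\<^sup>2 + r)) \<longlongrightarrow> 0) at_top"
      by (rule Lim_null_comparison[OF always_eventually *(1)]) (rule allI, rule le)
  qed
  then show ?thesis by (subst std_normal_integral_eq) (simp_all add: h_def)
qed

text \<open>The index set is general because both the full row \<open>{..<n}\<close> and its part
  \<open>{1..<n}\<close>, without the coordinate that carries the drift, are needed.\<close>

locale indep_std_normals = prob_space M for M :: "'a measure" +
  fixes Z :: "nat \<Rightarrow> 'a \<Rightarrow> real" and I :: "nat set"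
  assumes finite_I: "finite I"
    and indep: "indep_vars (\<lambda>_. borel) Z I"
    and law: "\<And>i. i \<in> I \<Longrightarrow> distr M borel (Z i) = std_normal_distribution"
begin

definition chi2 :: "'a \<Rightarrow> real" where
  "chi2 \<omega> = (\<Sum>i\<in>I. (Z i \<omega>)\<^sup>2)"

lemma Z_measurable [measurable]: "i \<in> I \<Longrightarrow> Z i \<in> borel_measurable M"
  using indep unfolding indep_vars_def by auto

lemma chi2_measurable [measurable]: "chi2 \<in> borel_measurable M"
  unfolding chi2_def[abs_def] by measurable

lemma expectation_Z:
  fixes f :: "real \<Rightarrow> real"
  assumes i: "i \<in> I" and f[measurable]: "f \<in> borel_measurable borel"
  shows "expectation (\<lambda>\<omega>. f (Z i \<omega>)) = (\<integral>x. f x \<partial>std_normal_distribution)"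
    and "integrable M (\<lambda>\<omega>. f (Z i \<omega>)) \<longleftrightarrow> integrable std_normal_distribution f"
  unfolding law[OF i, symmetric] using i by (simp_all add: integral_distr integrable_distr_eq)

lemma integrable_Z_power: "i \<in> I \<Longrightarrow> integrable M (\<lambda>\<omega>. Z i \<omega> ^ k)"
  by (subst expectation_Z(2)[of i "\<lambda>x. x ^ k"]) (auto simp: integrable_std_normal_distribution_moment)

lemma indep_Z_sum:
  fixes f h :: "real \<Rightarrow> real"
  assumes i: "i \<in> I" and J: "J \<subseteq> I" "i \<notin> J"
    and [measurable]: "f \<in> borel_measurable borel" "h \<in> borel_measurable borel"
  shows "indep_var borel (\<lambda>\<omega>. h (Z i \<omega>)) borel (\<lambda>\<omega>. \<Sum>j\<in>J. f (Z j \<omega>))"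
proof -
  have "indep_vars (\<lambda>_. borel) Z (insert i J)"
    using indep_vars_subset[OF indep, of "insert i J"] i J by auto
  then have "indep_vars (\<lambda>_. borel) (\<lambda>j \<omega>. (if j = i then h else f) (Z j \<omega>)) (insert i J)"
    by (rule indep_vars_compose2[where M'="\<lambda>_. borel"]) auto
  from indep_vars_sum[OF finite_subset[OF J(1) finite_I] J(2) this]
  have "indep_var borel (\<lambda>\<omega>. h (Z i \<omega>)) borel (\<lambda>\<omega>. \<Sum>j\<in>J. (if j = i then h else f) (Z j \<omega>))" by simp
  also have "(\<lambda>\<omega>. \<Sum>j\<in>J. (if j = i then h else f) (Z j \<omega>)) = (\<lambda>\<omega>. \<Sum>j\<in>J. f (Z j \<omega>))"
    using J by (intro ext sum.cong) auto
  finally show ?thesis .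
qed

lemma integrable_chi2: "integrable M chi2"
  unfolding chi2_def[abs_def] by (intro Bochner_Integration.integrable_sum integrable_Z_power)

text \<open>For each coordinate the remaining sum of squares is independent of it and acts as a
  constant r, so the one-dimensional identity applies; the coordinate identities are then added. The
  result is the Stein identity of the chi-square law.\<close>

lemma chi2_by_parts:
  fixes g g' :: "real \<Rightarrow> real"
  assumes cont: "continuous_on UNIV g"
    and deriv: "\<And>y. y \<noteq> c \<Longrightarrow> (g has_real_derivative g' y) (at y)"
    and [measurable]: "g' \<in> borel_measurable borel"
    and B: "\<And>y. \<bar>g y\<bar> \<le> B" and B': "\<And>y. \<bar>g' y\<bar> \<le> B'"
  shows "expectation (\<lambda>\<omega>. (chi2 \<omega> - card I) * g (chi2 \<omega>)) = 2 * expectation (\<lambda>\<omega>. chi2 \<omega> * g' (chi2 \<omega>))"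
proof -
  have [measurable]: "g \<in> borel_measurable borel" using cont by (rule borel_measurable_continuous_onI)
  define T where "T i \<omega> = ((Z i \<omega>)\<^sup>2 - 1) * g (chi2 \<omega>) - 2 * (Z i \<omega>)\<^sup>2 * g' (chi2 \<omega>)" for i \<omega>
  have int1: "integrable M (\<lambda>\<omega>. ((Z i \<omega>)\<^sup>2 - 1) * g (chi2 \<omega>))"
    if i: "i \<in> I" for i
    by (rule integrable_mult_bounded[OF _ B]) (use integrable_Z_power[OF i, of 2] in simp_all)
  have int2: "integrable M (\<lambda>\<omega>. 2 * (Z i \<omega>)\<^sup>2 * g' (chi2 \<omega>))" if i: "i \<in> I" for i
    by (rule integrable_mult_bounded[OF _ B']) (use integrable_Z_power[OF i, of 2] in simp_all)
  have intT: "integrable M (T i)" if i: "i \<in> I" for i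
    unfolding T_def[abs_def] by (rule Bochner_Integration.integrable_diff[OF int1[OF i] int2[OF i]])
  have T0: "expectation (T i) = 0" if i: "i \<in> I" for i
  proof -
    define R where "R \<omega> = (\<Sum>j\<in>I - {i}. (Z j \<omega>)\<^sup>2)" for \<omega>
    have chi: "chi2 \<omega> = (Z i \<omega>)\<^sup>2 + R \<omega>" for \<omega>
      unfolding chi2_def R_def using i finite_I by (simp add: sum.remove)
    define F where "F = (\<lambda>(x, r). (x\<^sup>2 - 1) * g (x\<^sup>2 + r) - 2 * x\<^sup>2 * g' (x\<^sup>2 + r :: real) :: real)"
    have ind: "indep_var borel (Z i) borel R"
      unfolding R_def[abs_def]
      by (rule indep_Z_sum[OF i, where J="I - {i}" and f="\<lambda>x. x\<^sup>2" and h="\<lambda>x. x"]) auto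
    have TF: "T i = (\<lambda>\<omega>. F (Z i \<omega>, R \<omega>))" by (rule ext) (simp add: T_def F_def chi)
    have "expectation (T i) = expectation (\<lambda>\<omega>. \<integral>x. F (x, R \<omega>) \<partial>std_normal_distribution)"
      unfolding TF using intT[OF i] by (intro expectation_indep_Fubini[OF ind law[OF i]]) (auto simp: F_def TF)
    also have "\<dots> = 0"
      unfolding F_def using std_normal_square_by_parts[OF cont deriv _ B B'] by simp
    finally show ?thesis .
  qed
  have "0 = expectation (\<lambda>\<omega>. \<Sum>i\<in>I. T i \<omega>)"
    by (subst Bochner_Integration.integral_sum) (use intT T0 in auto)
  also have "(\<lambda>\<omega>. \<Sum>i\<in>I. T i \<omega>) = (\<lambda>\<omega>. (chi2 \<omega> - card I) * g (chi2 \<omega>) - 2 * (chi2 \<omega> * g' (chi2 \<omega>)))"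
  proof (rule ext)
    fix \<omega>
    have "(\<Sum>i\<in>I. T i \<omega>) = (\<Sum>i\<in>I. (Z i \<omega>)\<^sup>2 - 1) * g (chi2 \<omega>) - (\<Sum>i\<in>I. 2 * (Z i \<omega>)\<^sup>2) * g' (chi2 \<omega>)"
      by (simp only: T_def sum_subtractf[of "\<lambda>i. _ i * g _"] sum_distrib_right)
    also have "(\<Sum>i\<in>I. (Z i \<omega>)\<^sup>2 - 1) = chi2 \<omega> - card I" by (simp add: chi2_def sum_subtractf)
    also have "(\<Sum>i\<in>I. 2 * (Z i \<omega>)\<^sup>2) = 2 * chi2 \<omega>" by (simp add: chi2_def sum_distrib_left)
    finally show "(\<Sum>i\<in>I. T i \<omega>) = (chi2 \<omega> - card I) * g (chi2 \<omega>) - 2 * (chi2 \<omega> * g' (chi2 \<omega>))" by simp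
  qed
  also have "expectation \<dots> = expectation (\<lambda>\<omega>. (chi2 \<omega> - card I) * g (chi2 \<omega>)) - expectation (\<lambda>\<omega>. 2 * (chi2 \<omega> * g' (chi2 \<omega>)))"
  proof (rule Bochner_Integration.integral_diff)
    show "integrable M (\<lambda>\<omega>. (chi2 \<omega> - card I) * g (chi2 \<omega>))"
      by (rule integrable_mult_bounded[OF _ B]) (use integrable_chi2 in simp_all)
    show "integrable M (\<lambda>\<omega>. 2 * (chi2 \<omega> * g' (chi2 \<omega>)))"
      by (rule integrable_mult_right, rule integrable_mult_bounded[OF integrable_chi2 B']) simp
  qed
  finally show ?thesis by simp
qed

end

section \<open>Moments and normal approximation of the chi-square sum\<close>

context indep_std_normals
begin

lemma integrable_centered_square_power:
  assumes i: "i \<in> I"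
  shows "integrable M (\<lambda>\<omega>. ((Z i \<omega>)\<^sup>2 - 1) ^ k)"
proof -
  have eq: "((Z i \<omega>)\<^sup>2 - 1) ^ k = (\<Sum>j\<le>k. real (k choose j) * Z i \<omega> ^ (2 * j) * (-1) ^ (k - j))" for \<omega>
    using binomial_ring[of "(Z i \<omega>)\<^sup>2" "-1" k] by (simp add: power_mult)
  show ?thesis unfolding eq
    by (intro Bochner_Integration.integrable_sum integrable_mult_left integrable_mult_right integrable_Z_power i)
qed

lemma expectation_Z_even_power:
  assumes i: "i \<in> I"
  shows "expectation (\<lambda>\<omega>. Z i \<omega> ^ (2 * k)) = fact (2 * k) / (2 ^ k * fact k)"
  using expectation_Z(1)[OF i, of "\<lambda>x. x ^ (2 * k)"] std_normal_distribution_even_moments(1)[of k] by simp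

lemma centered_square_moments:
  assumes i: "i \<in> I"
  shows "expectation (\<lambda>\<omega>. (Z i \<omega>)\<^sup>2 - 1) = 0"
    and "expectation (\<lambda>\<omega>. ((Z i \<omega>)\<^sup>2 - 1)\<^sup>2) = 2"
    and "expectation (\<lambda>\<omega>. ((Z i \<omega>)\<^sup>2 - 1) ^ 4) = 60"
proof -
  note int = integrable_Z_power[OF i]
  have m2: "expectation (\<lambda>\<omega>. Z i \<omega> ^ 2) = 1" and m4: "expectation (\<lambda>\<omega>. Z i \<omega> ^ 4) = 3"
   and m6: "expectation (\<lambda>\<omega>. Z i \<omega> ^ 6) = 15" and m8: "expectation (\<lambda>\<omega>. Z i \<omega> ^ 8) = 105"
    using expectation_Z_even_power[OF i, of 1] expectation_Z_even_power[OF i, of 2]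
      expectation_Z_even_power[OF i, of 3] expectation_Z_even_power[OF i, of 4]
    by (simp_all add: fact_numeral)
  show "expectation (\<lambda>\<omega>. (Z i \<omega>)\<^sup>2 - 1) = 0"
    using int[of 2] m2 by (simp add: prob_space)
  have e2: "((Z i \<omega>)\<^sup>2 - 1)\<^sup>2 = Z i \<omega> ^ 4 - 2 * Z i \<omega> ^ 2 + 1" for \<omega>
    by (simp add: power2_eq_square power4_eq_xxxx algebra_simps)
  show "expectation (\<lambda>\<omega>. ((Z i \<omega>)\<^sup>2 - 1)\<^sup>2) = 2"
    unfolding e2 using int[of 2] int[of 4] m2 m4 by (simp add: prob_space)
  have e4: "((Z i \<omega>)\<^sup>2 - 1) ^ 4 = Z i \<omega> ^ 8 - 4 * Z i \<omega> ^ 6 + 6 * Z i \<omega> ^ 4 - 4 * Z i \<omega> ^ 2 + 1" for \<omega>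
    by (simp add: eval_nat_numeral algebra_simps)
  \<comment> \<open>The even moments 1, 3, 15, 105 combine to 105 - 60 + 18 - 4 + 1.\<close>
  show "expectation (\<lambda>\<omega>. ((Z i \<omega>)\<^sup>2 - 1) ^ 4) = 60"
    unfolding e4 using int[of 2] int[of 4] int[of 6] int[of 8] m2 m4 m6 m8 by (simp add: prob_space)
qed

text \<open>One independent centred summand is added at a time. In the fourth power the terms with a
  first power vanish and the mixed squares contribute 6 * 2 * 2k = 24k, where k is the old
  cardinality; 60 + 24k + 60k^2 stays below 60(k + 1)^2. Integrability of all powers is carried
  along because the mixed moments need it.\<close>

lemma centered_square_sum_moments:
  assumes "J \<subseteq> I"
  defines "S \<equiv> \<lambda>\<omega>. \<Sum>j\<in>J. (Z j \<omega>)\<^sup>2 - 1"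
  shows "(\<forall>k. integrable M (\<lambda>\<omega>. S \<omega> ^ k)) \<and> expectation S = 0 \<and>
    expectation (\<lambda>\<omega>. (S \<omega>)\<^sup>2) = 2 * real (card J) \<and> expectation (\<lambda>\<omega>. S \<omega> ^ 4) \<le> 60 * (real (card J))\<^sup>2"
proof -
  have "finite J" using assms(1) finite_I by (rule finite_subset)
  then show ?thesis using assms(1) unfolding S_def
  proof (induction J rule: finite_induct)
    case empty
    then show ?case by (simp add: power_0_left)
  next
    case (insert i J)
    define S where "S \<omega> = (\<Sum>j\<in>J. (Z j \<omega>)\<^sup>2 - 1)" for \<omega>
    define x where "x \<omega> = (Z i \<omega>)\<^sup>2 - 1" for \<omega>
    have i: "i \<in> I" and J: "J \<subseteq> I" using insert.prems by auto
    have IH: "integrable M (\<lambda>\<omega>. S \<omega> ^ k)" "expectation S = 0" "expectation (\<lambda>\<omega>. (S \<omega>)\<^sup>2) = 2 * real (card J)"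
      "expectation (\<lambda>\<omega>. S \<omega> ^ 4) \<le> 60 * (real (card J))\<^sup>2" for k
      using insert.IH[OF J] unfolding S_def by blast+
    have xk: "integrable M (\<lambda>\<omega>. x \<omega> ^ k)" for k unfolding x_def by (rule integrable_centered_square_power[OF i])
    have x: "expectation x = 0" "expectation (\<lambda>\<omega>. (x \<omega>)\<^sup>2) = 2" "expectation (\<lambda>\<omega>. x \<omega> ^ 4) = 60"
      unfolding x_def using centered_square_moments[OF i] by blast+
    have ind: "indep_var borel x borel S"
      unfolding x_def[abs_def] S_def[abs_def]
      by (rule indep_Z_sum[OF i J, where f="\<lambda>x. x\<^sup>2 - 1" and h="\<lambda>x. x\<^sup>2 - 1"]) (use insert.hyps in auto)
    have indk: "indep_var borel (\<lambda>\<omega>. x \<omega> ^ a) borel (\<lambda>\<omega>. S \<omega> ^ b)" for a b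
      using indep_var_compose[OF ind, of "\<lambda>y. y ^ a" borel "\<lambda>y. y ^ b" borel] by (simp add: comp_def)
    have prod_int: "integrable M (\<lambda>\<omega>. x \<omega> ^ a * S \<omega> ^ b)" for a b
      by (rule indep_var_integrable[OF indk xk IH(1)])
    have prod_eq: "expectation (\<lambda>\<omega>. x \<omega> ^ a * S \<omega> ^ b) = expectation (\<lambda>\<omega>. x \<omega> ^ a) * expectation (\<lambda>\<omega>. S \<omega> ^ b)" for a b
      by (rule indep_var_lebesgue_integral[OF indk xk IH(1)])
    have sum: "(\<Sum>j\<in>insert i J. (Z j \<omega>)\<^sup>2 - 1) = x \<omega> + S \<omega>" for \<omega>
      unfolding x_def S_def using insert.hyps by simp
    have "integrable M (\<lambda>\<omega>. (x \<omega> + S \<omega>) ^ k)" for k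
      unfolding binomial_ring mult.assoc by (intro Bochner_Integration.integrable_sum integrable_mult_right prod_int)
    moreover have "expectation (\<lambda>\<omega>. x \<omega> + S \<omega>) = 0"
      using xk[of 1] IH(1)[of 1] x IH(2) by simp
    moreover have "expectation (\<lambda>\<omega>. (x \<omega> + S \<omega>)\<^sup>2) = 2 * real (card (insert i J))"
    proof -
      have "(x \<omega> + S \<omega>)\<^sup>2 = x \<omega> ^ 2 + 2 * (x \<omega> ^ 1 * S \<omega> ^ 1) + S \<omega> ^ 2" for \<omega>
        by (simp add: power2_eq_square algebra_simps)
      then have "expectation (\<lambda>\<omega>. (x \<omega> + S \<omega>)\<^sup>2) = expectation (\<lambda>\<omega>. x \<omega> ^ 2 + 2 * (x \<omega> ^ 1 * S \<omega> ^ 1) + S \<omega> ^ 2)"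
        by (simp only:)
      also have "\<dots> = expectation (\<lambda>\<omega>. x \<omega> ^ 2) + 2 * expectation (\<lambda>\<omega>. x \<omega> ^ 1 * S \<omega> ^ 1) + expectation (\<lambda>\<omega>. S \<omega> ^ 2)"
        using xk[of 2] prod_int[of 1 1] IH(1)[of 2] by (simp del: power_one_right)
      also have "\<dots> = 2 * real (card (insert i J))" unfolding prod_eq using x IH(2,3) insert.hyps by simp
      finally show ?thesis .
    qed
    moreover have "expectation (\<lambda>\<omega>. (x \<omega> + S \<omega>) ^ 4) \<le> 60 * (real (card (insert i J)))\<^sup>2"
    proof -
      have "(x \<omega> + S \<omega>) ^ 4 = x \<omega> ^ 4 + 4 * (x \<omega> ^ 3 * S \<omega> ^ 1) + 6 * (x \<omega> ^ 2 * S \<omega> ^ 2) + 4 * (x \<omega> ^ 1 * S \<omega> ^ 3) + S \<omega> ^ 4" for \<omega>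
        by (simp add: eval_nat_numeral algebra_simps)
      then have "expectation (\<lambda>\<omega>. (x \<omega> + S \<omega>) ^ 4) =
         expectation (\<lambda>\<omega>. x \<omega> ^ 4 + 4 * (x \<omega> ^ 3 * S \<omega> ^ 1) + 6 * (x \<omega> ^ 2 * S \<omega> ^ 2) + 4 * (x \<omega> ^ 1 * S \<omega> ^ 3) + S \<omega> ^ 4)"
        by (simp only:)
      also have "\<dots> = expectation (\<lambda>\<omega>. x \<omega> ^ 4) + 4 * expectation (\<lambda>\<omega>. x \<omega> ^ 3 * S \<omega> ^ 1)
         + 6 * expectation (\<lambda>\<omega>. x \<omega> ^ 2 * S \<omega> ^ 2) + 4 * expectation (\<lambda>\<omega>. x \<omega> ^ 1 * S \<omega> ^ 3) + expectation (\<lambda>\<omega>. S \<omega> ^ 4)"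
        using xk[of 4] prod_int[of 3 1] prod_int[of 2 2] prod_int[of 1 3] IH(1)[of 4] by (simp del: power_one_right)
      also have "\<dots> = 60 + 24 * real (card J) + expectation (\<lambda>\<omega>. S \<omega> ^ 4)"
        unfolding prod_eq using x IH(2,3) by simp
      also have "\<dots> \<le> 60 + 24 * real (card J) + 60 * (real (card J))\<^sup>2" using IH(4) by simp
      also have "\<dots> \<le> 60 * (real (card (insert i J)))\<^sup>2"
        using insert.hyps by (simp add: power2_eq_square algebra_simps)
      finally show ?thesis by simp
    qed
    ultimately show ?case unfolding sum by blast
  qed
qed

lemma chi2_centered: "(\<Sum>j\<in>I. (Z j \<omega>)\<^sup>2 - 1) = chi2 \<omega> - card I"
  by (simp add: chi2_def sum_subtractf)

lemma chi2_moments: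
  shows "integrable M (\<lambda>\<omega>. (chi2 \<omega> - card I) ^ k)"
    and "expectation chi2 = card I"
    and "expectation (\<lambda>\<omega>. (chi2 \<omega> - card I)\<^sup>2) = 2 * real (card I)"
    and "expectation (\<lambda>\<omega>. (chi2 \<omega> - card I) ^ 4) \<le> 60 * (real (card I))\<^sup>2"
proof -
  note m = centered_square_sum_moments[OF order_refl, unfolded chi2_centered]
  show "integrable M (\<lambda>\<omega>. (chi2 \<omega> - card I) ^ k)" "expectation (\<lambda>\<omega>. (chi2 \<omega> - card I)\<^sup>2) = 2 * real (card I)"
    "expectation (\<lambda>\<omega>. (chi2 \<omega> - card I) ^ 4) \<le> 60 * (real (card I))\<^sup>2"
    using m by blast+
  have "expectation (\<lambda>\<omega>. chi2 \<omega> - card I) = 0" using m by blast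
  then show "expectation chi2 = card I" using integrable_chi2 by (simp add: prob_space)
qed

text \<open>In the application \<open>I\<close> has n - 1 elements, so the denominator is the
  sqrt(2n) inherited from Q_n and the variance is (n - 1)/n.\<close>

definition std_chi2 :: "'a \<Rightarrow> real" where
  "std_chi2 \<omega> = (chi2 \<omega> - card I) / sqrt (2 * (real (card I) + 1))"

lemma std_chi2_measurable [measurable]: "std_chi2 \<in> borel_measurable M"
  unfolding std_chi2_def[abs_def] by measurable

lemma std_chi2_second_moment: "integrable M (\<lambda>\<omega>. (std_chi2 \<omega>)\<^sup>2)" "expectation (\<lambda>\<omega>. (std_chi2 \<omega>)\<^sup>2) \<le> 1"
proof -
  define s where "s = 2 * (real (card I) + 1)"
  have s: "s > 0" by (simp add: s_def)
  have e: "(std_chi2 \<omega>)\<^sup>2 = (chi2 \<omega> - card I)\<^sup>2 / s" for \<omega>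
    using s unfolding std_chi2_def s_def[symmetric] by (simp add: power_divide)
  show "integrable M (\<lambda>\<omega>. (std_chi2 \<omega>)\<^sup>2)" unfolding e using chi2_moments(1)[of 2] by simp
  have "expectation (\<lambda>\<omega>. (std_chi2 \<omega>)\<^sup>2) = 2 * real (card I) / s" unfolding e using chi2_moments(3) by simp
  also have "\<dots> \<le> 1" by (simp add: s_def)
  finally show "expectation (\<lambda>\<omega>. (std_chi2 \<omega>)\<^sup>2) \<le> 1" .
qed

lemma integrable_std_chi2: "integrable M std_chi2"
  unfolding std_chi2_def[abs_def] using integrable_chi2 by simp

text \<open>Stein's equation, with the left-hand side rewritten through integration by parts: the factor
  $1 - \chi^2/n$ is one minus the Stein kernel of $F$.\<close>
lemma stein_identity:
  "prob {\<omega> \<in> space M. std_chi2 \<omega> \<le> z} - Phi z =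
   expectation (\<lambda>\<omega>. stein_deriv z (std_chi2 \<omega>) * (1 - chi2 \<omega> / (real (card I) + 1)))"
proof -
  define n where "n = real (card I) + 1"
  define s where "s = sqrt (2 * n)"
  have n: "0 < n" by (simp add: n_def)
  have s: "0 < s" "s * s = 2 * n" using n by (simp_all add: s_def)
  define L where "L y = (y - card I) / s" for y :: real
  have FL: "std_chi2 \<omega> = L (chi2 \<omega>)" for \<omega> by (simp add: std_chi2_def L_def s_def n_def)
  obtain B where B: "\<And>x. \<bar>stein z x\<bar> \<le> B" using stein_bounded by blast
  have "expectation (\<lambda>\<omega>. (chi2 \<omega> - card I) * stein z (L (chi2 \<omega>))) =
    2 * expectation (\<lambda>\<omega>. chi2 \<omega> * (stein_deriv z (L (chi2 \<omega>)) * (1 / s)))"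
  \<comment> \<open>The exceptional point is the preimage of the kink z under L, and 1/s is the
    chain rule factor.\<close>
  proof (rule chi2_by_parts[where c="card I + s * z" and B=B and B'="1 / s"])
    show "continuous_on UNIV (\<lambda>y. stein z (L y))"
      unfolding L_def using s by (intro continuous_on_compose2[OF continuous_on_stein[of UNIV]] continuous_intros) auto
    show "((\<lambda>y. stein z (L y)) has_real_derivative stein_deriv z (L y) * (1 / s)) (at y)" if "y \<noteq> card I + s * z" for y
    proof (rule DERIV_chain2[where f="stein z"])
      show "(stein z has_real_derivative stein_deriv z (L y)) (at (L y))"
        by (rule stein_has_deriv) (use that s in \<open>auto simp: L_def field_simps\<close>)
      show "(L has_real_derivative 1 / s) (at y)"
        unfolding L_def[abs_def] using s(1) by (auto intro!: derivative_eq_intros)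
    qed
    show "\<bar>stein_deriv z (L y) * (1 / s)\<bar> \<le> 1 / s" for y
      using stein_deriv_bound[of z "L y"] s by (simp add: abs_mult divide_right_mono)
    have [measurable]: "L \<in> borel_measurable borel" unfolding L_def[abs_def] by measurable
    show "(\<lambda>y. stein_deriv z (L y) * (1 / s)) \<in> borel_measurable borel" by measurable
  qed (rule B)
  \<comment> \<open>After division by s the right side carries 2/(s * s), which is 1/n.\<close>
  then have "expectation (\<lambda>\<omega>. (chi2 \<omega> - card I) * stein z (std_chi2 \<omega>)) / s =
     2 * expectation (\<lambda>\<omega>. chi2 \<omega> * stein_deriv z (std_chi2 \<omega>)) / (s * s)"
    unfolding FL using s(1) by (simp add: field_simps)
  then have ibp: "expectation (\<lambda>\<omega>. std_chi2 \<omega> * stein z (std_chi2 \<omega>)) = expectation (\<lambda>\<omega>. chi2 \<omega> / n * stein_deriv z (std_chi2 \<omega>))"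
    unfolding s(2) by (simp add: std_chi2_def n_def[symmetric] s_def[symmetric])
  have i1: "integrable M (\<lambda>\<omega>. std_chi2 \<omega> * stein z (std_chi2 \<omega>))"
    by (rule integrable_mult_bounded[OF integrable_std_chi2 B]) simp
  have i2: "integrable M (\<lambda>\<omega>. chi2 \<omega> / n * stein_deriv z (std_chi2 \<omega>))"
    by (rule integrable_mult_bounded[OF _ stein_deriv_bound]) (use integrable_chi2 in simp_all)
  have i3: "integrable M (\<lambda>\<omega>. stein_deriv z (std_chi2 \<omega>))"
    by (rule integrable_const_bound[where B=1]) (use stein_deriv_bound in auto)
  have "prob {\<omega> \<in> space M. std_chi2 \<omega> \<le> z} = expectation (indicator {\<omega> \<in> space M. std_chi2 \<omega> \<le> z})" by simp
  also have "\<dots> = expectation (\<lambda>\<omega>. stein_deriv z (std_chi2 \<omega>) - std_chi2 \<omega> * stein z (std_chi2 \<omega>) + Phi z)"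
    by (rule Bochner_Integration.integral_cong) (auto simp: stein_deriv_def indicator_def)
  also have "\<dots> = expectation (\<lambda>\<omega>. stein_deriv z (std_chi2 \<omega>)) - expectation (\<lambda>\<omega>. std_chi2 \<omega> * stein z (std_chi2 \<omega>)) + Phi z"
    using i1 i3 by (simp add: prob_space)
  also have "\<dots> = expectation (\<lambda>\<omega>. stein_deriv z (std_chi2 \<omega>) - chi2 \<omega> / n * stein_deriv z (std_chi2 \<omega>)) + Phi z"
    unfolding ibp using i2 i3 by simp
  also have "(\<lambda>\<omega>. stein_deriv z (std_chi2 \<omega>) - chi2 \<omega> / n * stein_deriv z (std_chi2 \<omega>)) = (\<lambda>\<omega>. stein_deriv z (std_chi2 \<omega>) * (1 - chi2 \<omega> / n))"
    by (simp add: algebra_simps)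
  finally show ?thesis unfolding n_def by simp
qed

lemma kolmogorov_bound:
  "\<bar>prob {\<omega> \<in> space M. std_chi2 \<omega> \<le> z} - Phi z\<bar> \<le> sqrt (2 * (real (card I) + 1) - 1) / (real (card I) + 1)"
proof -
  define n where "n = real (card I) + 1"
  have n: "0 < n" by (simp add: n_def)
  define K where "K \<omega> = 1 - chi2 \<omega> / n" for \<omega>
  have [measurable]: "K \<in> borel_measurable M" unfolding K_def[abs_def] by measurable
  have intK: "integrable M K" unfolding K_def[abs_def] using integrable_chi2 by simp
  have K2: "(K \<omega>)\<^sup>2 = (1 - 2 * (chi2 \<omega> - card I) + (chi2 \<omega> - card I)\<^sup>2) / n\<^sup>2" for \<omega>
  proof -
    have "K \<omega> = (1 - (chi2 \<omega> - card I)) / n" using n by (simp add: K_def n_def field_simps)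
    then show ?thesis by (simp add: power_divide power2_eq_square algebra_simps)
  qed
  have intK2: "integrable M (\<lambda>\<omega>. (K \<omega>)\<^sup>2)"
    unfolding K2 using chi2_moments(1)[of 2] integrable_chi2 by simp
  \<comment> \<open>The numerator is 2(n - 1) + 1: the variance of the chi-square sum plus the
    squared offset from measuring it against n and not n - 1.\<close>
  have EK2: "expectation (\<lambda>\<omega>. (K \<omega>)\<^sup>2) = (2 * n - 1) / n\<^sup>2"
    unfolding K2 using chi2_moments(1)[of 2] chi2_moments(2,3) integrable_chi2
    by (simp add: prob_space n_def)
  have "\<bar>prob {\<omega> \<in> space M. std_chi2 \<omega> \<le> z} - Phi z\<bar> = \<bar>expectation (\<lambda>\<omega>. stein_deriv z (std_chi2 \<omega>) * K \<omega>)\<bar>"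
    unfolding stein_identity K_def n_def ..
  also have "\<dots> \<le> expectation (\<lambda>\<omega>. \<bar>stein_deriv z (std_chi2 \<omega>) * K \<omega>\<bar>)" by (rule integral_abs_bound)
  also have "\<dots> \<le> expectation (\<lambda>\<omega>. \<bar>K \<omega>\<bar>)"
  proof (rule integral_mono)
    show "integrable M (\<lambda>\<omega>. \<bar>stein_deriv z (std_chi2 \<omega>) * K \<omega>\<bar>)"
      using integrable_mult_bounded[OF intK stein_deriv_bound[of z "std_chi2 _"]] by (simp add: mult.commute)
    show "integrable M (\<lambda>\<omega>. \<bar>K \<omega>\<bar>)" using intK by simp
    show "\<bar>stein_deriv z (std_chi2 \<omega>) * K \<omega>\<bar> \<le> \<bar>K \<omega>\<bar>" for \<omega>
      using mult_right_mono[OF stein_deriv_bound[of z "std_chi2 \<omega>"], of "\<bar>K \<omega>\<bar>"] by (simp add: abs_mult)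
  qed
  also have "\<dots> \<le> sqrt ((2 * n - 1) / n\<^sup>2)"
  proof (rule real_le_rsqrt)
    \<comment> \<open>Nonnegativity of the variance is the Cauchy-Schwarz inequality against the
      constant 1.\<close>
    have "0 \<le> variance (\<lambda>\<omega>. \<bar>K \<omega>\<bar>)" by (rule variance_positive)
    also have "\<dots> = expectation (\<lambda>\<omega>. \<bar>K \<omega>\<bar>\<^sup>2) - (expectation (\<lambda>\<omega>. \<bar>K \<omega>\<bar>))\<^sup>2"
      by (rule variance_eq) (use intK intK2 in auto)
    finally show "(expectation (\<lambda>\<omega>. \<bar>K \<omega>\<bar>))\<^sup>2 \<le> (2 * n - 1) / n\<^sup>2" using EK2 by simp
  qed
  also have "\<dots> = sqrt (2 * n - 1) / n" using n by (simp add: real_sqrt_divide)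
  finally show ?thesis unfolding n_def .
qed

end

section \<open>The maximum likelihood estimators\<close>

context prob_space
begin

text \<open>Expressed through the second moment, the cosine formula covers the degenerate case of an
  almost surely vanishing combination together with the normal one.\<close>

lemma gaussian_combination:
  fixes a :: "nat \<Rightarrow> real"
  assumes G: "centered_gaussian_process M G" and s: "\<And>i. i < n \<Longrightarrow> 0 \<le> s i"
  defines "X \<equiv> \<lambda>\<omega>. \<Sum>i<n. a i * G (s i) \<omega>"
  shows "random_variable borel X" and "integrable M (\<lambda>\<omega>. (X \<omega>)\<^sup>2)"
    and "expectation (\<lambda>\<omega>. cos (\<psi> + X \<omega>)) = cos \<psi> * exp (- expectation (\<lambda>\<omega>. (X \<omega>)\<^sup>2) / 2)"
proof -
  have Gm: "random_variable borel (G (s i))" if "i < n" for i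
    using G s[OF that] unfolding centered_gaussian_process_def by blast
  show X[measurable]: "random_variable borel X" unfolding X_def using Gm by measurable
  have "(AE \<omega> in M. X \<omega> = 0) \<or> (\<exists>v>0. distributed M lborel X (normal_density 0 v))"
    using G s unfolding centered_gaussian_process_def X_def Let_def by blast
  then have "integrable M (\<lambda>\<omega>. (X \<omega>)\<^sup>2) \<and>
    expectation (\<lambda>\<omega>. cos (\<psi> + X \<omega>)) = cos \<psi> * exp (- expectation (\<lambda>\<omega>. (X \<omega>)\<^sup>2) / 2)"
  proof
    assume ae: "AE \<omega> in M. X \<omega> = 0"
    have 1: "integrable M (\<lambda>\<omega>. (X \<omega>)\<^sup>2)"
      by (rule integrable_const_bound[where B=0]) (use ae in auto)
    have 2: "expectation (\<lambda>\<omega>. (X \<omega>)\<^sup>2) = expectation (\<lambda>_. 0)"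
      by (rule integral_cong_AE) (use ae in auto)
    have 3: "expectation (\<lambda>\<omega>. cos (\<psi> + X \<omega>)) = expectation (\<lambda>_. cos \<psi>)"
      by (rule integral_cong_AE) (use ae in auto)
    show ?thesis using 1 2 3 by (simp add: prob_space)
  next
    assume "\<exists>v>0. distributed M lborel X (normal_density 0 v)"
    then obtain v where v: "0 < v" and d: "distributed M lborel X (normal_density 0 v)" by blast
    \<comment> \<open>The second parameter of \<open>normal_density\<close> is the standard
      deviation.\<close>
    define Y where "Y \<omega> = X \<omega> / v" for \<omega>
    have [measurable]: "random_variable borel Y" unfolding Y_def[abs_def] by measurable
    have "distributed M lborel Y std_normal_density"
      using d normal_standard_normal_convert[OF v, of X 0] unfolding Y_def[abs_def] by simp
    then have "distr M lborel Y = std_normal_distribution" by (simp add: distributed_def)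
    then have Y: "distr M borel Y = std_normal_distribution"
      by (metis distr_cong sets_lborel)
    have XY: "X \<omega> = v * Y \<omega>" for \<omega> using v by (simp add: Y_def)
    have i2: "integrable M (\<lambda>\<omega>. (Y \<omega>)\<^sup>2)"
      using integrable_std_normal_distribution_moment[of 2] unfolding Y[symmetric]
      by (subst (asm) integrable_distr_eq) auto
    have "expectation (\<lambda>\<omega>. (Y \<omega>)\<^sup>2) = (\<integral>x. x\<^sup>2 \<partial>std_normal_distribution)"
      unfolding Y[symmetric] by (subst integral_distr) auto
    then have e2: "expectation (\<lambda>\<omega>. (Y \<omega>)\<^sup>2) = 1"
      using std_normal_distribution_even_moments(1)[of 1] by simp
    have "expectation (\<lambda>\<omega>. cos (\<psi> + v * Y \<omega>)) = (\<integral>x. cos (\<psi> + v * x) \<partial>std_normal_distribution)"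
      unfolding Y[symmetric] by (subst integral_distr) auto
    then have ec: "expectation (\<lambda>\<omega>. cos (\<psi> + v * Y \<omega>)) = cos \<psi> * exp (- v\<^sup>2 / 2)"
      by (simp only: std_normal_integral_cos)
    show ?thesis unfolding XY ec power_mult_distrib using i2 e2 by simp
  qed
  then show "integrable M (\<lambda>\<omega>. (X \<omega>)\<^sup>2)"
    "expectation (\<lambda>\<omega>. cos (\<psi> + X \<omega>)) = cos \<psi> * exp (- expectation (\<lambda>\<omega>. (X \<omega>)\<^sup>2) / 2)"
    by blast+
qed

lemma gaussian_combination_variance:
  assumes G: "centered_gaussian_process M G" and ts: "\<And>i. 0 \<le> ts (Suc i)"
  shows "expectation (\<lambda>\<omega>. (\<Sum>i<n. a i * G (ts (Suc i)) \<omega>)\<^sup>2) = bilin n a (Vmat M G ts) a"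
proof -
  have m[measurable]: "random_variable borel (G (ts (Suc i)))" for i
    using G ts unfolding centered_gaussian_process_def by blast
  have sq: "integrable M (\<lambda>\<omega>. (G (ts (Suc i)) \<omega>)\<^sup>2)" for i
    using gaussian_combination(2)[OF G, of 1 "\<lambda>_. ts (Suc i)" "\<lambda>_. 1"] ts by simp
  have prod: "integrable M (\<lambda>\<omega>. G (ts (Suc i)) \<omega> * G (ts (Suc j)) \<omega>)" for i j
  proof (rule Bochner_Integration.integrable_bound[OF Bochner_Integration.integrable_add[OF sq[of i] sq[of j]]])
    have "\<bar>x * y\<bar> \<le> \<bar>x\<^sup>2 + y\<^sup>2\<bar>" for x y :: real
    proof -
      have "0 \<le> (\<bar>x\<bar> - \<bar>y\<bar>)\<^sup>2" by simp
      then have "2 * (\<bar>x\<bar> * \<bar>y\<bar>) \<le> x\<^sup>2 + y\<^sup>2" by (simp add: power2_diff)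
      moreover have "0 \<le> \<bar>x\<bar> * \<bar>y\<bar>" by simp
      ultimately show ?thesis unfolding abs_mult by linarith
    qed
    then show "AE \<omega> in M. norm (G (ts (Suc i)) \<omega> * G (ts (Suc j)) \<omega>) \<le> norm ((G (ts (Suc i)) \<omega>)\<^sup>2 + (G (ts (Suc j)) \<omega>)\<^sup>2)"
      by (intro AE_I2) simp
  qed measurable
  have "(\<Sum>i<n. a i * G (ts (Suc i)) \<omega>)\<^sup>2 =
      (\<Sum>i<n. \<Sum>j<n. a i * a j * (G (ts (Suc i)) \<omega> * G (ts (Suc j)) \<omega>))" for \<omega>
    unfolding power2_eq_square sum_product by (simp add: mult_ac)
  then have "expectation (\<lambda>\<omega>. (\<Sum>i<n. a i * G (ts (Suc i)) \<omega>)\<^sup>2) =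
     (\<Sum>i<n. \<Sum>j<n. a i * a j * expectation (\<lambda>\<omega>. G (ts (Suc i)) \<omega> * G (ts (Suc j)) \<omega>))"
    using prod by simp
  also have "\<dots> = bilin n a (Vmat M G ts) a"
    unfolding bilin_def Vmat_def Rcov_def by (simp add: mult_ac)
  finally show ?thesis .
qed

text \<open>A combination of coordinates is again a combination of values of G, and orthonormality
  gives it the variance that independent standard normals would produce; the cosine transforms
  therefore agree.\<close>

lemma orthonormal_coordinates_indep:
  assumes G: "centered_gaussian_process M G" and ts: "\<And>i. 0 \<le> ts (Suc i)"
    and a: "orthonormal_family n (Vmat M G ts) a" and n: "1 \<le> n"
  shows "indep_std_normals M (\<lambda>i \<omega>. dotn n (a i) (\<lambda>l. G (ts (Suc l)) \<omega>)) {..<n}"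
proof -
  define Z where "Z i \<omega> = dotn n (a i) (\<lambda>l. G (ts (Suc l)) \<omega>)" for i \<omega>
  have Zm: "random_variable borel (Z i)" for i
    unfolding Z_def[abs_def] dotn_def by (rule gaussian_combination(1)[OF G]) (rule ts)
  have comb: "(\<Sum>i<n. c i * Z i \<omega>) = (\<Sum>l<n. (\<Sum>i<n. c i * a i l) * G (ts (Suc l)) \<omega>)" for c \<omega>
    unfolding Z_def dotn_def sum_distrib_left sum_distrib_right by (subst sum.swap) (simp add: mult.assoc)
  have norm: "bilin n (\<lambda>l. \<Sum>i<n. c i * a i l) (Vmat M G ts) (\<lambda>l. \<Sum>i<n. c i * a i l) = (\<Sum>i<n. (c i)\<^sup>2)" for c
  proof -
    have "bilin n (\<lambda>l. \<Sum>i<n. c i * a i l) V (\<lambda>l. \<Sum>i<n. c i * a i l) =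
       (\<Sum>i<n. \<Sum>j<n. c i * c j * bilin n (a i) V (a j))" for V
    proof -
      have "bilin n (\<lambda>l. \<Sum>i<n. c i * a i l) V (\<lambda>l. \<Sum>i<n. c i * a i l) =
         (\<Sum>l<n. \<Sum>m<n. \<Sum>i<n. \<Sum>j<n. c i * c j * (a i l * V l m * a j m))"
        unfolding bilin_def by (simp add: sum_distrib_left sum_distrib_right mult_ac)
      also have "\<dots> = (\<Sum>l<n. \<Sum>i<n. \<Sum>m<n. \<Sum>j<n. c i * c j * (a i l * V l m * a j m))"
        by (intro sum.cong refl sum.swap)
      also have "\<dots> = (\<Sum>i<n. \<Sum>l<n. \<Sum>m<n. \<Sum>j<n. c i * c j * (a i l * V l m * a j m))"
        by (rule sum.swap)
      also have "\<dots> = (\<Sum>i<n. \<Sum>l<n. \<Sum>j<n. \<Sum>m<n. c i * c j * (a i l * V l m * a j m))"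
        by (intro sum.cong refl sum.swap)
      also have "\<dots> = (\<Sum>i<n. \<Sum>j<n. \<Sum>l<n. \<Sum>m<n. c i * c j * (a i l * V l m * a j m))"
        by (intro sum.cong refl sum.swap)
      finally show ?thesis unfolding bilin_def by (simp add: sum_distrib_left)
    qed
    also have "(\<Sum>i<n. \<Sum>j<n. c i * c j * bilin n (a i) (Vmat M G ts) (a j)) = (\<Sum>i<n. \<Sum>j<n. if i = j then c i * c j else 0)"
      using a unfolding orthonormal_family_def by (intro sum.cong) auto
    also have "\<dots> = (\<Sum>i<n. (c i)\<^sup>2)" by (simp add: power2_eq_square)
    finally show ?thesis .
  qed
  have cs: "expectation (\<lambda>\<omega>. cos (\<psi> + (\<Sum>i<n. c i * Z i \<omega>))) = cos \<psi> * exp (- (\<Sum>i<n. (c i)\<^sup>2) / 2)" for \<psi> c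
    using gaussian_combination(3)[where s="\<lambda>l. ts (Suc l)", OF G ts, where n=n and \<psi>=\<psi> and a="\<lambda>l. \<Sum>i<n. c i * a i l"]
    unfolding gaussian_combination_variance[where ts=ts, OF G ts] norm comb .
  show ?thesis
    unfolding Z_def[symmetric] using indep_std_normal_of_char[OF Zm cs n]
    by unfold_locales auto
qed

text \<open>The coordinates are taken along a $V$-orthonormal family whose members other than the first
  annihilate $\mathbf t$.\<close>
lemma mle_representation:
  assumes G: "centered_gaussian_process M G" and ts: "\<And>i. 0 < ts (Suc i)" and sg: "0 < sg"
    and V: "strictly_pos_def n (Vmat M G ts)" and n: "1 \<le> n"
  defines "T \<equiv> bilin n (tvec ts) (inv_mat n (Vmat M G ts)) (tvec ts)"
  shows "0 < T" and "\<exists>Z. indep_std_normals M Z {..<n} \<and>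
    (\<forall>\<omega>. mu_hat M G mu sg ts n \<omega> = mu + sg * (Z 0 \<omega> / sqrt T)) \<and>
    (\<forall>\<omega>. sigma2_hat M G mu sg ts n \<omega> = sg\<^sup>2 / real n * (\<Sum>i\<in>{1..<n}. (Z i \<omega>)\<^sup>2))"
proof -
  define t where "t = tvec ts"
  obtain a where a: "orthonormal_family n (Vmat M G ts) a" and at: "\<And>i. 0 < i \<Longrightarrow> i < n \<Longrightarrow> dotn n (a i) t = 0"
    and a0: "0 \<le> dotn n (a 0) t"
    using orthonormal_family_adapted[OF V n, of t] by blast
  define q where "q = dotn n (a 0) t"
  define Z where "Z i \<omega> = dotn n (a i) (\<lambda>l. G (ts (Suc l)) \<omega>)" for i \<omega>
  note W = bilin_inv_mat_orthonormal[OF V a]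
  have split: "(\<Sum>k<n. f k) = f 0 + (\<Sum>k\<in>{1..<n}. f k)" for f :: "nat \<Rightarrow> real"
    using n by (simp add: lessThan_atLeast0 sum.atLeast_Suc_lessThan)
  \<comment> \<open>Only the coordinate 0 sees t, so a pairing with t collapses to one term.\<close>
  have tW: "bilin n t (inv_mat n (Vmat M G ts)) u = q * dotn n (a 0) u" for u
    unfolding W split using at by (simp add: q_def)
  have T: "T = q * q" unfolding T_def t_def[symmetric] tW by (simp add: q_def)
  \<comment> \<open>A positive first observation time forces T to be nonzero; with T = q * q and q
    \<ge> 0 this makes q the square root of T.\<close>
  have "(t 0)\<^sup>2 \<le> Vmat M G ts 0 0 * T"
    unfolding T_def t_def[symmetric] by (rule inv_mat_Cauchy_Schwarz[OF V]) (use n in simp)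
  moreover have "0 < (t 0)\<^sup>2" using ts[of 0] by (simp add: t_def tvec_def)
  ultimately have "T \<noteq> 0" by auto
  then have q: "0 < q" using T a0 unfolding q_def[symmetric] by auto
  then show "0 < T" unfolding T by simp
  have sq: "sqrt T = q" unfolding T using q by simp
  have X: "dotn n (a i) (Xvec G mu sg ts \<omega>) = mu * dotn n (a i) t + sg * Z i \<omega>" for i \<omega>
    unfolding dotn_def Xvec_def t_def tvec_def Z_def
    by (simp add: distrib_left sum.distrib sum_distrib_left mult_ac)
  have mu: "mu_hat M G mu sg ts n \<omega> = mu + sg * (Z 0 \<omega> / sqrt T)" for \<omega>
    unfolding mu_hat_def Let_def t_def[symmetric] tW X sq using q by (simp add: q_def[symmetric] field_simps)
  have "bilin n (Xvec G mu sg ts \<omega>) (inv_mat n (Vmat M G ts)) (Xvec G mu sg ts \<omega>) =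
    (mu * q + sg * Z 0 \<omega>)\<^sup>2 + sg\<^sup>2 * (\<Sum>i\<in>{1..<n}. (Z i \<omega>)\<^sup>2)" for \<omega>
    unfolding W X split using at by (simp add: q_def power2_eq_square sum_distrib_left mult_ac)
  \<comment> \<open>In the numerator of the variance estimator the square of coordinate 0, and with
    it the drift, cancels.\<close>
  then have sigma: "sigma2_hat M G mu sg ts n \<omega> = sg\<^sup>2 / real n * (\<Sum>i\<in>{1..<n}. (Z i \<omega>)\<^sup>2)" for \<omega>
    unfolding sigma2_hat_def Let_def t_def[symmetric] tW X using q
    by (simp add: q_def[symmetric] field_simps power2_eq_square)
  have "indep_std_normals M Z {..<n}"
    unfolding Z_def[abs_def] by (rule orthonormal_coordinates_indep[OF G _ a n]) (use ts in \<open>simp add: less_imp_le\<close>)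
  with mu sigma show "\<exists>Z. indep_std_normals M Z {..<n} \<and>
    (\<forall>\<omega>. mu_hat M G mu sg ts n \<omega> = mu + sg * (Z 0 \<omega> / sqrt T)) \<and>
    (\<forall>\<omega>. sigma2_hat M G mu sg ts n \<omega> = sg\<^sup>2 / real n * (\<Sum>i\<in>{1..<n}. (Z i \<omega>)\<^sup>2))" by blast
qed

end

section \<open>Convergence in law of a pair with one exactly normal component\<close>

lemma indep_std_normals_subset:
  assumes "indep_std_normals M Z I" "J \<subseteq> I"
  shows "indep_std_normals M Z J"
proof -
  interpret indep_std_normals M Z I by fact
  show ?thesis
    using indep_vars_subset[OF indep assms(2)] law assms(2) finite_subset[OF assms(2) finite_I]
    by unfold_locales auto
qed

text \<open>The first component already has its limit law for every n. Integrating it out leaves a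
  bounded continuous function g of the second component, so the bivariate limit reduces to weak
  convergence on the line. The hypotheses start at \<open>Suc n\<close> because the estimators are
  described only for at least one observation.\<close>

lemma conv_law_std_normal2_of_indep:
  assumes M: "prob_space M"
    and ind: "\<And>n. prob_space.indep_var M borel (Y (Suc n)) borel (Q (Suc n))"
    and law: "\<And>n. distr M borel (Y (Suc n)) = std_normal_distribution"
    and conv: "weak_conv_m (\<lambda>n. distr M borel (Q (Suc n))) std_normal_distribution"
  shows "conv_law_std_normal2 M Y Q"
  unfolding conv_law_std_normal2_def
proof (intro allI impI)
  interpret prob_space M by fact
  interpret N: real_distribution std_normal_distribution by (rule real_dist_normal_dist)
  interpret P: pair_prob_space std_normal_distribution std_normal_distribution ..
  fix f :: "real \<times> real \<Rightarrow> real" assume f: "continuous_on UNIV f \<and> bounded (range f)"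
  then obtain B where B: "\<And>p. norm (f p) \<le> B" unfolding bounded_iff by auto
  have fm[measurable]: "f \<in> borel_measurable borel" using f by (intro borel_measurable_continuous_onI) simp
  have fm2[measurable]: "f \<in> borel_measurable (borel \<Otimes>\<^sub>M borel)" using fm by (simp only: borel_prod)
  have Qm: "random_variable borel (Q (Suc n))" and Ym: "random_variable borel (Y (Suc n))" for n
    using ind[of n] indep_var_rv2 indep_var_rv1 by blast+
  define g where "g q = (\<integral>y. f (y, q) \<partial>std_normal_distribution)" for q
  have gB: "norm (g q) \<le> B" for q
  proof -
    have "norm (g q) \<le> (\<integral>y. B \<partial>std_normal_distribution)"
      unfolding g_def by (rule Bochner_Integration.integral_norm_bound_integral) (use B in \<open>auto intro!: N.integrable_const_bound[where B=B]\<close>)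
    then show ?thesis using N.prob_space by simp
  qed
  have gc: "isCont g q" for q
    unfolding continuous_at_sequentially
  proof (intro allI impI)
    fix x assume x: "x \<longlonglongrightarrow> q"
    show "(g \<circ> x) \<longlonglongrightarrow> g q"
      unfolding comp_def g_def
    proof (rule integral_dominated_convergence[where w="\<lambda>_. B"])
      show "AE y in std_normal_distribution. (\<lambda>i. f (y, x i)) \<longlonglongrightarrow> f (y, q)"
      proof (rule AE_I2)
        fix y
        have "isCont f (y, q)" using f by (simp add: continuous_on_eq_continuous_at)
        then show "(\<lambda>i. f (y, x i)) \<longlonglongrightarrow> f (y, q)"
          by (rule isCont_tendsto_compose) (intro tendsto_Pair tendsto_const x)
      qed
    qed (use B in auto)
  qed
  have "(\<lambda>p. \<phi> (fst p) * \<phi> (snd p)) \<in> borel_measurable (borel \<Otimes>\<^sub>M borel)" by measurable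
  then have dm[measurable]: "(\<lambda>p::real \<times> real. \<phi> (fst p) * \<phi> (snd p)) \<in> borel_measurable borel" by (simp only: borel_prod)
  have gm: "g \<in> borel_measurable borel" using gc by (intro borel_measurable_continuous_onI continuous_at_imp_continuous_on) auto
  have step: "expectation (\<lambda>\<omega>. f (Y (Suc n) \<omega>, Q (Suc n) \<omega>)) = (\<integral>q. g q \<partial>distr M borel (Q (Suc n)))" for n
  proof -
    have "expectation (\<lambda>\<omega>. f (Y (Suc n) \<omega>, Q (Suc n) \<omega>)) = expectation (\<lambda>\<omega>. g (Q (Suc n) \<omega>))"
      unfolding g_def
      by (rule expectation_indep_Fubini[OF ind law fm2], rule integrable_const_bound[where B=B])
         (use B Ym[of n] Qm[of n] in auto)
    then show ?thesis using gm Qm by (simp add: integral_distr)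
  qed
  have lim: "(\<lambda>n. \<integral>q. g q \<partial>distr M borel (Q (Suc n))) \<longlonglongrightarrow> (\<integral>q. g q \<partial>std_normal_distribution)"
    by (rule weak_conv_imp_integral_bdd_continuous_conv[OF _ _ conv gc gB])
       (auto simp: N.real_distribution_axioms intro!: real_distribution_distr Qm)
  have "(\<integral>q. g q \<partial>std_normal_distribution) = (\<integral>p. f p * (\<phi> (fst p) * \<phi> (snd p)) \<partial>lborel)"
  proof -
    have int: "integrable (std_normal_distribution \<Otimes>\<^sub>M std_normal_distribution) f"
      by (rule P.integrable_const_bound[where B=B]) (use B in auto)
    then have "(\<integral>q. g q \<partial>std_normal_distribution) = integral\<^sup>L (std_normal_distribution \<Otimes>\<^sub>M std_normal_distribution) f"
      unfolding g_def using P.integral_snd[of "\<lambda>y q. f (y, q)"] by simp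
    also have "std_normal_distribution \<Otimes>\<^sub>M std_normal_distribution =
        density (lborel \<Otimes>\<^sub>M lborel) (\<lambda>(x, y). ennreal (\<phi> x) * ennreal (\<phi> y))"
      by (rule pair_measure_density) (auto simp: N.sigma_finite_measure_axioms lborel.sigma_finite_measure_axioms)
    also have "\<dots> = density (lborel \<Otimes>\<^sub>M lborel) (\<lambda>p. ennreal (\<phi> (fst p) * \<phi> (snd p)))"
      by (rule density_cong) (auto simp: ennreal_mult split_beta simp del: lborel_prod)
    also have "\<dots> = density lborel (\<lambda>p. ennreal (\<phi> (fst p) * \<phi> (snd p)))"
      by (simp only: lborel_prod)
    also have "integral\<^sup>L \<dots> f = (\<integral>p. (\<phi> (fst p) * \<phi> (snd p)) *\<^sub>R f p \<partial>lborel)"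
      by (rule integral_density) auto
    finally show ?thesis by (simp add: mult.commute)
  qed
  with lim step have "(\<lambda>n. expectation (\<lambda>\<omega>. f (Y (Suc n) \<omega>, Q (Suc n) \<omega>))) \<longlonglongrightarrow>
     (\<integral>p. f p * (\<phi> (fst p) * \<phi> (snd p)) \<partial>lborel)" by simp
  then show "(\<lambda>n. expectation (\<lambda>\<omega>. f (Y n \<omega>, Q n \<omega>))) \<longlonglongrightarrow>
     (\<integral>p. f p * (\<phi> (fst p) * \<phi> (snd p)) \<partial>lborel)"
    by (rule LIMSEQ_imp_Suc)
qed

lemma emeasure_std_normal_singleton: "emeasure std_normal_distribution {z} = 0"
  by (simp add: emeasure_density nn_integral_indicator_singleton[of z lborel "\<lambda>x. ennreal (\<phi> x)"])

lemma cdf_std_normal: "cdf std_normal_distribution = Phi"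
  by (rule ext) (simp add: cdf_def Phi_eq_measure)


section \<open>Triangular arrays of standard normal coordinates\<close>

locale std_normal_array = prob_space M for M :: "'a measure" +
  fixes Z :: "nat \<Rightarrow> nat \<Rightarrow> 'a \<Rightarrow> real"
  assumes row: "\<And>n. 1 \<le> n \<Longrightarrow> indep_std_normals M (Z n) {..<n}"
begin

definition chi :: "nat \<Rightarrow> 'a \<Rightarrow> real" where
  "chi n \<omega> = (\<Sum>i\<in>{1..<n}. (Z n i \<omega>)\<^sup>2)"

definition std_chi :: "nat \<Rightarrow> 'a \<Rightarrow> real" where
  "std_chi n \<omega> = (chi n \<omega> - (real n - 1)) / sqrt (2 * real n)"

lemma tail_row: "1 \<le> n \<Longrightarrow> indep_std_normals M (Z n) {1..<n}"
  by (rule indep_std_normals_subset[OF row]) auto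

lemma chi_eq: "1 \<le> n \<Longrightarrow> indep_std_normals.chi2 (Z n) {1..<n} = chi n"
  by (rule ext) (simp only: chi_def indep_std_normals.chi2_def[OF tail_row])

lemma card_tail: "1 \<le> n \<Longrightarrow> real (card {1..<n}) = real n - 1"
  by (simp add: of_nat_diff)

lemma std_chi_eq: "1 \<le> n \<Longrightarrow> std_chi n = indep_std_normals.std_chi2 (Z n) {1..<n}"
  by (rule ext) (simp only: std_chi_def indep_std_normals.std_chi2_def[OF tail_row] chi_eq card_tail diff_add_cancel)

lemma chi_measurable: "1 \<le> n \<Longrightarrow> random_variable borel (chi n)"
  using indep_std_normals.chi2_measurable[OF tail_row] by (simp only: chi_eq)

lemma chi_integrable: "1 \<le> n \<Longrightarrow> integrable M (chi n)"
  using indep_std_normals.integrable_chi2[OF tail_row] by (simp only: chi_eq)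

lemma chi_expectation: "1 \<le> n \<Longrightarrow> expectation (chi n) = real n - 1"
  using indep_std_normals.chi2_moments(2)[OF tail_row] by (simp only: chi_eq card_tail)

lemma chi_fourth_moment:
  assumes n: "1 \<le> n"
  shows "integrable M (\<lambda>\<omega>. (chi n \<omega> - (real n - 1)) ^ 4)"
    and "expectation (\<lambda>\<omega>. (chi n \<omega> - (real n - 1)) ^ 4) \<le> 60 * (real n - 1)\<^sup>2"
  using indep_std_normals.chi2_moments(1)[OF tail_row[OF n], of 4] indep_std_normals.chi2_moments(4)[OF tail_row[OF n]]
  by (simp_all only: chi_eq[OF n] card_tail[OF n])

lemma std_chi_measurable: "1 \<le> n \<Longrightarrow> random_variable borel (std_chi n)"
  using indep_std_normals.std_chi2_measurable[OF tail_row] by (simp only: std_chi_eq)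

lemma std_chi_integrable: "1 \<le> n \<Longrightarrow> integrable M (std_chi n)"
  using indep_std_normals.integrable_std_chi2[OF tail_row] by (simp only: std_chi_eq)

lemma std_chi_second_moment:
  assumes n: "1 \<le> n"
  shows "integrable M (\<lambda>\<omega>. (std_chi n \<omega>)\<^sup>2)" and "expectation (\<lambda>\<omega>. (std_chi n \<omega>)\<^sup>2) \<le> 1"
  using indep_std_normals.std_chi2_second_moment[OF tail_row[OF n]] by (simp_all only: std_chi_eq[OF n])

lemma kolmogorov:
  assumes n: "1 \<le> n"
  shows "\<bar>prob {\<omega> \<in> space M. std_chi n \<omega> \<le> z} - Phi z\<bar> \<le> sqrt (2 * real n - 1) / real n"
  using indep_std_normals.kolmogorov_bound[OF tail_row[OF n], of z]
  by (simp only: std_chi_eq[OF n] card_tail[OF n] diff_add_cancel)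

lemma kolmogorov_sup:
  "1 \<le> n \<Longrightarrow> (SUP z. \<bar>prob {\<omega> \<in> space M. std_chi n \<omega> \<le> z} - Phi z\<bar>) \<le> sqrt (2 * real n - 1) / real n"
  by (rule cSUP_least) (use kolmogorov in auto)

lemma stein_row:
  assumes n: "1 \<le> n"
  shows "prob {\<omega> \<in> space M. std_chi n \<omega> \<le> z} - Phi z =
    expectation (\<lambda>\<omega>. stein_deriv z (std_chi n \<omega>) * (1 - chi n \<omega> / real n))"
  using indep_std_normals.stein_identity[OF tail_row[OF n], of z]
  by (simp only: std_chi_eq[OF n] card_tail[OF n] chi_eq[OF n] diff_add_cancel)

lemma kolmogorov_tendsto:
  "(\<lambda>n. prob {\<omega> \<in> space M. std_chi (Suc n) \<omega> \<le> z n} - Phi (z n)) \<longlonglongrightarrow> 0"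
proof (rule Lim_null_comparison[OF always_eventually])
  show "(\<lambda>n. sqrt (2 * real (Suc n) - 1) / real (Suc n)) \<longlonglongrightarrow> 0" by real_asymp
  show "\<forall>n. norm (prob {\<omega> \<in> space M. std_chi (Suc n) \<omega> \<le> z n} - Phi (z n)) \<le> sqrt (2 * real (Suc n) - 1) / real (Suc n)"
    unfolding real_norm_def by (intro allI kolmogorov) simp
qed

text \<open>Q_n is not centred: it is the centred variable minus a deterministic term tending to 0.
  The bound being uniform in z, it can be evaluated at the moving point \<open>z + d n\<close>, and
  continuity of Phi does the rest.\<close>

lemma weak_conv_shift:
  assumes d: "d \<longlonglongrightarrow> 0"
  shows "weak_conv_m (\<lambda>n. distr M borel (\<lambda>\<omega>. std_chi (Suc n) \<omega> - d n)) std_normal_distribution"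
  unfolding weak_conv_m_def weak_conv_def cdf_std_normal
proof (intro allI impI)
  fix z
  have cdf: "cdf (distr M borel (\<lambda>\<omega>. std_chi (Suc n) \<omega> - d n)) z = prob {\<omega> \<in> space M. std_chi (Suc n) \<omega> \<le> z + d n}" for n
  proof -
    have [measurable]: "random_variable borel (std_chi (Suc n))" by (rule std_chi_measurable) simp
    have "(\<lambda>\<omega>. std_chi (Suc n) \<omega> - d n) -` {..z} \<inter> space M = {\<omega> \<in> space M. std_chi (Suc n) \<omega> \<le> z + d n}"
      by (auto simp: algebra_simps)
    then show ?thesis unfolding cdf_def by (subst measure_distr) auto
  qed
  have "(\<lambda>n. z + d n) \<longlonglongrightarrow> z" using tendsto_add[OF tendsto_const d, of z] by simp
  then have "(\<lambda>n. Phi (z + d n)) \<longlonglongrightarrow> Phi z" by (rule isCont_tendsto_compose[OF isCont_Phi])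
  from tendsto_add[OF kolmogorov_tendsto[of "\<lambda>n. z + d n"] this]
  show "(\<lambda>n. cdf (distr M borel (\<lambda>\<omega>. std_chi (Suc n) \<omega> - d n)) z) \<longlonglongrightarrow> Phi z"
    unfolding cdf by simp
qed

text \<open>Weak convergence alone does not give the limit of E[F f_z'(F)], since the integrand
  grows linearly and jumps at z. Second moments at most 1 control the growth, and the normal law has
  no atom at z.\<close>

lemma exact_asymptotics:
  "(\<lambda>n. real n / sqrt (2 * real n - 1) * (prob {\<omega> \<in> space M. std_chi n \<omega> \<le> z} - Phi z))
      \<longlonglongrightarrow> - ((z\<^sup>2 - 1) * \<phi> z) / 3"
proof -
  define \<mu> where "\<mu> n = distr M borel (std_chi (Suc n))" for n
  have one: "1 \<le> Suc n" for n by simp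
  note F_meas[measurable] = std_chi_measurable[OF one]
  have \<mu>: "real_distribution (\<mu> n)" for n unfolding \<mu>_def by (rule real_distribution_distr) (rule F_meas)
  have weak: "weak_conv_m \<mu> std_normal_distribution"
    using weak_conv_shift[of "\<lambda>_. 0"] unfolding \<mu>_def[abs_def] by simp
  have lim: "(\<lambda>n. \<integral>x. x * stein_deriv z x \<partial>\<mu> n) \<longlonglongrightarrow> (\<integral>x. x * stein_deriv z x \<partial>std_normal_distribution)"
  proof (rule weak_conv_linear_growth[OF \<mu> real_dist_normal_dist weak, where z=z])
    show "\<bar>x * stein_deriv z x\<bar> \<le> \<bar>x\<bar>" for x
      using mult_left_mono[OF stein_deriv_bound[of z x], of "\<bar>x\<bar>"] by (simp add: abs_mult)
    show "isCont (\<lambda>x. x * stein_deriv z x) x" if "x \<noteq> z" for x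
    proof -
      have "isCont (stein z) x" using continuous_on_stein[of UNIV z] by (simp add: continuous_on_eq_continuous_at)
      moreover have "isCont (indicator {..z} :: real \<Rightarrow> real) x"
        using that by (simp add: isCont_indicator)
      ultimately show ?thesis unfolding stein_deriv_def by (intro continuous_intros)
    qed
    show "integrable (\<mu> n) (\<lambda>x. x\<^sup>2)" for n
      unfolding \<mu>_def by (subst integrable_distr_eq) (use std_chi_second_moment(1)[OF one] in auto)
    show "(\<integral>x. x\<^sup>2 \<partial>\<mu> n) \<le> 1" for n
      unfolding \<mu>_def by (subst integral_distr) (use std_chi_second_moment(2)[OF one] in auto)
    show "integrable std_normal_distribution (\<lambda>x. x\<^sup>2)" by (rule integrable_std_normal_distribution_moment)
    show "(\<integral>x. x\<^sup>2 \<partial>std_normal_distribution) \<le> 1"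
      using std_normal_distribution_even_moments(1)[of 1] by simp
  qed (simp_all add: emeasure_std_normal_singleton)
  \<comment> \<open>Boundedness of e suffices, because its coefficient tends to 0.\<close>
  define e where "e n = expectation (\<lambda>\<omega>. stein_deriv z (std_chi (Suc n) \<omega>))" for n
  have eb: "\<bar>e n\<bar> \<le> 1" for n
  proof -
    have "\<bar>e n\<bar> \<le> expectation (\<lambda>\<omega>. \<bar>stein_deriv z (std_chi (Suc n) \<omega>)\<bar>)" unfolding e_def by (rule integral_abs_bound)
    also have "\<dots> \<le> 1"
      by (rule integral_le_const) (use stein_deriv_bound in \<open>auto intro!: integrable_const_bound[where B=1]\<close>)
    finally show ?thesis .
  qed
  have eq: "real (Suc n) / sqrt (2 * real (Suc n) - 1) * (prob {\<omega> \<in> space M. std_chi (Suc n) \<omega> \<le> z} - Phi z) =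
     e n / sqrt (2 * real (Suc n) - 1) - sqrt (2 * real (Suc n)) / sqrt (2 * real (Suc n) - 1) * (\<integral>x. x * stein_deriv z x \<partial>\<mu> n)" for n
  proof -
    define m where "m = real (Suc n)"
    have m: "0 < m" by (simp add: m_def)
    define s where "s = sqrt (2 * m)"
    have s: "0 < s" "s * s = 2 * m" using m by (simp_all add: s_def)
    have E: "(\<integral>x. x * stein_deriv z x \<partial>\<mu> n) = expectation (\<lambda>\<omega>. std_chi (Suc n) \<omega> * stein_deriv z (std_chi (Suc n) \<omega>))"
      unfolding \<mu>_def by (subst integral_distr) auto
    have k: "stein_deriv z (std_chi (Suc n) \<omega>) * (1 - chi (Suc n) \<omega> / m) =
      (1 / m) * stein_deriv z (std_chi (Suc n) \<omega>) - (s / m) * (std_chi (Suc n) \<omega> * stein_deriv z (std_chi (Suc n) \<omega>))" for \<omega>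
    proof -
      have chi: "chi (Suc n) \<omega> = s * std_chi (Suc n) \<omega> + (m - 1)"
        unfolding std_chi_def m_def[symmetric] s_def[symmetric] using s(1) by simp
      show ?thesis unfolding chi using m by (simp add: field_simps)
    qed
    have i1: "integrable M (\<lambda>\<omega>. stein_deriv z (std_chi (Suc n) \<omega>))"
      by (rule integrable_const_bound[where B=1]) (use stein_deriv_bound in auto)
    have i2: "integrable M (\<lambda>\<omega>. std_chi (Suc n) \<omega> * stein_deriv z (std_chi (Suc n) \<omega>))"
      by (rule integrable_mult_bounded[OF std_chi_integrable[OF one] stein_deriv_bound]) measurable
    have "prob {\<omega> \<in> space M. std_chi (Suc n) \<omega> \<le> z} - Phi z = (1 / m) * e n - (s / m) * (\<integral>x. x * stein_deriv z x \<partial>\<mu> n)"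
      unfolding stein_row[OF one] m_def[symmetric] k E e_def
      using i1 i2 by simp
    then show ?thesis unfolding m_def[symmetric] s_def[symmetric] using m by (simp add: right_diff_distrib)
  qed
  have "(\<lambda>n. e n / sqrt (2 * real (Suc n) - 1)) \<longlonglongrightarrow> 0"
  proof (rule Lim_null_comparison[OF always_eventually])
    show "(\<lambda>n. 1 / sqrt (2 * real (Suc n) - 1)) \<longlonglongrightarrow> 0" by real_asymp
    show "\<forall>n. norm (e n / sqrt (2 * real (Suc n) - 1)) \<le> 1 / sqrt (2 * real (Suc n) - 1)"
      using eb by (auto simp: intro!: divide_right_mono)
  qed
  moreover have "(\<lambda>n. sqrt (2 * real (Suc n)) / sqrt (2 * real (Suc n) - 1)) \<longlonglongrightarrow> 1" by real_asymp
  ultimately have "(\<lambda>n. e n / sqrt (2 * real (Suc n) - 1) -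
      sqrt (2 * real (Suc n)) / sqrt (2 * real (Suc n) - 1) * (\<integral>x. x * stein_deriv z x \<partial>\<mu> n)) \<longlonglongrightarrow>
      0 - 1 * ((z\<^sup>2 - 1) * \<phi> z / 3)"
    using lim unfolding stein_limit_constant by (intro tendsto_diff tendsto_mult)
  then show ?thesis unfolding eq[symmetric] by - (rule LIMSEQ_imp_Suc, simp)
qed

lemma kolmogorov_two_sided:
  "\<exists>C. 0 < C \<and> C < 1 \<and> (\<exists>n0\<ge>(1::nat). \<forall>n\<ge>n0.
          C < real n / sqrt (2 * real n - 1) * (SUP z. \<bar>prob {\<omega> \<in> space M. std_chi n \<omega> \<le> z} - Phi z\<bar>) \<and>
          real n / sqrt (2 * real n - 1) * (SUP z. \<bar>prob {\<omega> \<in> space M. std_chi n \<omega> \<le> z} - Phi z\<bar>) \<le> 1)"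
proof -
  \<comment> \<open>The limit of the rescaled difference at z = 0 is \<phi>(0)/3; half of it is
    eventually exceeded, and the supremum dominates the value at 0.\<close>
  define C where "C = \<phi> 0 / 6"
  have C0: "0 < C" unfolding C_def using std_normal_density_positive[of 0] by simp
  have "1 \<le> sqrt (2 * pi)" using pi_gt3 by simp
  then have "\<phi> 0 \<le> 1" unfolding std_normal_density_def by simp
  then have C1: "C < 1" by (simp add: C_def)
  have "C < - ((0\<^sup>2 - 1) * \<phi> 0) / 3" using std_normal_density_positive[of 0] by (simp add: C_def)
  from order_tendstoD(1)[OF exact_asymptotics this] obtain n1 where
    n1: "\<And>n. n1 \<le> n \<Longrightarrow> C < real n / sqrt (2 * real n - 1) * (prob {\<omega> \<in> space M. std_chi n \<omega> \<le> 0} - Phi 0)"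
    unfolding eventually_sequentially by blast
  show ?thesis
  proof (intro exI[of _ C] conjI C0 C1 exI[of _ "max 1 n1"] allI impI)
    fix n assume "max 1 n1 \<le> n"
    then have n: "1 \<le> n" "n1 \<le> n" by auto
    define r where "r = real n / sqrt (2 * real n - 1)"
    have pos: "0 < sqrt (2 * real n - 1)" "0 < real n" using n by auto
    then have r: "0 < r" by (simp add: r_def)
    have "prob {\<omega> \<in> space M. std_chi n \<omega> \<le> 0} - Phi 0 \<le> \<bar>prob {\<omega> \<in> space M. std_chi n \<omega> \<le> 0} - Phi 0\<bar>" by simp
    also have "\<dots> \<le> (SUP z. \<bar>prob {\<omega> \<in> space M. std_chi n \<omega> \<le> z} - Phi z\<bar>)"
      by (rule cSUP_upper[of 0 UNIV "\<lambda>z. \<bar>prob {\<omega> \<in> space M. std_chi n \<omega> \<le> z} - Phi z\<bar>"])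
         (use kolmogorov[OF n(1)] in \<open>auto intro!: bdd_aboveI\<close>)
    finally have "r * (prob {\<omega> \<in> space M. std_chi n \<omega> \<le> 0} - Phi 0) \<le> r * (SUP z. \<bar>prob {\<omega> \<in> space M. std_chi n \<omega> \<le> z} - Phi z\<bar>)"
      using r by (intro mult_left_mono) auto
    with n1[OF n(2)]
    show "C < real n / sqrt (2 * real n - 1) * (SUP z. \<bar>prob {\<omega> \<in> space M. std_chi n \<omega> \<le> z} - Phi z\<bar>)"
      unfolding r_def by linarith
    have "r * (SUP z. \<bar>prob {\<omega> \<in> space M. std_chi n \<omega> \<le> z} - Phi z\<bar>) \<le> r * (sqrt (2 * real n - 1) / real n)"
      using r kolmogorov_sup[OF n(1)] by (intro mult_left_mono) auto
    also have "\<dots> = 1" using pos by (simp add: r_def)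
    finally show "real n / sqrt (2 * real n - 1) * (SUP z. \<bar>prob {\<omega> \<in> space M. std_chi n \<omega> \<le> z} - Phi z\<bar>) \<le> 1"
      unfolding r_def .
  qed simp
qed

text \<open>Fourth moments of order n^2 against n^4 give the summable 1/n^2; second moments would
  give only 1/n.\<close>

lemma strong_law:
  "AE \<omega> in M. (\<lambda>n. (chi (Suc n) \<omega> - (real (Suc n) - 1)) / real (Suc n)) \<longlonglongrightarrow> 0"
proof (rule AE_tendsto_zero_of_summable_moments[where k=2 and a="\<lambda>n. 60 * (1 / real (Suc n) ^ 2)"])
  show "(\<lambda>\<omega>. (chi (Suc n) \<omega> - (real (Suc n) - 1)) / real (Suc n)) \<in> borel_measurable M" for n
    using chi_measurable[of "Suc n"] by simp
  have e: "((chi (Suc n) \<omega> - (real (Suc n) - 1)) / real (Suc n)) ^ (2 * 2) =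
    (chi (Suc n) \<omega> - (real (Suc n) - 1)) ^ 4 / real (Suc n) ^ 4" for n \<omega> by (simp only: power_divide) simp
  show "integrable M (\<lambda>\<omega>. ((chi (Suc n) \<omega> - (real (Suc n) - 1)) / real (Suc n)) ^ (2 * 2))" for n
    unfolding e using chi_fourth_moment(1)[of "Suc n"] by (intro integrable_divide) simp
  show "expectation (\<lambda>\<omega>. ((chi (Suc n) \<omega> - (real (Suc n) - 1)) / real (Suc n)) ^ (2 * 2)) \<le> 60 * (1 / real (Suc n) ^ 2)" for n
  proof -
    define m where "m = real (Suc n)"
    have m: "1 \<le> m" by (simp add: m_def)
    have "expectation (\<lambda>\<omega>. ((chi (Suc n) \<omega> - (real (Suc n) - 1)) / real (Suc n)) ^ (2 * 2)) =
          expectation (\<lambda>\<omega>. (chi (Suc n) \<omega> - (m - 1)) ^ 4) / m ^ 4"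
      unfolding e m_def by simp
    also have "\<dots> \<le> 60 * (m - 1)\<^sup>2 / m ^ 4"
      using chi_fourth_moment(2)[of "Suc n"] m unfolding m_def by (intro divide_right_mono) auto
    also have "\<dots> \<le> 60 * m\<^sup>2 / m ^ 4"
      using m by (intro divide_right_mono mult_left_mono power_mono) auto
    also have "\<dots> = 60 * (1 / m ^ 2)" using m by (simp add: eval_nat_numeral field_simps)
    finally show ?thesis unfolding m_def .
  qed
  show "summable (\<lambda>n. 60 * (1 / real (Suc n) ^ 2))"
    using inverse_power_summable[of 2, where 'a=real]
    by (intro summable_mult) (subst summable_Suc_iff[of "\<lambda>n. 1 / real n ^ 2"], simp add: inverse_eq_divide)
qed simp

lemma scaled_first_coordinate_tendsto:
  assumes d: "0 < d" and \<gamma>: "0 < \<gamma>" and TL: "\<And>n. 1 \<le> n \<Longrightarrow> d * real n powr \<gamma> \<le> T n"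
  shows "AE \<omega> in M. (\<lambda>n. Z (Suc n) 0 \<omega> / sqrt (T (Suc n))) \<longlonglongrightarrow> 0"
proof -
  have Tpos: "0 < T n" if "1 \<le> n" for n
    by (rule less_le_trans[OF _ TL[OF that]]) (use d that in simp)
  \<comment> \<open>The exponent \<gamma> may be small, so the order of the moments is adapted to
    it: \<gamma>k \<ge> 2 makes the moment of order 2k decay at least like 1/n^2.\<close>
  obtain k :: nat where k: "2 / \<gamma> \<le> real k" using real_arch_simple by blast
  then have k2: "2 \<le> \<gamma> * real k" using \<gamma> by (simp add: field_simps)
  then have k0: "0 < k" using \<gamma> by (cases k) auto
  define K where "K = (fact (2 * k) / (2 ^ k * fact k) :: real)"
  have K: "0 \<le> K" by (simp add: K_def)
  show "AE \<omega> in M. (\<lambda>n. Z (Suc n) 0 \<omega> / sqrt (T (Suc n))) \<longlonglongrightarrow> 0"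
  proof (rule AE_tendsto_zero_of_summable_moments[where k=k and a="\<lambda>n. K / d ^ k * (1 / real (Suc n) ^ 2)"])
    fix n
    have Zn: "indep_std_normals M (Z (Suc n)) {..<Suc n}" by (rule row) simp
    have Tn: "0 < T (Suc n)" by (rule Tpos) simp
    show "(\<lambda>\<omega>. Z (Suc n) 0 \<omega> / sqrt (T (Suc n))) \<in> borel_measurable M"
      using indep_std_normals.Z_measurable[OF Zn, of 0] by simp
    have e: "(Z (Suc n) 0 \<omega> / sqrt (T (Suc n))) ^ (2 * k) = Z (Suc n) 0 \<omega> ^ (2 * k) / T (Suc n) ^ k" for \<omega>
      using Tn by (simp add: power_divide power_mult)
    show "integrable M (\<lambda>\<omega>. (Z (Suc n) 0 \<omega> / sqrt (T (Suc n))) ^ (2 * k))"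
      unfolding e using indep_std_normals.integrable_Z_power[OF Zn, of 0] by (intro integrable_divide) simp
    have "expectation (\<lambda>\<omega>. (Z (Suc n) 0 \<omega> / sqrt (T (Suc n))) ^ (2 * k)) = K / T (Suc n) ^ k"
      unfolding e using indep_std_normals.expectation_Z_even_power[OF Zn, of 0 k] by (simp add: K_def)
    also have "\<dots> \<le> K / (d * real (Suc n) powr \<gamma>) ^ k"
      using TL[of "Suc n"] d K Tn by (intro divide_left_mono power_mono mult_pos_pos zero_less_power) auto
    also have "(d * real (Suc n) powr \<gamma>) ^ k = d ^ k * real (Suc n) powr (\<gamma> * real k)"
      by (simp add: power_mult_distrib powr_powr[symmetric] powr_realpow)
    also have "K / (d ^ k * real (Suc n) powr (\<gamma> * real k)) \<le> K / (d ^ k * real (Suc n) powr 2)"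
      using d K k2 by (intro divide_left_mono mult_left_mono powr_mono mult_pos_pos zero_less_power) auto
    also have "\<dots> = K / d ^ k * (1 / real (Suc n) ^ 2)" by (simp add: powr_numeral)
    finally show "expectation (\<lambda>\<omega>. (Z (Suc n) 0 \<omega> / sqrt (T (Suc n))) ^ (2 * k)) \<le> K / d ^ k * (1 / real (Suc n) ^ 2)" .
  next
    show "summable (\<lambda>n. K / d ^ k * (1 / real (Suc n) ^ 2))"
      using inverse_power_summable[of 2, where 'a=real]
      by (intro summable_mult) (subst summable_Suc_iff[of "\<lambda>n. 1 / real n ^ 2"], simp add: inverse_eq_divide)
  qed (rule k0)
qed

end

text \<open>The Cauchy-Schwarz bound at the last observation and the variance bound give T_n \<ge>
  t_n^(2 - \<beta>)/c. Since 2 - \<beta> is positive, the lower bound on t_n can be inserted, which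
  yields the exponent \<alpha>(2 - \<beta>) and the constant \<open>d\<close>.\<close>

lemma information_growth:
  assumes V: "\<And>n. 1 \<le> n \<Longrightarrow> strictly_pos_def n (Vmat M G ts)" and tpos: "\<And>i. 0 < ts (Suc i)"
    and c: "0 < c" and \<beta>: "\<beta> < 2" and var: "\<And>t. 0 < t \<Longrightarrow> (\<integral>\<omega>. (G t \<omega>)\<^sup>2 \<partial>M) \<le> c * t powr \<beta>"
    and \<alpha>: "0 < \<alpha>" and c1: "0 < c1" and growth: "\<And>n. 1 \<le> n \<Longrightarrow> c1 * real n powr \<alpha> \<le> ts n"
  shows "\<exists>d>0. \<exists>\<gamma>>0. \<forall>n\<ge>1. d * real n powr \<gamma> \<le> bilin n (tvec ts) (inv_mat n (Vmat M G ts)) (tvec ts)"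
proof -
  define T where "T n = bilin n (tvec ts) (inv_mat n (Vmat M G ts)) (tvec ts)" for n
  define \<gamma> where "\<gamma> = \<alpha> * (2 - \<beta>)"
  have \<gamma>: "0 < \<gamma>" using \<alpha> \<beta> by (simp add: \<gamma>_def)
  define d where "d = c1 powr (2 - \<beta>) / c"
  have d: "0 < d" using c c1 by (simp add: d_def)
  have Tpos: "0 \<le> T n" if n: "1 \<le> n" for n
  proof -
    obtain a where a: "orthonormal_family n (Vmat M G ts) a"
      using orthonormal_family_adapted[OF V[OF n] n] by blast
    show ?thesis unfolding T_def bilin_inv_mat_orthonormal[OF V[OF n] a] by (simp add: sum_nonneg)
  qed
  have TL: "d * real n powr \<gamma> \<le> T n" if n: "1 \<le> n" for n
  proof -
    obtain k where k: "n = Suc k" using n by (cases n) auto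
    have tn: "0 < ts n" using tpos[of k] k by simp
    have "(ts n)\<^sup>2 \<le> Vmat M G ts k k * T n"
      using inv_mat_Cauchy_Schwarz[OF V[OF n], of k "tvec ts"] unfolding T_def tvec_def k by simp
    also have "\<dots> \<le> (c * ts n powr \<beta>) * T n"
      using var[OF tn] Tpos[OF n] by (intro mult_right_mono) (auto simp: Vmat_def Rcov_def k power2_eq_square)
    finally have "ts n powr 2 \<le> (c * T n) * ts n powr \<beta>" using tn by (simp add: powr_numeral mult_ac)
    then have "ts n powr 2 / ts n powr \<beta> \<le> c * T n" using tn by (simp add: divide_le_eq)
    then have "ts n powr (2 - \<beta>) \<le> c * T n" by (simp add: powr_diff)
    moreover have "(c1 * real n powr \<alpha>) powr (2 - \<beta>) \<le> ts n powr (2 - \<beta>)"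
      using growth[OF n] c1 \<beta> by (intro powr_mono2) auto
    moreover have "(c1 * real n powr \<alpha>) powr (2 - \<beta>) = c1 powr (2 - \<beta>) * real n powr \<gamma>"
      using c1 by (simp add: powr_mult powr_powr \<gamma>_def)
    ultimately show ?thesis unfolding d_def using c by (simp add: field_simps)
  qed
  show ?thesis using d \<gamma> TL unfolding T_def by blast
qed

section \<open>Transfer from the array of coordinates to the estimators\<close>

theorem theorem1p2:
  fixes M :: "'a measure" and G :: "real \<Rightarrow> 'a \<Rightarrow> real"
    and ts :: "nat \<Rightarrow> real" and mu sg :: real
  assumes "prob_space M"
    and "centered_gaussian_process M G"
    and "sg > 0"
    and "ts 1 > 0" and "\<And>i. i \<ge> 1 \<Longrightarrow> ts i < ts (Suc i)"
    and H2: "\<And>n. n \<ge> 1 \<Longrightarrow> strictly_pos_def n (Vmat M G ts)"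
  shows
    "((\<exists>c>0. \<exists>\<beta><2. \<forall>t>0. (\<integral>\<omega>. (G t \<omega>)\<^sup>2 \<partial>M) \<le> c * t powr \<beta>) \<and>
      (\<exists>\<alpha>>0. \<exists>c1>0. \<exists>c2>0. \<forall>n\<ge>1. c1 * real n powr \<alpha> \<le> ts n \<and> ts n \<le> c2 * real n powr \<alpha>)
      \<longrightarrow> (AE \<omega> in M. (\<lambda>n. mu_hat M G mu sg ts n \<omega>) \<longlonglongrightarrow> mu) \<and>
          (AE \<omega> in M. (\<lambda>n. sigma2_hat M G mu sg ts n \<omega>) \<longlonglongrightarrow> sg\<^sup>2))
     \<and> conv_law_std_normal2 M (Yn M G mu sg ts) (Qn M G mu sg ts)
     \<and> (\<forall>n\<ge>1. (SUP z. \<bar>measure M {\<omega>\<in>space M. Qbar M G mu sg ts n \<omega> \<le> z} - Phi z\<bar>)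
                  \<le> sqrt (2 * real n - 1) / real n)
     \<and> (\<forall>z. (\<lambda>n. real n / sqrt (2 * real n - 1) *
               (measure M {\<omega>\<in>space M. Qbar M G mu sg ts n \<omega> \<le> z} - Phi z))
            \<longlonglongrightarrow> - ((z\<^sup>2 - 1) * std_normal_density z) / 3)
     \<and> (\<exists>C. 0 < C \<and> C < 1 \<and> (\<exists>n0\<ge>(1::nat). \<forall>n\<ge>n0.
          C < real n / sqrt (2 * real n - 1) *
                (SUP z. \<bar>measure M {\<omega>\<in>space M. Qbar M G mu sg ts n \<omega> \<le> z} - Phi z\<bar>) \<and>
          real n / sqrt (2 * real n - 1) *
                (SUP z. \<bar>measure M {\<omega>\<in>space M. Qbar M G mu sg ts n \<omega> \<le> z} - Phi z\<bar>) \<le> 1))"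
proof -
  interpret prob_space M by fact
  have tpos: "0 < ts (Suc i)" for i
  proof (induction i)
    case (Suc i)
    then show ?case using assms(5)[of "Suc i"] by simp
  qed (use assms(4) in simp)
  define T where "T n = bilin n (tvec ts) (inv_mat n (Vmat M G ts)) (tvec ts)" for n
  note rep = mle_representation[OF assms(2) tpos assms(3) H2, folded T_def]
  have Tpos: "0 < T n" if "1 \<le> n" for n using rep(1)[OF that that] .
  \<comment> \<open>The condition \<open>1 \<le> n\<close> is moved under the quantifier so that
    choice yields one array for all n; its row 0 is arbitrary.\<close>
  have "\<forall>n. \<exists>Z. 1 \<le> n \<longrightarrow> indep_std_normals M Z {..<n} \<and>
    (\<forall>\<omega>. mu_hat M G mu sg ts n \<omega> = mu + sg * (Z 0 \<omega> / sqrt (T n))) \<and>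
    (\<forall>\<omega>. sigma2_hat M G mu sg ts n \<omega> = sg\<^sup>2 / real n * (\<Sum>i\<in>{1..<n}. (Z i \<omega>)\<^sup>2))"
    using rep(2) by blast
  from choice[OF this] obtain Z where
    Z: "\<And>n. 1 \<le> n \<Longrightarrow> indep_std_normals M (Z n) {..<n}" and
    mu: "\<And>n \<omega>. 1 \<le> n \<Longrightarrow> mu_hat M G mu sg ts n \<omega> = mu + sg * (Z n 0 \<omega> / sqrt (T n))" and
    sigma: "\<And>n \<omega>. 1 \<le> n \<Longrightarrow> sigma2_hat M G mu sg ts n \<omega> = sg\<^sup>2 / real n * (\<Sum>i\<in>{1..<n}. (Z n i \<omega>)\<^sup>2)"
    by blast
  interpret A: std_normal_array M Z
    by (intro std_normal_array.intro std_normal_array_axioms.intro prob_space_axioms Z)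
  have Q: "Qn M G mu sg ts n = (\<lambda>\<omega>. (A.chi n \<omega> - real n) / sqrt (2 * real n))" if n: "1 \<le> n" for n
  proof
    fix \<omega>
    have "sqrt (real n / 2) * sqrt (2 * real n) = real n" by (simp add: real_sqrt_mult[symmetric])
    then have s: "sqrt (real n / 2) = real n / sqrt (2 * real n)" using n by (simp add: field_simps)
    show "Qn M G mu sg ts n \<omega> = (A.chi n \<omega> - real n) / sqrt (2 * real n)"
      unfolding Qn_def sigma[OF n] A.chi_def[symmetric] s using n assms(3) by (simp add: field_simps)
  qed
  \<comment> \<open>The chi-square sum has mean n - 1 but is compared with n in Q_n; centring
    therefore only replaces n by n - 1.\<close>
  have EQ: "expectation (Qn M G mu sg ts n) = - (1 / sqrt (2 * real n))" if n: "1 \<le> n" for n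
    unfolding Q[OF n] using A.chi_integrable[OF n] A.chi_expectation[OF n] by (simp add: prob_space)
  have Qb: "Qbar M G mu sg ts n = A.std_chi n" if n: "1 \<le> n" for n
    by (rule ext) (simp only: Qbar_def EQ[OF n], simp add: Q[OF n] A.std_chi_def diff_divide_distrib)

  have a: "\<forall>n\<ge>1. (SUP z. \<bar>prob {\<omega> \<in> space M. Qbar M G mu sg ts n \<omega> \<le> z} - Phi z\<bar>) \<le> sqrt (2 * real n - 1) / real n"
    using A.kolmogorov_sup by (simp add: Qb)
  have b: "\<forall>z. (\<lambda>n. real n / sqrt (2 * real n - 1) * (prob {\<omega> \<in> space M. Qbar M G mu sg ts n \<omega> \<le> z} - Phi z))
      \<longlonglongrightarrow> - ((z\<^sup>2 - 1) * \<phi> z) / 3"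
  proof
    fix z
    \<comment> \<open>The identification of the centred Q_n with the array is available from n = 1
      on, so index 0 has to be discarded.\<close>
    show "(\<lambda>n. real n / sqrt (2 * real n - 1) * (prob {\<omega> \<in> space M. Qbar M G mu sg ts n \<omega> \<le> z} - Phi z))
      \<longlonglongrightarrow> - ((z\<^sup>2 - 1) * \<phi> z) / 3"
      by (rule Lim_transform_eventually[OF A.exact_asymptotics])
         (auto simp: eventually_sequentially Qb intro!: exI[of _ 1])
  qed
  have c: "\<exists>C. 0 < C \<and> C < 1 \<and> (\<exists>n0\<ge>(1::nat). \<forall>n\<ge>n0.
      C < real n / sqrt (2 * real n - 1) * (SUP z. \<bar>prob {\<omega> \<in> space M. Qbar M G mu sg ts n \<omega> \<le> z} - Phi z\<bar>) \<and>
      real n / sqrt (2 * real n - 1) * (SUP z. \<bar>prob {\<omega> \<in> space M. Qbar M G mu sg ts n \<omega> \<le> z} - Phi z\<bar>) \<le> 1)"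
  proof -
    obtain C n0 where C: "0 < C" "C < 1" and n0: "1 \<le> (n0::nat)" and b2: "\<forall>n\<ge>n0.
          C < real n / sqrt (2 * real n - 1) * (SUP z. \<bar>prob {\<omega> \<in> space M. A.std_chi n \<omega> \<le> z} - Phi z\<bar>) \<and>
          real n / sqrt (2 * real n - 1) * (SUP z. \<bar>prob {\<omega> \<in> space M. A.std_chi n \<omega> \<le> z} - Phi z\<bar>) \<le> 1"
      using A.kolmogorov_two_sided by blast
    show ?thesis
      by (intro exI[of _ C] exI[of _ n0] conjI C n0 allI impI) (use b2 n0 in \<open>simp_all add: Qb\<close>)
  qed

  have two: "conv_law_std_normal2 M (Yn M G mu sg ts) (Qn M G mu sg ts)"
  proof (rule conv_law_std_normal2_of_indep)
    fix n
    define m where "m = Suc n"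
    have m: "1 \<le> m" by (simp add: m_def)
    have Y: "Yn M G mu sg ts m = Z m 0"
      by (rule ext) (use Tpos[OF m] assms(3) in \<open>simp add: Yn_def mu[OF m] T_def[symmetric]\<close>)
    show "distr M borel (Yn M G mu sg ts (Suc n)) = std_normal_distribution"
      unfolding m_def[symmetric] Y using indep_std_normals.law[OF Z[OF m], of 0] m by simp
    have "indep_var borel (Z m 0) borel (A.chi m)"
      unfolding A.chi_def[abs_def]
      by (rule indep_std_normals.indep_Z_sum[OF Z[OF m], where h="\<lambda>x. x" and f="\<lambda>x. x\<^sup>2" and J="{1..<m}"]) (use m in auto)
    from indep_var_compose[OF this, of "\<lambda>x. x" borel "\<lambda>x. (x - real m) / sqrt (2 * real m)" borel]
    have "indep_var borel (Z m 0) borel (\<lambda>\<omega>. (A.chi m \<omega> - real m) / sqrt (2 * real m))"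
      by (simp add: comp_def)
    then show "indep_var borel (Yn M G mu sg ts (Suc n)) borel (Qn M G mu sg ts (Suc n))"
      unfolding m_def[symmetric] Y Q[OF m] .
  next
    have Q': "Qn M G mu sg ts (Suc n) = (\<lambda>\<omega>. A.std_chi (Suc n) \<omega> - 1 / sqrt (2 * real (Suc n)))" for n
      by (rule ext) (simp add: Q A.std_chi_def diff_divide_distrib add_divide_distrib)
    have "(\<lambda>n. 1 / sqrt (2 * real (Suc n))) \<longlonglongrightarrow> 0" by real_asymp
    from A.weak_conv_shift[OF this]
    show "weak_conv_m (\<lambda>n. distr M borel (Qn M G mu sg ts (Suc n))) std_normal_distribution"
      unfolding Q' .
  qed fact

  have one_sigma: "AE \<omega> in M. (\<lambda>n. sigma2_hat M G mu sg ts n \<omega>) \<longlonglongrightarrow> sg\<^sup>2"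
    using A.strong_law
  proof eventually_elim
    case (elim \<omega>)
    \<comment> \<open>The strong law is centred at n - 1; adding back (n - 1)/n, with limit 1, gives
      the average of the squares divided by n.\<close>
    have "(\<lambda>n. (real (Suc n) - 1) / real (Suc n)) \<longlonglongrightarrow> 1" by real_asymp
    from tendsto_mult_left[OF tendsto_add[OF elim this], of "sg\<^sup>2"]
    have "(\<lambda>n. sg\<^sup>2 * ((A.chi (Suc n) \<omega> - (real (Suc n) - 1)) / real (Suc n) + (real (Suc n) - 1) / real (Suc n))) \<longlonglongrightarrow> sg\<^sup>2"
      by simp
    moreover have "sg\<^sup>2 * ((A.chi (Suc n) \<omega> - (real (Suc n) - 1)) / real (Suc n) + (real (Suc n) - 1) / real (Suc n)) =
        sigma2_hat M G mu sg ts (Suc n) \<omega>" for n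
      unfolding sigma[of "Suc n", simplified] A.chi_def by (simp add: add_divide_distrib[symmetric])
    ultimately show ?case by - (rule LIMSEQ_imp_Suc, simp)
  qed

  have one_mu: "AE \<omega> in M. (\<lambda>n. mu_hat M G mu sg ts n \<omega>) \<longlonglongrightarrow> mu"
    if c: "0 < c" and \<beta>: "\<beta> < 2" and var: "\<forall>t>0. (\<integral>\<omega>. (G t \<omega>)\<^sup>2 \<partial>M) \<le> c * t powr \<beta>"
      and \<alpha>: "0 < \<alpha>" and c1: "0 < c1" and growth: "\<forall>n\<ge>1. c1 * real n powr \<alpha> \<le> ts n \<and> ts n \<le> c2 * real n powr \<alpha>" for c \<beta> \<alpha> c1 c2
  proof -
    obtain d \<gamma> where d: "0 < d" "0 < \<gamma>" and TL: "\<forall>n\<ge>1. d * real n powr \<gamma> \<le> T n"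
      using information_growth[OF H2 tpos c \<beta> _ \<alpha> c1] var growth unfolding T_def by blast
    have "AE \<omega> in M. (\<lambda>n. Z (Suc n) 0 \<omega> / sqrt (T (Suc n))) \<longlonglongrightarrow> 0"
      using A.scaled_first_coordinate_tendsto[OF d] TL by blast
    then show ?thesis
    proof eventually_elim
      case (elim \<omega>)
      from tendsto_add[OF tendsto_const tendsto_mult_left[OF elim, of sg], of mu]
      have "(\<lambda>n. mu_hat M G mu sg ts (Suc n) \<omega>) \<longlonglongrightarrow> mu" by (simp add: mu)
      then show ?case by (rule LIMSEQ_imp_Suc)
    qed
  qed

  show ?thesis
    using one_mu one_sigma two a b c by blast
qed

end
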